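(* Let $b=(b_n)_{n\ge1}$ be a strictly increasing sequence of natural numbers which is arithmetic. Then the following statements are equivalent: (a) $\limsup_{n\to\infty}\frac{b_{n+1}}{b_n}=\infty$; (b) $|G_1(b)|>\aleph_0$; (c) $b\in\mathrm{IPRWM}$; (d) $|G_2(b)|>\aleph_0$.
   Context: $\mathbb T=\mathbb R/\mathbb Z$, $\|x\|:=\min_{n\in\mathbb Z}|x-n|$, $\mathbb N=\{1,2,\dots\}$. For $0<p<\infty$, $G_p(b):=\{t\in\mathbb T:\ \sum_{n=1}^\infty\|b_nt\|^p<\infty\}$. A strictly increasing sequence $q=(q_n)_{n\ge 1}$ of natural numbers is called arithmetic if either it is multiplicative, i.e. $q_n\mid q_{n+1}$ for all $n\ge1$, or it is the principal denominator sequence of some irrational $\alpha\in\mathbb T\setminus\mathbb Q$, i.e. $q_0=1$, $q_1=a_1$, $q_{n+1}=a_{n+1}q_n+q_{n-1}$, where $\alpha=[0;a_1,a_2,\dots]$ is the continued fraction expansion of $\alpha$. $(X,\mathcal B,m)$ denotes a standard non-atomic probability space and $\mathrm{MPT}(X,\mathcal B,m)$ the collection of its invertible $m$-preserving transformations. Let $\mathcal F$ be the collection of finite nonempty subsets of $\mathbb N$, and $b(F):=\sum_{j\in F}b_j$ for $F\in\mathcal F$. $T\in\mathrm{MPT}(X,\mathcal B,m)$ is IP-rigid along $b$ if for every $A\in\mathcal B$, $m(A\,\triangle\,T^{b(F)}A)\to0$ as $\min F\to\infty$, $F\in\mathcal F$. $\mathrm{IPRWM}$ is the set of strictly increasing sequences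 $b$ of natural numbers such that there exists a weakly mixing $T\in\mathrm{MPT}(X,\mathcal B,m)$ which is IP-rigid along $b$. *)

theory Defs
  imports "HOL-Probability.Probability"
begin

text \<open>
  A sequence \<open>b\<^sub>1, b\<^sub>2, \<dots>\<close> of natural numbers is a function \<open>b :: nat \<Rightarrow> nat\<close> of which only the
  values at positive indices are used; \<open>b 0\<close> is irrelevant throughout. Natural numbers are positive.
\<close>

definition incr_seq :: "(nat \<Rightarrow> nat) \<Rightarrow> bool" where
  "incr_seq b \<longleftrightarrow> (\<forall>n\<ge>1. 1 \<le> b n) \<and> strict_mono_on {1..} b"

definition multiplicative_seq :: "(nat \<Rightarrow> nat) \<Rightarrow> bool" where
  "multiplicative_seq q \<longleftrightarrow> (\<forall>n\<ge>1. q n dvd q (Suc n))"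

text \<open>The finite continued fraction \<open>[0; a\<^sub>1, \<dots>, a\<^sub>n]\<close> of the list \<open>[a\<^sub>1, \<dots>, a\<^sub>n]\<close>.\<close>

fun fin_cfrac :: "nat list \<Rightarrow> real" where
  "fin_cfrac [] = 0"
| "fin_cfrac (x # xs) = 1 / (real x + fin_cfrac xs)"

text \<open>\<open>\<alpha> = [0; a\<^sub>1, a\<^sub>2, \<dots>]\<close>, an infinite expansion; the value \<open>a 0\<close> is not used.\<close>

definition has_cfrac :: "real \<Rightarrow> (nat \<Rightarrow> nat) \<Rightarrow> bool" where
  "has_cfrac \<alpha> a \<longleftrightarrow>
     (\<forall>n\<ge>1. 1 \<le> a n) \<and> (\<lambda>n. fin_cfrac (map a [1..<Suc n])) \<longlonglongrightarrow> \<alpha>"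

fun cfrac_denom :: "(nat \<Rightarrow> nat) \<Rightarrow> nat \<Rightarrow> nat" where
  "cfrac_denom a 0 = 1"
| "cfrac_denom a (Suc 0) = a 1"
| "cfrac_denom a (Suc (Suc n)) = a (Suc (Suc n)) * cfrac_denom a (Suc n) + cfrac_denom a n"

text \<open>
  A point of \<open>\<real>/\<int>\<close> is represented by its representative in \<open>[0,1)\<close>, here and in \<open>G\<close> below.
\<close>

definition principal_denominator_seq :: "(nat \<Rightarrow> nat) \<Rightarrow> bool" where
  "principal_denominator_seq q \<longleftrightarrow>
     (\<exists>\<alpha>\<in>{0..<1} - \<rat>. \<exists>a. has_cfrac \<alpha> a \<and> (\<forall>n\<ge>1. q n = cfrac_denom a n))"

definition arithmetic_seq :: "(nat \<Rightarrow> nat) \<Rightarrow> bool" where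
  "arithmetic_seq q \<longleftrightarrow>
     incr_seq q \<and> (multiplicative_seq q \<or> principal_denominator_seq q)"

text \<open>
  \<open>infdist x \<int>\<close> is the distance from \<open>x\<close> to the nearest integer. It is 1-periodic, so that
  \<open>infdist (b\<^sub>n t) \<int>\<close> depends only on the class of \<open>t\<close> modulo 1.
\<close>

definition G :: "real \<Rightarrow> (nat \<Rightarrow> nat) \<Rightarrow> real set" where
  "G p b = {t \<in> {0..<1}. summable (\<lambda>n. infdist (real (b (Suc n)) * t) \<int> powr p)}"

definition standard_borel :: "'a measure \<Rightarrow> bool" where
  "standard_borel M \<longleftrightarrow>
     (\<exists>S. topspace S = space M \<and> completely_metrizable_space S \<and> second_countable S \<and>
          sets M = sigma_sets (space M) {U. openin S U})"

definition non_atomic :: "'a measure \<Rightarrow> bool" where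
  "non_atomic M \<longleftrightarrow>
     (\<forall>A\<in>sets M. 0 < emeasure M A \<longrightarrow>
        (\<exists>B\<in>sets M. B \<subseteq> A \<and> 0 < emeasure M B \<and> emeasure M B < emeasure M A))"

definition MPT :: "'a measure \<Rightarrow> ('a \<Rightarrow> 'a) set" where
  "MPT M = {T. bij_betw T (space M) (space M) \<and>
               T \<in> M \<rightarrow>\<^sub>M M \<and> the_inv_into (space M) T \<in> M \<rightarrow>\<^sub>M M \<and>
               (\<forall>A\<in>sets M. emeasure M (T -` A \<inter> space M) = emeasure M A)}"

definition weakly_mixing :: "'a measure \<Rightarrow> ('a \<Rightarrow> 'a) \<Rightarrow> bool" where
  "weakly_mixing M T \<longleftrightarrow>
     (\<forall>A\<in>sets M. \<forall>B\<in>sets M.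
        (\<lambda>n. (\<Sum>k<n. \<bar>measure M (A \<inter> (T ^^ k) -` B) - measure M A * measure M B\<bar>) / real n)
          \<longlonglongrightarrow> 0)"

text \<open>The nonempty finite subsets of \<open>{1, 2, \<dots>}\<close>, and the filter \<open>min F \<rightarrow> \<infinity>\<close> on them.\<close>

definition fin_subsets :: "nat set set" where
  "fin_subsets = {F. finite F \<and> F \<noteq> {} \<and> F \<subseteq> {1..}}"

definition Min_at_top :: "nat set filter" where
  "Min_at_top = inf (filtercomap Min at_top) (principal fin_subsets)"

definition IP_rigid :: "'a measure \<Rightarrow> ('a \<Rightarrow> 'a) \<Rightarrow> (nat \<Rightarrow> nat) \<Rightarrow> bool" where
  "IP_rigid M T b \<longleftrightarrow>
     (\<forall>A\<in>sets M.
        ((\<lambda>F. measure M (sym_diff A ((T ^^ (\<Sum>j\<in>F. b j)) ` A))) \<longlongrightarrow> 0) Min_at_top)"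

definition IPRWM :: "'a measure \<Rightarrow> (nat \<Rightarrow> nat) set" where
  "IPRWM M = {b. incr_seq b \<and> (\<exists>T\<in>MPT M. weakly_mixing M T \<and> IP_rigid M T b)}"

lemma tendsto_Min_at_top_iff:
  fixes f :: "nat set \<Rightarrow> real"
  shows "(f \<longlongrightarrow> l) Min_at_top \<longleftrightarrow>
           (\<forall>\<epsilon>>0. \<exists>N. \<forall>F\<in>fin_subsets. N \<le> Min F \<longrightarrow> \<bar>f F - l\<bar> < \<epsilon>)"
  unfolding tendsto_iff Min_at_top_def eventually_inf_principal eventually_filtercomap
    eventually_at_top_linorder dist_real_def
  by (intro iff_allI imp_cong refl) fast

end

theory Submission
  imports Defs
begin

text \<open>
  If the ratios \<open>b (n + 1) / b n\<close> are bounded, \<open>t\<close> with \<open>\<parallel>b n t\<parallel> \<longlonglongrightarrow> 0\<close> is determined by finitely many of the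
  integers nearest to \<open>b n t\<close>, so \<open>G 2 b\<close> is countable. If they are unbounded, the \<open>t = 1 / b (n + 1)\<close>, or
  \<open>t = \<parallel>b n \<alpha>\<parallel>\<close> in the continued fraction case, contain a lacunary sequence \<open>(t\<^sub>k)\<close> along which
  \<open>\<Sum>\<^sub>n \<parallel>b n t\<^sub>k\<parallel>\<close> decays geometrically. Its subset sums are uncountably many points of \<open>G 1 b\<close>, and the
  Gaussian process with covariance \<open>\<Prod>\<^sub>k cos (2 \<pi> m t\<^sub>k)\<close> gives a weakly mixing shift that is IP-rigid along \<open>b\<close>;
  it is transported to the given space by an isomorphism modulo null sets.
  Conversely, an IP-rigid weakly mixing transformation has by Herglotz an atomless spectral measure, against which
  the averages \<open>\<Prod>\<^sub>j (1 + e (b j t)) / 2\<close> of the characters of the sums \<open>b(F)\<close> do not tend to zero in mean;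
  so it charges \<open>G 2 b\<close>, outside which these products tend to zero.
\<close>

text \<open>Exponents 1 and 2 bracket IP-rigidity. The construction needs summable distances
  \<parallel>b j t\<parallel>, so that all finite sums b(F) t are close to integers at once.
  Rigidity gives back summable squares, because |1 + e(x)| / 2 falls short of 1 by the order of
  \<parallel>x\<parallel>^2. For arithmetic sequences the gap closes, since bounded ratios make
  \<open>G p b\<close> countable for every p > 0. The covariance is the Fourier transform of the law
  of the random sum of the +-t k with independent fair signs; lacunarity enters as vanishing Cesaro
  means of its modulus, that is, as the absence of atoms. The process is an explicit limit of linear
  combinations of independent normal variables, whose convergence rests on the summability of t.
  Correlations are real, so spectral measures are accessed through their cosine transforms. The test
  functions are cosines of linear forms with a phase: their integrals against a Gaussian law are
  explicit, and they decide invariance, mixing and rigidity for all measurable sets.\<close>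

abbreviation idist :: "real \<Rightarrow> real" where
  "idist x \<equiv> infdist x \<int>"

lemma idist_le: "idist x \<le> \<bar>x - of_int n\<bar>"
  using infdist_le[of "of_int n" \<int> x] by (simp add: dist_real_def)

lemma idist_eq_round: "idist x = \<bar>x - of_int (round x)\<bar>"
proof (rule antisym[OF idist_le])
  have "\<bar>x - of_int (round x)\<bar> \<le> (INF a\<in>\<int>. dist x a)"
    by (rule cINF_greatest) (auto simp: Ints_def dist_real_def round_diff_minimal)
  then show "\<bar>x - of_int (round x)\<bar> \<le> idist x"
    unfolding infdist_def by (auto simp: Ints_def)
qed

lemma idist_nonneg: "0 \<le> idist x"
  by (rule infdist_nonneg)

lemma idist_le_abs: "idist x \<le> \<bar>x\<bar>"
  using idist_le[of x 0] by simp

lemma idist_le_half: "idist x \<le> 1/2"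
  unfolding idist_eq_round by (rule of_int_round_abs_le[THEN order_trans[OF eq_refl, rotated]]) (simp add: abs_minus_commute)

lemma idist_add_of_int [simp]: "idist (x + of_int n) = idist x"
proof -
  have "idist (y + of_int k) \<le> idist y" for y k
    using idist_le[of "y + of_int k" "round y + k"] by (simp add: idist_eq_round[of y])
  from this[of x n] this[of "x + of_int n" "- n"] show ?thesis by simp
qed

lemma idist_of_int [simp]: "idist (of_int n) = 0"
  by simp

lemma idist_minus [simp]: "idist (- x) = idist x"
proof -
  have "idist (- y) \<le> idist y" for y
    using idist_le[of "- y" "- round y"] by (simp add: idist_eq_round[of y])
  from this[of x] this[of "- x"] show ?thesis by simp
qed

lemma idist_mult_abs: "idist (c * \<bar>x\<bar>) = idist (c * x)"
  using idist_minus[of "c * x"] by (simp add: abs_if)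

lemma idist_add_le: "idist (x + y) \<le> idist x + idist y"
  using idist_le[of "x + y" "round x + round y"] by (simp add: idist_eq_round[of x] idist_eq_round[of y])

lemma idist_sum_le: "idist (\<Sum>i\<in>I. f i) \<le> (\<Sum>i\<in>I. idist (f i))"
proof (induction I rule: infinite_finite_induct)
  case (insert x F)
  then show ?case using idist_add_le[of "f x" "sum f F"] by simp
qed (simp_all add: infdist_zero)

lemma idist_nat_mult_le: "idist (real n * x) \<le> real n * idist x"
proof -
  have "idist (real n * x) \<le> \<bar>real n * x - of_int (int n * round x)\<bar>" by (rule idist_le)
  also have "\<dots> = real n * idist x"
    by (simp add: idist_eq_round[of x] abs_mult flip: right_diff_distrib)
  finally show ?thesis .
qed

lemma idist_frac_mult [simp]: "idist (real n * frac x) = idist (real n * x)"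
proof -
  have "real n * x = real n * frac x + of_int (int n * \<lfloor>x\<rfloor>)"
    by (simp add: frac_def algebra_simps)
  then show ?thesis by (metis idist_add_of_int)
qed

lemma tendsto_idist: "(f \<longlongrightarrow> l) F \<Longrightarrow> ((\<lambda>x. idist (f x)) \<longlongrightarrow> idist l) F"
  by (rule tendsto_infdist)

lemma idist_zero_imp_Ints: "idist x = 0 \<Longrightarrow> x \<in> \<int>"
  unfolding idist_eq_round by (metis Ints_of_int abs_eq_0 eq_iff_diff_eq_0)

lemma incr_seq_less: "incr_seq b \<Longrightarrow> 1 \<le> m \<Longrightarrow> m < n \<Longrightarrow> b m < b n"
  unfolding incr_seq_def strict_mono_on_def by auto

lemma incr_seq_ge: "incr_seq b \<Longrightarrow> 1 \<le> n \<Longrightarrow> n \<le> b n"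
proof (induction n)
  case 0 then show ?case by simp
next
  case (Suc n)
  then show ?case using incr_seq_less[of b n "Suc n"] by (cases "n = 0") (auto simp: incr_seq_def)
qed

lemma incr_seq_pos: "incr_seq b \<Longrightarrow> 1 \<le> n \<Longrightarrow> 0 < b n"
  using incr_seq_ge[of b n] by auto

section \<open>Arithmetic sequences\<close>

text \<open>Common interface to both kinds of sequences: \<open>B\<close> is 0 in the multiplicative
  and 1 in the continued fraction case. The doubling takes two steps because a partial quotient 1
  gives b (n + 2) < 2 b (n + 1).\<close>

lemma arithmetic_seq_recursion:
  assumes "arithmetic_seq b"
  obtains A B where "\<And>n. 1 \<le> n \<Longrightarrow> b (n + 2) = A n * b (n + 1) + B n * b n"
    and "\<And>n. B n \<le> (1::nat)" and "\<And>n. 1 \<le> n \<Longrightarrow> 2 * b n \<le> b (n + 2)"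
proof -
  have incr: "incr_seq b" using assms by (simp add: arithmetic_seq_def)
  consider "multiplicative_seq b" | "principal_denominator_seq b"
    using assms by (auto simp: arithmetic_seq_def)
  then show thesis
  proof cases
    case 1
    have dv: "b (n + 1) = (b (n + 1) div b n) * b n" if "1 \<le> n" for n
      using 1 that by (simp add: multiplicative_seq_def)
    show thesis
    proof (rule that[of "\<lambda>n. b (n + 2) div b (n + 1)" "\<lambda>_. 0"])
      fix n :: nat assume n: "1 \<le> n"
      show "b (n + 2) = b (n + 2) div b (n + 1) * b (n + 1) + 0 * b n"
        using dv[of "n + 1"] by simp
      have "b n dvd b (n + 1)" "b n < b (n + 1)" "b (n + 1) < b (n + 2)"
        using 1 n incr_seq_less[OF incr] by (auto simp: multiplicative_seq_def)
      then obtain k where "b (n + 1) = b n * k" "k \<noteq> 1" "k \<noteq> 0" by (auto elim!: dvdE)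
      moreover from this have "b n * 2 \<le> b n * k" by (intro mult_left_mono) auto
      ultimately show "2 * b n \<le> b (n + 2)" using \<open>b (n + 1) < b (n + 2)\<close> by linarith
    qed simp
  next
    case 2
    then obtain a \<alpha> where a: "has_cfrac \<alpha> a" "\<And>n. n \<ge> 1 \<Longrightarrow> b n = cfrac_denom a n"
      unfolding principal_denominator_seq_def by auto
    have rec: "b (n + 2) = a (n + 2) * b (n + 1) + b n" if "1 \<le> n" for n
      using a(2)[of n] a(2)[of "n + 1"] a(2)[of "n + 2"] that by simp
    show thesis
    proof (rule that[of "\<lambda>n. a (n + 2)" "\<lambda>_. 1"])
      fix n :: nat assume n: "1 \<le> n"
      show "b (n + 2) = a (n + 2) * b (n + 1) + 1 * b n" using rec[OF n] by simp
      have "1 \<le> a (n + 2)" using a(1) by (auto simp: has_cfrac_def)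
      then have "1 * b (n + 1) \<le> a (n + 2) * b (n + 1)" by (intro mult_right_mono) auto
      then show "2 * b n \<le> b (n + 2)" using rec[OF n] incr_seq_less[OF incr n, of "n + 1"] by linarith
    qed simp
  qed
qed

text \<open>The constant 4 reproduces itself in steps of two: 4 b k + b (k + 1) + b (k + 2) is at
  most (2 + 1 + 1) b (k + 2).\<close>

lemma arithmetic_seq_sum_le:
  assumes "arithmetic_seq b" "1 \<le> n"
  shows "(\<Sum>i=1..n. real (b i)) \<le> 4 * real (b n)"
  using assms(2)
proof (induction n rule: less_induct)
  case (less n)
  have incr: "incr_seq b" using assms by (simp add: arithmetic_seq_def)
  obtain A B where g: "\<And>n. 1 \<le> n \<Longrightarrow> 2 * b n \<le> b (n + 2)"
    using arithmetic_seq_recursion[OF assms(1)] by metis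
  show ?case
  proof (cases "n \<le> 2")
    case True
    then have "n = 1 \<or> n = 2" using less.prems by auto
    moreover have "b 1 < b 2" using incr_seq_less[OF incr] by simp
    ultimately show ?thesis by (auto simp: numeral_2_eq_2)
  next
    case False
    then obtain k where k: "n = k + 2" "1 \<le> k" by (intro that[of "n - 2"]) auto
    have "(\<Sum>i=1..n. real (b i)) = (\<Sum>i=1..k. real (b i)) + real (b (k + 1)) + real (b (k + 2))"
      using k by (simp add: numeral_2_eq_2)
    also have "\<dots> \<le> 4 * real (b k) + real (b (k + 1)) + real (b (k + 2))"
      using less.IH[of k] k by simp
    also have "\<dots> \<le> 4 * real (b n)"
      using g[OF k(2)] incr_seq_less[OF incr, of "k + 1" "k + 2"] k by simp
    finally show ?thesis .
  qed
qed

text \<open>The mirror image for reciprocals: 1 + 1 + 4/2 = 4.\<close>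

lemma arithmetic_seq_sum_inverse_le:
  assumes "arithmetic_seq b" "1 \<le> n"
  shows "(\<Sum>i=n..<n+k. 1 / real (b i)) \<le> 4 / real (b n)"
  using assms(2)
proof (induction k arbitrary: n rule: less_induct)
  case (less k)
  have incr: "incr_seq b" using assms by (simp add: arithmetic_seq_def)
  have pos: "0 < b i" if "1 \<le> i" for i using incr_seq_pos[OF incr that] .
  obtain A B where g: "\<And>n. 1 \<le> n \<Longrightarrow> 2 * b n \<le> b (n + 2)"
    using arithmetic_seq_recursion[OF assms(1)] by metis
  show ?case
  proof (cases "k < 2")
    case True
    then have "k = 0 \<or> k = 1" by auto
    then show ?thesis using pos[OF less.prems] by (auto simp: field_simps)
  next
    case False
    then obtain j where j: "k = j + 2" by (intro that[of "k - 2"]) auto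
    have "{n..<n+k} = insert n (insert (n+1) {n+2..<n+2+j})" using j by auto
    then have "(\<Sum>i=n..<n+k. 1 / real (b i)) = 1 / real (b n) + 1 / real (b (n+1)) + (\<Sum>i=n+2..<n+2+j. 1 / real (b i))"
      by simp
    also have "\<dots> \<le> 1 / real (b n) + 1 / real (b n) + 4 / real (2 * b n)"
    proof (intro add_mono)
      show "1 / real (b (n + 1)) \<le> 1 / real (b n)"
        using pos[OF less.prems] incr_seq_less[OF incr less.prems, of "n+1"] by (intro divide_left_mono) auto
      have "(\<Sum>i=n+2..<n+2+j. 1 / real (b i)) \<le> 4 / real (b (n + 2))"
        using less.IH[of j "n + 2"] j by simp
      also have "\<dots> \<le> 4 / real (2 * b n)"
        using g[OF less.prems] pos[OF less.prems] pos[of "n+2"] by (intro divide_left_mono) (auto simp flip: of_nat_mult)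
      finally show "(\<Sum>i=n+2..<n+2+j. 1 / real (b i)) \<le> 4 / real (2 * b n)" .
    qed simp
    also have "\<dots> = 4 / real (b n)" by simp
    finally show ?thesis .
  qed
qed


text \<open>Once all distances are below \<open>\<delta>\<close>, the nearest integers satisfy the
  recursion of b themselves, so two consecutive ones determine all later ones, and these determine
  t.\<close>

lemma countable_tendsto_idist:
  assumes incr: "incr_seq b" and n0: "1 \<le> n0"
    and rec: "\<And>n. n0 \<le> n \<Longrightarrow> b (n + 2) = A n * b (n + 1) + B n * b n"
    and bd: "\<And>n. n0 \<le> n \<Longrightarrow> A n + B n \<le> R"
  shows "countable {t. (\<lambda>n. idist (real (b n) * t)) \<longlonglongrightarrow> 0}" (is "countable ?S")
proof -
  \<comment> \<open>The defect of the recursion for the nearest integers is an integer of modulus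
    less than (A n + B n + 1) \<open>\<delta>\<close> <= 1, hence 0.\<close>
  define \<delta> where "\<delta> = 1 / (real R + 1)"
  define p where "p t n = round (real (b n) * t)" for t n
  define good where "good t m \<longleftrightarrow> n0 \<le> m \<and> (\<forall>n\<ge>m. idist (real (b n) * t) < \<delta>)" for t m
  define m where "m t = (SOME m. good t m)" for t
  have m: "good t (m t)" if "t \<in> ?S" for t
  proof -
    have "\<forall>\<^sub>F n in sequentially. idist (real (b n) * t) < \<delta>"
      using that by (intro order_tendstoD(2)[where y = 0]) (auto simp: \<delta>_def)
    then obtain k where "\<forall>n\<ge>k. idist (real (b n) * t) < \<delta>" by (auto simp: eventually_sequentially)
    then have "good t (max n0 k)" by (auto simp: good_def)
    then show ?thesis unfolding m_def by (rule someI)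
  qed
  have recp: "p t (n + 2) = int (A n) * p t (n + 1) + int (B n) * p t n" if "good t k" "k \<le> n" for t k n
  proof -
    have n: "n0 \<le> n" using that by (auto simp: good_def)
    define e where "e i = real (b i) * t - real_of_int (p t i)" for i
    have e: "\<bar>e i\<bar> < \<delta>" if "n \<le> i" for i
      using that \<open>good t k\<close> \<open>k \<le> n\<close> by (auto simp: good_def e_def p_def simp flip: idist_eq_round)
    have "real_of_int (p t (n + 2) - (int (A n) * p t (n + 1) + int (B n) * p t n))
        = real (A n) * e (n + 1) + real (B n) * e n - e (n + 2)"
      using rec[OF n] by (simp add: e_def algebra_simps)
    also have "\<bar>\<dots>\<bar> \<le> real (A n) * \<bar>e (n + 1)\<bar> + real (B n) * \<bar>e n\<bar> + \<bar>e (n + 2)\<bar>"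
      by (rule order_trans[OF abs_triangle_ineq4] order_trans[OF add_right_mono[OF abs_triangle_ineq]])+ (simp add: abs_mult)
    also have "\<dots> < real (A n) * \<delta> + real (B n) * \<delta> + \<delta>"
      using e[of n] e[of "n + 1"] e[of "n + 2"]
      by (intro add_le_less_mono add_mono mult_left_mono) auto
    also have "\<dots> = (real (A n + B n) + 1) * \<delta>" by (simp add: algebra_simps)
    also have "\<dots> \<le> (real R + 1) * \<delta>"
      using bd[OF n] by (intro mult_right_mono) (auto simp: \<delta>_def)
    also have "\<dots> = 1" by (simp add: \<delta>_def)
    finally show ?thesis by linarith
  qed
  have det: "p t n = p s n \<and> p t (n + 1) = p s (n + 1)"
    if "good t k" "good s k" "p t k = p s k" "p t (k + 1) = p s (k + 1)" "k \<le> n" for t s k n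
    using that(5)
  proof (induction n rule: dec_induct)
    case (step n)
    then show ?case using recp[OF that(1), of n] recp[OF that(2), of n] by simp
  qed (use that in auto)
  have "inj_on (\<lambda>t. (m t, p t (m t), p t (m t + 1))) ?S"
  proof (rule inj_onI)
    fix t s assume ts: "t \<in> ?S" "s \<in> ?S"
      "(m t, p t (m t), p t (m t + 1)) = (m s, p s (m s), p s (m s + 1))"
    \<comment> \<open>Equal nearest integers put t and s within 2 \<open>\<delta>\<close> / b n of
      each other, and b n >= n.\<close>
    have close: "real n * \<bar>t - s\<bar> \<le> 2 * \<delta>" if "m t \<le> n" for n
    proof -
      have eq: "p t n = p s n" using det[of t "m t" s n] m[OF ts(1)] m[OF ts(2)] ts(3) that by (metis prod.inject)
      have 1: "\<bar>real (b n) * t - p t n\<bar> < \<delta>" "\<bar>real (b n) * s - p s n\<bar> < \<delta>" "n \<ge> 1"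
        using m[OF ts(1)] m[OF ts(2)] ts(3) that n0 by (auto simp: good_def p_def simp flip: idist_eq_round)
      have "real n * \<bar>t - s\<bar> \<le> real (b n) * \<bar>t - s\<bar>"
        using incr_seq_ge[OF incr 1(3)] by (intro mult_right_mono) auto
      also have "\<dots> = \<bar>(real (b n) * t - p t n) - (real (b n) * s - p s n)\<bar>"
        using eq by (simp add: abs_mult flip: right_diff_distrib)
      finally show ?thesis using 1 by linarith
    qed
    have "\<bar>t - s\<bar> \<le> 0"
    proof (rule ccontr)
      assume "\<not> \<bar>t - s\<bar> \<le> 0"
      then obtain n where "2 * \<delta> < real n * \<bar>t - s\<bar>" using reals_Archimedean3[of "\<bar>t - s\<bar>"] by auto
      also have "\<dots> \<le> real (max n (m t)) * \<bar>t - s\<bar>" by (intro mult_right_mono) auto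
      finally show False using close[of "max n (m t)"] by simp
    qed
    then show "t = s" by simp
  qed
  then show ?thesis by (rule countableI')
qed

lemma limsup_eq_infinity_iff:
  fixes f :: "nat \<Rightarrow> real"
  shows "limsup (\<lambda>n. ereal (f n)) = \<infinity> \<longleftrightarrow> (\<forall>C N. \<exists>n\<ge>N. C < f n)"
proof
  assume L: "limsup (\<lambda>n. ereal (f n)) = \<infinity>"
  show "\<forall>C N. \<exists>n\<ge>N. C < f n"
  proof (rule ccontr)
    assume "\<not> (\<forall>C N. \<exists>n\<ge>N. C < f n)"
    then obtain C N where "\<forall>n\<ge>N. f n \<le> C" by (auto simp: not_less)
    then have "\<forall>\<^sub>F n in sequentially. ereal (f n) \<le> ereal C" by (auto simp: eventually_sequentially)
    then have "limsup (\<lambda>n. ereal (f n)) \<le> ereal C" by (rule Limsup_bounded)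
    with L show False by simp
  qed
next
  assume R: "\<forall>C N. \<exists>n\<ge>N. C < f n"
  show "limsup (\<lambda>n. ereal (f n)) = \<infinity>"
  proof (rule ccontr)
    assume "limsup (\<lambda>n. ereal (f n)) \<noteq> \<infinity>"
    then obtain C where "limsup (\<lambda>n. ereal (f n)) < ereal (real C)"
      using less_PInf_Ex_of_nat by (auto simp: less_top[symmetric] top_ereal_def)
    then have "\<forall>\<^sub>F n in sequentially. ereal (f n) < ereal (real C)" by (rule Limsup_lessD)
    then obtain N where "\<forall>n\<ge>N. f n < real C" by (auto simp: eventually_sequentially)
    then show False using R by (meson less_asym)
  qed
qed

lemma countable_G_if_bounded_ratio:
  assumes "arithmetic_seq b" "0 < p"
    and "limsup (\<lambda>n. ereal (real (b (Suc n)) / real (b n))) \<noteq> \<infinity>"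
  shows "countable (G p b)"
proof -
  have incr: "incr_seq b" using assms by (simp add: arithmetic_seq_def)
  obtain A B where rec: "\<And>n. 1 \<le> n \<Longrightarrow> b (n + 2) = A n * b (n + 1) + B n * b n" "\<And>n. B n \<le> (1::nat)"
    using arithmetic_seq_recursion[OF assms(1)] by metis
  obtain C N where CN: "\<And>n. N \<le> n \<Longrightarrow> real (b (Suc n)) / real (b n) \<le> C"
    using assms(3) unfolding limsup_eq_infinity_iff by (auto simp: not_less)
  have A: "A n \<le> nat \<lceil>C\<rceil>" if "max 1 N \<le> n" for n
  proof -
    have pos: "0 < b (n + 1)" using incr_seq_pos[OF incr] by simp
    have "A n * b (n + 1) \<le> b (n + 2)" using rec(1)[of n] that by simp
    then have "real (A n) * real (b (n + 1)) \<le> real (b (n + 2))"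
      by (metis of_nat_le_iff of_nat_mult)
    then have "real (A n) \<le> real (b (n + 2)) / real (b (n + 1))" using pos by (simp add: field_simps)
    also have "\<dots> \<le> C" using CN[of "n + 1"] that by simp
    finally show ?thesis by linarith
  qed
  have "countable {t. (\<lambda>n. idist (real (b n) * t)) \<longlonglongrightarrow> 0}"
  proof (rule countable_tendsto_idist[OF incr, of "max 1 N" A B "nat \<lceil>C\<rceil> + 1"])
    show "A n + B n \<le> nat \<lceil>C\<rceil> + 1" if "max 1 N \<le> n" for n
      using A[OF that] rec(2)[of n] by simp
  qed (use rec in auto)
  moreover have "G p b \<subseteq> {t. (\<lambda>n. idist (real (b n) * t)) \<longlonglongrightarrow> 0}"
  proof
    fix t assume "t \<in> G p b"
    then have "(\<lambda>n. idist (real (b (Suc n)) * t) powr p) \<longlonglongrightarrow> 0"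
      unfolding G_def using summable_LIMSEQ_zero by blast
    then have "(\<lambda>n. (idist (real (b (Suc n)) * t) powr p) powr (1/p)) \<longlonglongrightarrow> 0"
      using \<open>0 < p\<close> by (intro tendsto_zero_powrI[where b = "1 / p", OF _ tendsto_const]) auto
    then have "(\<lambda>n. idist (real (b (Suc n)) * t)) \<longlonglongrightarrow> 0"
      using \<open>0 < p\<close> by (simp add: powr_powr infdist_nonneg)
    then show "t \<in> {t. (\<lambda>n. idist (real (b n) * t)) \<longlonglongrightarrow> 0}"
      using filterlim_sequentially_Suc[of "\<lambda>n. idist (real (b n) * t)"] by simp
  qed
  ultimately show ?thesis by (rule countable_subset[rotated])
qed

section \<open>Continued fractions and their convergents\<close>

fun cfrac_num :: "(nat \<Rightarrow> nat) \<Rightarrow> nat \<Rightarrow> nat" where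
  "cfrac_num a 0 = 0"
| "cfrac_num a (Suc 0) = 1"
| "cfrac_num a (Suc (Suc n)) = a (Suc (Suc n)) * cfrac_num a (Suc n) + cfrac_num a n"

lemma fin_cfrac_nonneg: "0 \<le> fin_cfrac xs"
  by (induction xs) auto

text \<open>Reads \<open>[0; x\<^sub>1, \<dots>, x\<^sub>n + y]\<close>\<close>

abbreviation cfrac_with_tail :: "nat list \<Rightarrow> real \<Rightarrow> real" where
  "cfrac_with_tail xs y \<equiv> foldr (\<lambda>x z. 1 / (real x + z)) xs y"

lemma fin_cfrac_append: "fin_cfrac (xs @ ys) = cfrac_with_tail xs (fin_cfrac ys)"
  by (induction xs) auto

lemma cfrac_denom_pos: "\<forall>n\<ge>1. 1 \<le> a n \<Longrightarrow> 0 < cfrac_denom a n"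
proof (induction a n rule: cfrac_denom.induct)
  case (3 a n)
  then show ?case by auto
qed auto

text \<open>A real tail y makes the induction possible, since the last partial quotient can be
  absorbed into it; later y is the value of all remaining quotients.\<close>

lemma cfrac_with_tail_eq:
  assumes "\<forall>n\<ge>1. 1 \<le> a n" "0 \<le> y"
  shows "cfrac_with_tail (map a [1..<Suc (Suc n)]) y
    = (real (cfrac_num a (Suc n)) + y * real (cfrac_num a n)) /
      (real (cfrac_denom a (Suc n)) + y * real (cfrac_denom a n))"
  using assms(2)
proof (induction n arbitrary: y)
  case 0
  then show ?case by simp
next
  case (Suc n)
  \<comment> \<open>Ending the expansion with the quotient c is the same as adding the tail 1 / c to
    the quotient before it.\<close>
  define c where "c = real (a (Suc (Suc n))) + y"
  have "1 \<le> a (Suc (Suc n))" using assms(1) by simp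
  then have c: "0 < c" using Suc.prems by (simp add: c_def)
  have "cfrac_with_tail (map a [1..<Suc (Suc (Suc n))]) y = cfrac_with_tail (map a [1..<Suc (Suc n)]) (1 / c)"
    by (simp add: c_def)
  also have "\<dots> = (real (cfrac_num a (Suc n)) + 1 / c * real (cfrac_num a n)) /
      (real (cfrac_denom a (Suc n)) + 1 / c * real (cfrac_denom a n))"
    by (rule Suc.IH) (use c in simp)
  also have "\<dots> = (c * (real (cfrac_num a (Suc n)) + 1 / c * real (cfrac_num a n))) /
      (c * (real (cfrac_denom a (Suc n)) + 1 / c * real (cfrac_denom a n)))"
    using c by (subst mult_divide_mult_cancel_left) auto
  also have "\<dots> = (c * real (cfrac_num a (Suc n)) + real (cfrac_num a n)) /
      (c * real (cfrac_denom a (Suc n)) + real (cfrac_denom a n))"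
    using c by (simp add: distrib_left)
  finally show ?case by (simp add: c_def algebra_simps)
qed

lemma cfrac_det:
  "real (cfrac_num a (Suc n)) * real (cfrac_denom a n) - real (cfrac_num a n) * real (cfrac_denom a (Suc n)) = (- 1) ^ n"
proof (induction n)
  case (Suc n)
  have "real (cfrac_num a (Suc (Suc n))) * real (cfrac_denom a (Suc n)) - real (cfrac_num a (Suc n)) * real (cfrac_denom a (Suc (Suc n)))
    = - (real (cfrac_num a (Suc n)) * real (cfrac_denom a n) - real (cfrac_num a n) * real (cfrac_denom a (Suc n)))"
    by (simp add: algebra_simps)
  then show ?case using Suc.IH by simp
qed simp

text \<open>By the determinant identity every finite expansion x of length at least n + 1 satisfies
  |q n * x - p n| = 1 / D, where D = q (n + 1) + y * q n >= q (n + 1). The bound survives the limit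
  to \<alpha>.\<close>

lemma idist_cfrac_denom_le:
  assumes "has_cfrac \<alpha> a"
  shows "idist (real (cfrac_denom a n) * \<alpha>) \<le> 1 / real (cfrac_denom a (Suc n))"
proof -
  have a: "\<forall>n\<ge>1. 1 \<le> a n" and lim: "(\<lambda>m. fin_cfrac (map a [1..<Suc m])) \<longlonglongrightarrow> \<alpha>"
    using assms by (auto simp: has_cfrac_def)
  let ?p = "\<lambda>n. real (cfrac_num a n)" and ?q = "\<lambda>n. real (cfrac_denom a n)"
  have q: "0 < ?q k" for k using cfrac_denom_pos[OF a] by simp
  have bd: "\<bar>?q n * fin_cfrac (map a [1..<Suc m]) - of_int (int (cfrac_num a n))\<bar> \<le> 1 / ?q (Suc n)" if "Suc n \<le> m" for m
  proof -
    define y where "y = fin_cfrac (map a [Suc (Suc n)..<Suc m])"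
    have y: "0 \<le> y" by (simp add: y_def fin_cfrac_nonneg)
    have "[1..<Suc m] = [1..<Suc (Suc n)] @ [Suc (Suc n)..<Suc m]"
      using that by (metis upt_add_eq_append le_add1 le_add_diff_inverse Suc_le_mono One_nat_def Suc_leI zero_less_Suc)
    then have "fin_cfrac (map a [1..<Suc m]) = (?p (Suc n) + y * ?p n) / (?q (Suc n) + y * ?q n)" (is "_ = _ / ?D")
      by (simp only: map_append fin_cfrac_append y_def[symmetric] cfrac_with_tail_eq[OF a y])
    moreover have D: "?q (Suc n) \<le> ?D" using y q by simp
    then have "0 < ?D" using q[of "Suc n"] by linarith
    ultimately have "?q n * fin_cfrac (map a [1..<Suc m]) - ?p n = (?p (Suc n) * ?q n - ?p n * ?q (Suc n)) / ?D"
      by (simp add: field_simps)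
    also have "\<dots> = (- 1) ^ n / ?D" by (simp only: cfrac_det)
    finally have "\<bar>?q n * fin_cfrac (map a [1..<Suc m]) - ?p n\<bar> = 1 / ?D" using \<open>0 < ?D\<close> by (simp add: abs_divide)
    also have "\<dots> \<le> 1 / ?q (Suc n)" using D q[of "Suc n"] by (intro divide_left_mono) auto
    finally show ?thesis by simp
  qed
  have "(\<lambda>m. \<bar>?q n * fin_cfrac (map a [1..<Suc m]) - of_int (int (cfrac_num a n))\<bar>) \<longlonglongrightarrow> \<bar>?q n * \<alpha> - of_int (int (cfrac_num a n))\<bar>"
    by (intro tendsto_intros lim)
  then have "\<bar>?q n * \<alpha> - of_int (int (cfrac_num a n))\<bar> \<le> 1 / ?q (Suc n)"
    by (rule LIMSEQ_le_const2) (use bd in blast)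
  then show ?thesis using idist_le order_trans by blast
qed

text \<open>Up to index n the terms are at most b i / b (n + 1), after n they are at most b n / b i;
  the two sum lemmas bound each part by 4 b n / b (n + 1).\<close>

lemma arithmetic_seq_idist_sum:
  assumes "arithmetic_seq b" "1 \<le> n" "0 \<le> t" "t \<le> 1 / real (b (Suc n))"
    and tail: "\<And>i. Suc n \<le> i \<Longrightarrow> idist (real (b i) * t) \<le> real (b n) / real (b i)"
  shows "summable (\<lambda>i. idist (real (b (Suc i)) * t))"
    and "(\<Sum>i. idist (real (b (Suc i)) * t)) \<le> 8 * (real (b n) / real (b (Suc n)))"
proof -
  have bd: "(\<Sum>i<N. idist (real (b (Suc i)) * t)) \<le> 8 * (real (b n) / real (b (Suc n)))" for N
  proof -
    have "(\<Sum>i<N. idist (real (b (Suc i)) * t)) = (\<Sum>i=1..<Suc N. idist (real (b i) * t))"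
      by (simp only: One_nat_def sum.shift_bounds_Suc_ivl atLeast0LessThan)
    also have "\<dots> \<le> (\<Sum>i\<in>{1..n} \<union> {Suc n..<Suc n + N}. idist (real (b i) * t))"
      by (rule sum_mono2) (auto simp: infdist_nonneg)
    also have "\<dots> = (\<Sum>i=1..n. idist (real (b i) * t)) + (\<Sum>i=Suc n..<Suc n + N. idist (real (b i) * t))"
      by (rule sum.union_disjoint) auto
    also have "(\<Sum>i=1..n. idist (real (b i) * t)) \<le> (\<Sum>i=1..n. real (b i) / real (b (Suc n)))"
    proof (rule sum_mono)
      fix i
      have "idist (real (b i) * t) \<le> real (b i) * t" using idist_le_abs[of "real (b i) * t"] assms(3) by simp
      also have "\<dots> \<le> real (b i) * (1 / real (b (Suc n)))" by (intro mult_left_mono assms) auto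
      finally show "idist (real (b i) * t) \<le> real (b i) / real (b (Suc n))" by simp
    qed
    also have "\<dots> = (\<Sum>i=1..n. real (b i)) / real (b (Suc n))" by (simp add: sum_divide_distrib)
    also have "\<dots> \<le> 4 * real (b n) / real (b (Suc n))"
      by (intro divide_right_mono arithmetic_seq_sum_le assms) auto
    also have "(\<Sum>i=Suc n..<Suc n + N. idist (real (b i) * t)) \<le> (\<Sum>i=Suc n..<Suc n + N. real (b n) * (1 / real (b i)))"
      using tail by (intro sum_mono) auto
    also have "\<dots> = real (b n) * (\<Sum>i=Suc n..<Suc n + N. 1 / real (b i))" unfolding sum_distrib_left ..
    also have "\<dots> \<le> real (b n) * (4 / real (b (Suc n)))"
      by (intro mult_left_mono arithmetic_seq_sum_inverse_le assms) auto
    finally show ?thesis by simp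
  qed
  show s: "summable (\<lambda>i. idist (real (b (Suc i)) * t))"
    by (rule summableI_nonneg_bounded[OF _ bd]) (rule infdist_nonneg)
  show "(\<Sum>i. idist (real (b (Suc i)) * t)) \<le> 8 * (real (b n) / real (b (Suc n)))"
    by (rule suminf_le_const[OF s bd])
qed

lemma arithmetic_seq_small_point:
  assumes b: "arithmetic_seq b" and "limsup (\<lambda>n. ereal (real (b (Suc n)) / real (b n))) = \<infinity>" and "0 < \<epsilon>"
  obtains t where "0 < t" "t < \<epsilon>" "summable (\<lambda>i. idist (real (b (Suc i)) * t))"
    "(\<Sum>i. idist (real (b (Suc i)) * t)) < \<epsilon>"
proof -
  have incr: "incr_seq b" using b by (simp add: arithmetic_seq_def)
  \<comment> \<open>The 8 is the constant of \<open>arithmetic_seq_idist_sum\<close>.\<close>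
  obtain n where n: "1 \<le> n" "8 / \<epsilon> < real (b (Suc n)) / real (b n)"
    using assms(2) unfolding limsup_eq_infinity_iff by blast
  have pos: "1 \<le> real (b n)" "1 \<le> real (b (Suc n))" using incr_seq_pos[OF incr] n(1) by (auto simp: Suc_le_eq)
  have small: "8 * (real (b n) / real (b (Suc n))) < \<epsilon>"
    using n(2) pos \<open>0 < \<epsilon>\<close> by (simp add: field_simps)
  have "1 / real (b (Suc n)) \<le> real (b n) / real (b (Suc n))" using pos by (intro divide_right_mono) auto
  also have "\<dots> \<le> 8 * (real (b n) / real (b (Suc n)))" using zero_le_divide_iff[of "real (b n)" "real (b (Suc n))"] by linarith
  finally have small': "1 / real (b (Suc n)) < \<epsilon>" using small by simp
  have "\<exists>t. 0 < t \<and> t \<le> 1 / real (b (Suc n)) \<and> (\<forall>i\<ge>Suc n. idist (real (b i) * t) \<le> real (b n) / real (b i))"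
  proof (cases "multiplicative_seq b")
    case True
    have "b (Suc n) dvd b i" if "Suc n \<le> i" for i
      using that by (induction i rule: dec_induct) (use True n in \<open>auto simp: multiplicative_seq_def intro: dvd_trans\<close>)
    then have "idist (real (b i) * (1 / real (b (Suc n)))) = 0" if "Suc n \<le> i" for i
      using that pos by (auto simp flip: real_of_nat_div)
    then show ?thesis using pos by (intro exI[of _ "1 / real (b (Suc n))"]) auto
  next
    case False
    then obtain \<alpha> a where a: "\<alpha> \<notin> \<rat>" "has_cfrac \<alpha> a" "\<And>n. 1 \<le> n \<Longrightarrow> b n = cfrac_denom a n"
      using b by (auto simp: arithmetic_seq_def principal_denominator_seq_def)
    have q: "idist (real (b i) * \<alpha>) \<le> 1 / real (b (Suc i))" if "1 \<le> i" for i
      using idist_cfrac_denom_le[OF a(2), of i] a(3)[of i] a(3)[of "Suc i"] that by simp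
    \<comment> \<open>Modulo 1 this is +-b n \<alpha>, so \<parallel>b i t\<parallel> <= b n
      \<parallel>b i \<alpha>\<parallel> <= b n / b (i + 1). Irrationality of \<alpha> makes it
      positive.\<close>
    define t where "t = idist (real (b n) * \<alpha>)"
    have "t \<noteq> 0"
    proof
      assume "t = 0"
      then obtain k where "real (b n) * \<alpha> = of_int k"
        unfolding t_def by (metis idist_zero_imp_Ints Ints_cases)
      then have "\<alpha> = of_int k / of_int (int (b n))" using pos by (simp add: field_simps)
      then show False using a(1) by (metis Rats_divide Rats_of_int)
    qed
    then have "0 < t" using idist_nonneg[of "real (b n) * \<alpha>"] by (simp add: t_def)
    moreover have "idist (real (b i) * t) \<le> real (b n) / real (b i)" if i: "Suc n \<le> i" for i
    proof -
      have "idist (real (b i) * t) = idist (real (b i) * (real (b n) * \<alpha> - of_int (round (real (b n) * \<alpha>))))"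
        unfolding t_def idist_eq_round[of "real (b n) * \<alpha>"] by (rule idist_mult_abs)
      also have "\<dots> = idist (real (b i) * (real (b n) * \<alpha>) + of_int (- (int (b i) * round (real (b n) * \<alpha>))))"
        by (rule arg_cong[of _ _ idist]) (simp add: algebra_simps)
      also have "\<dots> = idist (real (b n) * (real (b i) * \<alpha>))" by (simp only: idist_add_of_int mult.left_commute)
      also have "\<dots> \<le> real (b n) * (1 / real (b (Suc i)))"
        using i by (intro order_trans[OF idist_nat_mult_le] mult_left_mono q) auto
      also have "\<dots> \<le> real (b n) * (1 / real (b i))"
        using i incr_seq_less[OF incr, of i "Suc i"] incr_seq_pos[OF incr, of i]
        by (intro mult_left_mono divide_left_mono) auto
      finally show ?thesis by simp
    qed
    ultimately show ?thesis using q[OF n(1)] by (auto simp: t_def)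
  qed
  then obtain t where t: "0 < t" "t \<le> 1 / real (b (Suc n))" "\<And>i. Suc n \<le> i \<Longrightarrow> idist (real (b i) * t) \<le> real (b n) / real (b i)"
    by blast
  show thesis
    using that[OF t(1)] arithmetic_seq_idist_sum[OF b n(1) _ t(2,3)] t small small' by force
qed


section \<open>Lacunary sequences\<close>

text \<open>The ratio 1/8 bounds the sum of all terms after t k by t k / 7. Hence subset sums are
  ordered lexicographically, and a signed sum of the numbers 2 t k is dominated by its first term;
  \<open>t 0 <= 1/16\<close> keeps such sums strictly between -1 and 1.\<close>

locale lacunary =
  fixes t :: "nat \<Rightarrow> real"
  assumes t_pos: "\<And>k. 0 < t k"
    and t_Suc_le: "\<And>k. t (Suc k) \<le> t k / 8"
    and t_0_le: "t 0 \<le> 1 / 16"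
begin

lemma t_add_le: "t (k + i) \<le> t k * (1/8) ^ i"
proof (induction i)
  case (Suc i)
  then show ?case using t_Suc_le[of "k + i"] by simp
qed simp

lemma summable_t: "summable t"
proof (rule summable_comparison_test')
  show "summable (\<lambda>i. t 0 * (1/8::real) ^ i)" by (intro summable_mult summable_geometric) simp
  show "norm (t i) \<le> t 0 * (1/8) ^ i" if "0 \<le> i" for i using t_add_le[of 0 i] t_pos[of i] by simp
qed

lemma summable_t_tail: "summable (\<lambda>i. t (k + i))"
  using summable_t summable_iff_shift[of t k] by (simp add: add.commute)

lemma suminf_t_tail_le: "(\<Sum>i. t (k + i)) \<le> 8/7 * t k"
proof -
  have "(\<Sum>i. t (k + i)) \<le> (\<Sum>i. t k * (1/8) ^ i)"
    by (intro suminf_le t_add_le summable_mult summable_geometric summable_t_tail) simp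
  also have "\<dots> = 8/7 * t k" by (subst suminf_mult) (auto simp: suminf_geometric intro: summable_geometric)
  finally show ?thesis .
qed

definition subset_sum :: "nat set \<Rightarrow> real" where
  "subset_sum S = (\<Sum>k. if k \<in> S then t k else 0)"

lemma summable_subset_sum: "summable (\<lambda>k. if k \<in> S then t k else 0)"
  by (rule summable_comparison_test'[OF summable_t, of 0]) (auto simp: t_pos less_imp_le)

lemma subset_sum_in_unit: "subset_sum S \<in> {0..<1}"
proof -
  have "subset_sum S \<le> suminf t"
    unfolding subset_sum_def
    by (intro suminf_le summable_subset_sum summable_t) (auto simp: t_pos less_imp_le)
  also have "suminf t < 1" using suminf_t_tail_le[of 0] t_0_le by simp
  finally have "subset_sum S < 1" .
  moreover have "0 \<le> subset_sum S"
    unfolding subset_sum_def by (intro suminf_nonneg summable_subset_sum) (auto simp: t_pos less_imp_le)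
  ultimately show ?thesis by simp
qed

text \<open>At the first index k where S and S' differ, t k outweighs everything that S' can collect
  afterwards.\<close>

lemma subset_sum_less:
  assumes "k \<in> S" "k \<notin> S'" "\<And>i. i < k \<Longrightarrow> i \<in> S \<longleftrightarrow> i \<in> S'"
  shows "subset_sum S' < subset_sum S"
proof -
  define f where "f S i = (if i \<in> S then t i else 0)" for S i
  have sm: "summable (f S)" for S unfolding f_def by (rule summable_subset_sum)
  have f: "0 \<le> f S i" "f S i \<le> t i" for S i using t_pos by (auto simp: f_def less_imp_le)
  have split: "subset_sum S = (\<Sum>i. f S (i + Suc k)) + (\<Sum>i<Suc k. f S i)" for S
    unfolding subset_sum_def f_def[symmetric] by (rule suminf_split_initial_segment[OF sm])
  have "(\<Sum>i. f S' (i + Suc k)) \<le> (\<Sum>i. t (Suc k + i))"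
    using sm[of S'] f(2) by (intro suminf_le summable_t_tail) (auto simp only: summable_iff_shift add.commute[of "Suc k"])
  also have "\<dots> \<le> 8/7 * t (Suc k)" by (rule suminf_t_tail_le)
  also have "\<dots> < t k" using t_Suc_le[of k] t_pos[of k] by simp
  finally have 1: "(\<Sum>i. f S' (i + Suc k)) < t k" .
  have 2: "0 \<le> (\<Sum>i. f S (i + Suc k))"
    using sm[of S] f(1) by (intro suminf_nonneg) (auto simp only: summable_iff_shift)
  have "(\<Sum>i<k. f S' i) = (\<Sum>i<k. f S i)" using assms(3) by (intro sum.cong) (auto simp: f_def)
  then show ?thesis unfolding split using 1 2 assms(1,2) by (simp add: f_def)
qed

lemma inj_subset_sum: "inj subset_sum"
proof (rule injI, rule ccontr)
  fix S S' assume eq: "subset_sum S = subset_sum S'" and "S \<noteq> S'"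
  define k where "k = (LEAST k. (k \<in> S) \<noteq> (k \<in> S'))"
  have k: "(k \<in> S) \<noteq> (k \<in> S')" unfolding k_def by (rule LeastI_ex) (use \<open>S \<noteq> S'\<close> in auto)
  have "\<And>i. i < k \<Longrightarrow> i \<in> S \<longleftrightarrow> i \<in> S'" using not_less_Least unfolding k_def by blast
  then show False using subset_sum_less[of k S S'] subset_sum_less[of k S' S] k eq by auto
qed

end

text \<open>The bounds (1/2)^k make the double series of all \<parallel>b i t k\<parallel> converge
  with sum at most 2. This serves the membership of subset sums in \<open>G 1 b\<close> and the
  rigidity of the Gaussian shift alike.\<close>

locale lacunary_arithmetic = lacunary t for t :: "nat \<Rightarrow> real" +
  fixes b :: "nat \<Rightarrow> nat"
  assumes summable_idist: "\<And>k. summable (\<lambda>i. idist (real (b (Suc i)) * t k))"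
    and suminf_idist_le: "\<And>k. (\<Sum>i. idist (real (b (Suc i)) * t k)) \<le> (1/2) ^ k"
begin

lemma sum_idist_le: "(\<Sum>i<N. idist (real (b (Suc i)) * t k)) \<le> (1/2) ^ k"
  by (rule order_trans[OF sum_le_suminf[OF summable_idist] suminf_idist_le]) (auto simp: infdist_nonneg)

lemma sum_sum_idist_le: "(\<Sum>i<N. \<Sum>k<K. idist (real (b (Suc i)) * t k)) \<le> 2"
proof -
  have "(\<Sum>i<N. \<Sum>k<K. idist (real (b (Suc i)) * t k)) = (\<Sum>k<K. \<Sum>i<N. idist (real (b (Suc i)) * t k))"
    by (rule sum.swap)
  also have "\<dots> \<le> (\<Sum>k<K. (1/2) ^ k)" by (intro sum_mono sum_idist_le)
  also have "\<dots> \<le> (\<Sum>k. (1/2::real) ^ k)" by (intro sum_le_suminf summable_geometric) auto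
  also have "\<dots> = 2" by (simp add: suminf_geometric)
  finally show ?thesis .
qed

text \<open>Subadditivity of the distance is applied to finite sums over k; its continuity carries
  the bound 2 to the infinite sum, uniformly in N.\<close>

lemma subset_sum_in_G: "subset_sum S \<in> G 1 b"
proof -
  define f where "f k = (if k \<in> S then t k else 0)" for k
  have lim: "(\<lambda>K. \<Sum>k<K. f k) \<longlonglongrightarrow> subset_sum S"
    using summable_subset_sum[of S] unfolding subset_sum_def f_def by (rule summable_LIMSEQ)
  have "(\<Sum>i<N. idist (real (b (Suc i)) * subset_sum S)) \<le> 2" for N
  proof (rule LIMSEQ_le_const2)
    show "(\<lambda>K. \<Sum>i<N. idist (real (b (Suc i)) * (\<Sum>k<K. f k))) \<longlonglongrightarrow> (\<Sum>i<N. idist (real (b (Suc i)) * subset_sum S))"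
      by (intro tendsto_sum tendsto_idist tendsto_mult tendsto_const lim)
    have "(\<Sum>i<N. idist (real (b (Suc i)) * (\<Sum>k<K. f k))) \<le> 2" for K
    proof -
      have "(\<Sum>i<N. idist (real (b (Suc i)) * (\<Sum>k<K. f k))) \<le> (\<Sum>i<N. \<Sum>k<K. idist (real (b (Suc i)) * f k))"
        unfolding sum_distrib_left by (intro sum_mono idist_sum_le)
      also have "\<dots> \<le> (\<Sum>i<N. \<Sum>k<K. idist (real (b (Suc i)) * t k))"
        by (intro sum_mono) (auto simp: f_def infdist_nonneg)
      also have "\<dots> \<le> 2" by (rule sum_sum_idist_le)
      finally show ?thesis .
    qed
    then show "\<exists>N'. \<forall>K\<ge>N'. (\<Sum>i<N. idist (real (b (Suc i)) * (\<Sum>k<K. f k))) \<le> 2" by blast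
  qed
  then have "summable (\<lambda>i. idist (real (b (Suc i)) * subset_sum S))"
    by (intro summableI_nonneg_bounded[where x = 2]) (auto simp: infdist_nonneg)
  then show ?thesis using subset_sum_in_unit[of S] by (simp add: G_def infdist_nonneg)
qed

lemma uncountable_G: "uncountable (G 1 b)"
proof
  assume "countable (G 1 b)"
  then have "countable (range subset_sum)" by (rule countable_subset[rotated]) (auto simp: subset_sum_in_G)
  then have c: "countable (UNIV :: nat set set)" using inj_subset_sum by (rule countable_image_inj_on)
  have "range (from_nat_into UNIV :: nat \<Rightarrow> nat set) = UNIV" using c by (intro range_from_nat_into) auto
  then show False using Cantors_theorem[of "UNIV :: nat set"] by auto
qed

end

lemma obtain_lacunary_arithmetic:
  assumes b: "arithmetic_seq b" and inf: "limsup (\<lambda>n. ereal (real (b (Suc n)) / real (b n))) = \<infinity>"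
  obtains t where "lacunary_arithmetic t b"
proof -
  let ?P = "\<lambda>k x. 0 < x \<and> x \<le> 1/16 \<and> summable (\<lambda>i. idist (real (b (Suc i)) * x)) \<and>
    (\<Sum>i. idist (real (b (Suc i)) * x)) \<le> (1/2) ^ k"
  have ex: "\<exists>y. ?P k y \<and> y \<le> \<epsilon>" if "0 < \<epsilon>" for k \<epsilon>
  proof -
    obtain y where "0 < y" "y < min (min \<epsilon> (1/16)) ((1/2) ^ k)" "summable (\<lambda>i. idist (real (b (Suc i)) * y))"
      "(\<Sum>i. idist (real (b (Suc i)) * y)) < min (min \<epsilon> (1/16)) ((1/2) ^ k)"
      using arithmetic_seq_small_point[OF b inf, of "min (min \<epsilon> (1/16)) ((1/2) ^ k)"] \<open>0 < \<epsilon>\<close> by auto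
    then show ?thesis by (intro exI[of _ y]) auto
  qed
  have "\<exists>t. \<forall>k. ?P k (t k) \<and> t (Suc k) \<le> t k / 8"
  proof (rule dependent_nat_choice)
    show "\<exists>x. ?P 0 x" using ex[of 1 0] by auto
    show "\<exists>y. ?P (Suc k) y \<and> y \<le> x / 8" if "?P k x" for x k using ex[of "x/8" "Suc k"] that by auto
  qed
  then obtain t where "\<forall>k. ?P k (t k) \<and> t (Suc k) \<le> t k / 8" by blast
  then have "lacunary_arithmetic t b" by unfold_locales auto
  then show thesis by (rule that)
qed

section \<open>Spectral measures and rigidity\<close>

text \<open>Multiplication by 2 sin (\<theta> / 2) makes the sum telescope.\<close>

lemma sum_cos_bound:
  fixes \<theta> \<beta> :: real
  assumes "sin (\<theta> / 2) \<noteq> 0"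
  shows "\<bar>\<Sum>n<N. cos (real n * \<theta> + \<beta>)\<bar> \<le> 1 / \<bar>sin (\<theta> / 2)\<bar>"
proof -
  define F where "F n = sin (real n * \<theta> + \<beta> - \<theta> / 2)" for n
  have "2 * sin (\<theta> / 2) * cos (real n * \<theta> + \<beta>) = F (Suc n) - F n" for n
  proof -
    have "F (Suc n) = sin ((real n * \<theta> + \<beta>) + \<theta> / 2)" by (simp add: F_def algebra_simps)
    then show ?thesis unfolding F_def sin_add sin_diff by (simp add: algebra_simps)
  qed
  then have "2 * sin (\<theta> / 2) * (\<Sum>n<N. cos (real n * \<theta> + \<beta>)) = F N - F 0"
    by (simp add: sum_distrib_left sum_lessThan_telescope)
  then have "2 * \<bar>sin (\<theta> / 2)\<bar> * \<bar>\<Sum>n<N. cos (real n * \<theta> + \<beta>)\<bar> = \<bar>F N - F 0\<bar>"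
    by (metis abs_mult abs_numeral)
  also have "\<dots> \<le> 2"
    using abs_sin_le_one[of "real N * \<theta> + \<beta> - \<theta> / 2"] abs_sin_le_one[of "real 0 * \<theta> + \<beta> - \<theta> / 2"]
    unfolding F_def by linarith
  finally show ?thesis using assms by (simp add: field_simps)
qed

lemma average_cos_tendsto_0:
  fixes \<theta> \<beta> :: real
  assumes "sin (\<theta> / 2) \<noteq> 0"
  shows "(\<lambda>N. (\<Sum>n<N. cos (real n * \<theta> + \<beta>)) / real N) \<longlonglongrightarrow> 0"
proof (rule Lim_null_comparison)
  show "\<forall>\<^sub>F N in sequentially. norm ((\<Sum>n<N. cos (real n * \<theta> + \<beta>)) / real N) \<le> (1 / \<bar>sin (\<theta> / 2)\<bar>) / real N"
    using sum_cos_bound[OF assms]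
    by (intro always_eventually allI) (simp only: real_norm_def abs_divide abs_of_nat divide_right_mono of_nat_0_le_iff)
  show "(\<lambda>N. (1 / \<bar>sin (\<theta> / 2)\<bar>) / real N) \<longlonglongrightarrow> 0"
    by (rule lim_const_over_n)
qed

text \<open>With d the distance, 1 - cos y = 2 sin(pi d)^2, so sin (pi d) >= d on [0, 1/2] suffices.
  This quadratic order is the source of the exponent 2 in \<open>G 2 b\<close>.\<close>

lemma one_minus_cos_ge: "2 * (idist (y / (2 * pi)))\<^sup>2 \<le> 1 - cos y"
proof -
  define u where "u = y / (2 * pi)"
  define d where "d = idist u"
  have d: "0 \<le> d" "d \<le> 1/2" "d = \<bar>u - of_int (round u)\<bar>"
    unfolding d_def by (rule idist_nonneg idist_le_half idist_eq_round)+
  have "cos y = cos (2 * pi * (u - of_int (round u)))"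
    using cos_diff[of y "2 * pi * of_int (round u)"] cos_int_2pin[of "round u"] sin_int_2pin[of "round u"]
    by (simp add: u_def right_diff_distrib)
  also have "\<dots> = cos (2 * (pi * d))"
    unfolding d(3) by (metis abs_mult abs_of_nonneg cos_abs_real mult.assoc pi_ge_zero zero_le_numeral mult_nonneg_nonneg)
  also have "\<dots> = 1 - 2 * (sin (pi * d))\<^sup>2" by (rule cos_double_sin)
  finally have c: "1 - cos y = 2 * (sin (pi * d))\<^sup>2" by simp
  define z where "z = pi * d"
  \<comment> \<open>1.6 is a rational bound for pi / 2 with 1.6^2 / 6 < 1/2, so the cubic Taylor
    bound leaves sin z >= z / 2 = pi d / 2 >= d.\<close>
  have z: "0 \<le> z" "z \<le> 1.6" using d pi_less_4 pi_approx mult_mono[of pi "3.2" d "1/2"] by (auto simp: z_def)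
  have "\<bar>sin z - z\<bar> \<le> inverse 6 * z ^ 3"
    using Maclaurin_sin_bound[of z 3] z by (simp add: eval_nat_numeral sin_coeff_def)
  then have "6 * (z - sin z) \<le> z * (z * z)" by (simp add: eval_nat_numeral abs_if split: if_splits)
  then have "z * (1 - z * z / 6) \<le> sin z" by (simp add: algebra_simps)
  moreover have "z * z \<le> 1.6 * 1.6" using z by (intro mult_mono) auto
  then have "z * (1/2) \<le> z * (1 - z * z / 6)" using z by (intro mult_left_mono) auto
  moreover have "d \<le> z * (1/2)" unfolding z_def using mult_right_mono[of 2 pi d] d pi_ge_two by simp
  ultimately have "d \<le> sin z" by linarith
  then have "d\<^sup>2 \<le> (sin z)\<^sup>2" using d by (intro power_mono) auto
  then show ?thesis using c by (simp add: z_def d_def u_def)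
qed

text \<open>Sums an N x N Toeplitz array along its diagonals, of which the n-th has N - n entries on
  either side. It turns positive definiteness into nonnegativity of a Fejer sum.\<close>

lemma sum_nat_abs_diff:
  fixes g :: "nat \<Rightarrow> real"
  shows "(\<Sum>j<N. \<Sum>k<N. g (nat \<bar>int j - int k\<bar>)) = real N * g 0 + 2 * (\<Sum>n=1..<N. (real N - real n) * g n)"
proof (induction N)
  case (Suc N)
  have rev: "(\<Sum>k<N. g (nat \<bar>int k - int N\<bar>)) = (\<Sum>n=1..N. g n)"
  proof -
    have "(\<Sum>k<N. g (nat \<bar>int k - int N\<bar>)) = (\<Sum>k<N. g (Suc (N - Suc k)))"
      by (intro sum.cong arg_cong[of _ _ g]) auto
    also have "\<dots> = (\<Sum>k<N. g (Suc k))" by (rule sum.nat_diff_reindex)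
    also have "\<dots> = (\<Sum>n=1..N. g n)" by (rule sum_bounds_lt_plus1)
    finally show ?thesis .
  qed
  have rev': "(\<Sum>k<N. g (nat \<bar>int N - int k\<bar>)) = (\<Sum>n=1..N. g n)"
    by (subst abs_minus_commute) (rule rev)
  have "(\<Sum>j<Suc N. \<Sum>k<Suc N. g (nat \<bar>int j - int k\<bar>))
    = (\<Sum>j<N. \<Sum>k<N. g (nat \<bar>int j - int k\<bar>)) + 2 * (\<Sum>n=1..N. g n) + g 0"
    by (simp only: sum.lessThan_Suc sum.distrib rev rev') simp
  also have "\<dots> = real (Suc N) * g 0 + 2 * ((\<Sum>n=1..<N. (real N - real n) * g n) + (\<Sum>n=1..N. g n))"
    unfolding Suc.IH by (simp add: algebra_simps)
  also have "(\<Sum>n=1..<N. (real N - real n) * g n) = (\<Sum>n=1..N. (real N - real n) * g n)"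
    by (rule sum.mono_neutral_left) auto
  also have "\<dots> + (\<Sum>n=1..N. g n) = (\<Sum>n=1..<Suc N. (real (Suc N) - real n) * g n)"
    by (simp add: sum.distrib[symmetric] atLeastLessThanSuc_atLeastAtMost algebra_simps del: sum.op_ivl_Suc)
  finally show ?case .
qed simp

lemma integral_cos_period:
  "has_bochner_integral lborel (\<lambda>x. cos (of_int k * x) * indicator {-pi..pi} x) (if k = 0 then 2 * pi else 0)"
proof (cases "k = 0")
  case True
  have "has_bochner_integral lborel (\<lambda>x. 1 * indicator {-pi..pi} x :: real) (pi - (-pi))"
    by (rule has_bochner_integral_FTC_Icc_real[of _ _ "\<lambda>x. x"]) (auto intro!: derivative_eq_intros)
  then show ?thesis using True by simp
next
  case False
  have "has_bochner_integral lborel (\<lambda>x. cos (of_int k * x) * indicator {-pi..pi} x)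
      (sin (of_int k * pi) / of_int k - sin (of_int k * (-pi)) / of_int k)"
    by (rule has_bochner_integral_FTC_Icc_real[of _ _ "\<lambda>x. sin (of_int k * x) / of_int k"])
      (use False in \<open>auto intro!: derivative_eq_intros continuous_intros\<close>)
  then show ?thesis using False using sin_npi_int[of k] by (simp add: mult.commute)
qed

lemma integral_cos_cos_period:
  "has_bochner_integral lborel (\<lambda>x. cos (real m * x) * cos (real n * x) * indicator {-pi..pi} x)
     (if m = n then if n = 0 then 2 * pi else pi else 0)"
proof -
  have "has_bochner_integral lborel (\<lambda>x. (1/2) * (cos (of_int (int m - int n) * x) * indicator {-pi..pi} x
      + cos (of_int (int m + int n) * x) * indicator {-pi..pi} x))
     ((1/2) * ((if int m - int n = 0 then 2 * pi else 0) + (if int m + int n = 0 then 2 * pi else 0)))"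
    by (intro has_bochner_integral_mult_right has_bochner_integral_add integral_cos_period)
  moreover have eq1: "(1/2) * (cos (of_int (int m - int n) * x) * indicator {-pi..pi} x
      + cos (of_int (int m + int n) * x) * indicator {-pi..pi} x)
      = cos (real m * x) * cos (real n * x) * indicator {-pi..pi} x" for x :: real
    by (simp add: cos_times_cos algebra_simps split: split_indicator)
  moreover have eq2: "(1/2) * ((if int m - int n = 0 then 2 * pi else 0) + (if int m + int n = 0 then 2 * pi else 0))
      = (if m = n then if n = 0 then 2 * pi else pi else 0)"
    by auto
  ultimately show ?thesis by (simp only: eq1 eq2)
qed

text \<open>Herglotz's theorem: \<open>\<sigma>\<close> is a weak limit of the measures with Fejer sum densities.\<close>

theorem herglotz_cos:
  fixes \<rho> :: "nat \<Rightarrow> real"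
  assumes \<rho>0: "\<rho> 0 = 1"
    and pd: "\<And>N x. 0 \<le> (\<Sum>j<N. \<Sum>k<N. \<rho> (nat \<bar>int j - int k\<bar>) * cos ((real j - real k) * x))"
  obtains \<sigma> where "real_distribution \<sigma>" "\<And>n. (\<integral>x. cos (real n * x) \<partial>\<sigma>) = \<rho> n"
proof -
  \<comment> \<open>The double sum in \<open>pd\<close> collected along diagonals; hence it is
    nonnegative.\<close>
  define D where "D N x = real N + 2 * (\<Sum>m=1..<N. (real N - real m) * (\<rho> m * cos (real m * x)))" for N x
  have D_nonneg: "0 \<le> D N x" for N x
  proof -
    have "cos (real (nat \<bar>int j - int k\<bar>) * x) = cos ((real j - real k) * x)" for j k
    proof (cases "k \<le> j")
      case True then show ?thesis by (simp add: nat_diff_distrib of_nat_diff)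
    next
      case False
      then have "real (nat \<bar>int j - int k\<bar>) * x = - ((real j - real k) * x)" by (simp add: algebra_simps)
      then show ?thesis by (metis cos_minus)
    qed
    then show ?thesis
      using pd[where N = N and x = x] sum_nat_abs_diff[of "\<lambda>m. \<rho> m * cos (real m * x)" N] \<rho>0 by (simp add: D_def)
  qed
  \<comment> \<open>A probability density for N > 0, whose n-th cosine coefficient is (1 - n / N)
    \<open>\<rho> n\<close> for n < N.\<close>
  define \<phi> where "\<phi> N x = D N x / (2 * pi * real N) * indicator {-pi..pi} x" for N x
  have \<phi>_nonneg: "0 \<le> \<phi> N x" for N x by (simp add: \<phi>_def D_nonneg)
  have [measurable]: "\<phi> N \<in> borel_measurable borel" for N
    unfolding \<phi>_def D_def by measurable
  have int: "has_bochner_integral lborel (\<lambda>x. \<phi> N x * cos (real n * x))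
      (if n < N then (1 - real n / real N) * \<rho> n else 0)" if "0 < N" for N n
  proof -
    define c where "c m = (if m = n then if n = 0 then 2 * pi else pi else 0)" for m :: nat
    have "has_bochner_integral lborel (\<lambda>x. 1 / (2 * pi * real N) * (real N * (cos (real 0 * x) * cos (real n * x) * indicator {-pi..pi} x)
        + 2 * (\<Sum>m=1..<N. (real N - real m) * \<rho> m * (cos (real m * x) * cos (real n * x) * indicator {-pi..pi} x))))
      (1 / (2 * pi * real N) * (real N * c 0 + 2 * (\<Sum>m=1..<N. (real N - real m) * \<rho> m * c m)))"
      unfolding c_def by (intro has_bochner_integral_mult_right has_bochner_integral_add has_bochner_integral_sum integral_cos_cos_period)
    moreover have "1 / (2 * pi * real N) * (real N * (cos (real 0 * x) * cos (real n * x) * indicator {-pi..pi} x)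
        + 2 * (\<Sum>m=1..<N. (real N - real m) * \<rho> m * (cos (real m * x) * cos (real n * x) * indicator {-pi..pi} x)))
      = \<phi> N x * cos (real n * x)" for x
    proof -
      have "(\<Sum>m=1..<N. (real N - real m) * \<rho> m * (cos (real m * x) * cos (real n * x) * indicator {-pi..pi} x))
        = (\<Sum>m=1..<N. (real N - real m) * (\<rho> m * cos (real m * x))) * (cos (real n * x) * indicator {-pi..pi} x)"
        unfolding sum_distrib_right by (intro sum.cong) (simp_all add: mult_ac)
      then show ?thesis by (simp add: \<phi>_def D_def algebra_simps add_divide_distrib)
    qed
    moreover have "1 / (2 * pi * real N) * (real N * c 0 + 2 * (\<Sum>m=1..<N. (real N - real m) * \<rho> m * c m))
       = (if n < N then (1 - real n / real N) * \<rho> n else 0)"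
    proof (cases "n = 0")
      case True
      then have "(\<Sum>m=1..<N. (real N - real m) * \<rho> m * c m) = 0" by (intro sum.neutral) (auto simp: c_def)
      then show ?thesis using True that \<rho>0 by (simp add: c_def)
    next
      case False
      have "(\<Sum>m=1..<N. (real N - real m) * \<rho> m * c m) = (\<Sum>m\<in>{1..<N}. if m = n then (real N - real n) * \<rho> n * pi else 0)"
        using False by (intro sum.cong) (auto simp: c_def)
      also have "\<dots> = (if n < N then (real N - real n) * \<rho> n * pi else 0)" using False by simp
      finally show ?thesis using False that by (auto simp: c_def field_simps)
    qed
    ultimately show ?thesis by simp
  qed
  define \<mu> where "\<mu> N = density lborel (\<lambda>x. ennreal (\<phi> (Suc N) x))" for N
  have int_\<mu>: "(\<integral>x. cos (real n * x) \<partial>\<mu> N) = (if n < Suc N then (1 - real n / real (Suc N)) * \<rho> n else 0)" for n N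
  proof -
    have "(\<integral>x. cos (real n * x) \<partial>\<mu> N) = (\<integral>x. \<phi> (Suc N) x * cos (real n * x) \<partial>lborel)"
      unfolding \<mu>_def using \<phi>_nonneg by (subst integral_real_density) auto
    then show ?thesis using int[of "Suc N" n] by (simp add: has_bochner_integral_integral_eq)
  qed
  have em: "emeasure (\<mu> N) X = (\<integral>\<^sup>+x. ennreal (\<phi> (Suc N) x) * indicator X x \<partial>lborel)" if "X \<in> sets borel" for N X
    unfolding \<mu>_def using that by (subst emeasure_density) auto
  have total: "(\<integral>\<^sup>+x. ennreal (\<phi> (Suc N) x) \<partial>lborel) = 1" for N
  proof -
    have "has_bochner_integral lborel (\<phi> (Suc N)) 1" using int[of "Suc N" 0] \<rho>0 by simp
    then show ?thesis
      using \<phi>_nonneg by (simp add: nn_integral_eq_integral has_bochner_integral_iff)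
  qed
  interpret \<mu>: real_distribution "\<mu> N" for N
  proof (intro real_distribution.intro prob_spaceI real_distribution_axioms.intro)
    show "emeasure (\<mu> N) (space (\<mu> N)) = 1"
      using em[of UNIV N] total[of N] by (simp add: \<mu>_def)
  qed (simp add: \<mu>_def)
  have "tight \<mu>"
    unfolding tight_def
  proof (intro conjI allI impI)
    fix \<epsilon> :: real assume "0 < \<epsilon>"
    \<comment> \<open>Tightness is immediate: all densities live on [-pi, pi], and pi < 4.\<close>
    have "measure (\<mu> N) {-4<..4} = 1" for N
    proof -
      have "emeasure (\<mu> N) {-4<..4} = (\<integral>\<^sup>+x. ennreal (\<phi> (Suc N) x) \<partial>lborel)"
        unfolding em[of "{-4<..4}" N, simplified] using pi_less_4
        by (intro nn_integral_cong) (auto simp: \<phi>_def split: split_indicator)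
      then show ?thesis using total[of N] by (simp add: measure_def)
    qed
    then show "\<exists>a b. a < b \<and> (\<forall>n. 1 - \<epsilon> < measure (\<mu> n) {a<..b})"
      using \<open>0 < \<epsilon>\<close> by (intro exI[of _ "-4"] exI[of _ 4]) auto
  qed (rule \<mu>.real_distribution_axioms)
  then obtain r \<sigma> where r: "strict_mono r" "real_distribution \<sigma>" "weak_conv_m (\<mu> \<circ> id \<circ> r) \<sigma>"
    using tight_imp_convergent_subsubsequence[of \<mu> id] by (auto simp: strict_mono_id)
  interpret \<sigma>: real_distribution \<sigma> by fact
  have r3: "weak_conv_m (\<lambda>k. \<mu> (r k)) \<sigma>" using r(3) by (simp add: comp_def)
  have "(\<integral>x. cos (real n * x) \<partial>\<sigma>) = \<rho> n" for n
  proof -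
    have "(\<lambda>k. \<integral>x. cos (real n * x) \<partial>(\<mu> (r k))) \<longlonglongrightarrow> (\<integral>x. cos (real n * x) \<partial>\<sigma>)"
      by (rule weak_conv_imp_integral_bdd_continuous_conv[where B = 1, OF \<mu>.real_distribution_axioms r(2) r3]) auto
    moreover have "(\<lambda>k. \<integral>x. cos (real n * x) \<partial>(\<mu> (r k))) \<longlonglongrightarrow> \<rho> n"
    proof -
      have "(\<lambda>N. (1 - real n / real (Suc N)) * \<rho> n) \<longlonglongrightarrow> (1 - 0) * \<rho> n"
        by (intro tendsto_intros LIMSEQ_Suc[OF lim_const_over_n])
      moreover have "\<forall>\<^sub>F N in sequentially. (1 - real n / real (Suc N)) * \<rho> n = (\<integral>x. cos (real n * x) \<partial>\<mu> N)"
        using eventually_ge_at_top[of n] by eventually_elim (simp only: int_\<mu> less_Suc_eq_le if_True)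
      ultimately have "(\<lambda>N. \<integral>x. cos (real n * x) \<partial>\<mu> N) \<longlonglongrightarrow> (1 - 0) * \<rho> n"
        by (rule Lim_transform_eventually)
      then have "(\<lambda>N. \<integral>x. cos (real n * x) \<partial>\<mu> N) \<longlonglongrightarrow> \<rho> n" by simp
      from LIMSEQ_subseq_LIMSEQ[OF this r(1)] show ?thesis by (simp add: comp_def)
    qed
    ultimately show ?thesis by (rule LIMSEQ_unique)
  qed
  then show thesis using that r(2) by blast
qed


section \<open>Correlations of a measure-preserving map\<close>

lemma measure_preserving_distr:
  assumes "T \<in> M \<rightarrow>\<^sub>M M" "\<And>A. A \<in> sets M \<Longrightarrow> emeasure M (T -` A \<inter> space M) = emeasure M A"
  shows "distr M M (T ^^ n) = M"
proof (induction n)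
  case 0
  then show ?case by (simp add: distr_id2 id_def)
next
  case (Suc n)
  have m: "(T ^^ n) \<in> M \<rightarrow>\<^sub>M M" using assms(1) by (rule measurable_compose_n)
  have "distr M M T = M" using assms by (intro measure_eqI) (auto simp: emeasure_distr)
  then have "distr M M (T ^^ Suc n) = distr M M (T ^^ n)"
    using distr_distr[OF m assms(1)] by (metis funpow_Suc_right)
  then show ?case using Suc.IH by (simp add: comp_def)
qed

text \<open>The covariance of the indicator of A and its n-th translate. The centring is what makes
  its Cesaro means vanish under weak mixing.\<close>

definition autocorr :: "'a measure \<Rightarrow> ('a \<Rightarrow> 'a) \<Rightarrow> 'a set \<Rightarrow> nat \<Rightarrow> real" where
  "autocorr M T A n = measure M (A \<inter> (T ^^ n) -` A) - measure M A * measure M A"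

text \<open>The double sum is the integral of the squared modulus of \<Sum> e(j x) f(T^j y), with f
  the centred indicator of A; the squares of its real and imaginary parts are expanded
  separately.\<close>

lemma autocorr_pos_def:
  assumes "prob_space M" and T: "T \<in> M \<rightarrow>\<^sub>M M" "\<And>A. A \<in> sets M \<Longrightarrow> emeasure M (T -` A \<inter> space M) = emeasure M A"
    and A: "A \<in> sets M"
  shows "0 \<le> (\<Sum>j<N. \<Sum>k<N. autocorr M T A (nat \<bar>int j - int k\<bar>) * cos ((real j - real k) * x))"
proof -
  interpret prob_space M by fact
  define f where "f y = indicator A y - measure M A" for y
  have [measurable]: "T ^^ n \<in> M \<rightarrow>\<^sub>M M" for n using T(1) by (rule measurable_compose_n)
  have [measurable]: "A \<in> sets M" by fact
  have [measurable]: "f \<in> borel_measurable M" unfolding f_def by measurable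
  have fb: "\<bar>f y\<bar> \<le> 1" for y
    using prob_le_1[of A] measure_nonneg[of M A] by (auto simp: f_def indicator_def abs_if not_less simp del: prob_le_1 measure_nonneg)
  have fbb: "\<bar>f y * f z\<bar> \<le> 1" for y z using fb[of y] fb[of z] by (simp add: abs_mult mult_le_one)
  have int: "integrable M (\<lambda>y. f ((T ^^ j) y) * f ((T ^^ k) y))" for j k
    by (rule integrable_const_bound[where B = 1]) (auto simp: fbb)
  have int0: "(\<integral>y. f y * f ((T ^^ n) y) \<partial>M) = autocorr M T A n" for n
  proof -
    have pre: "(T ^^ n) -` A \<inter> space M \<in> sets M" by measurable
    have "measure M ((T ^^ n) -` A \<inter> space M) = measure (distr M M (T ^^ n)) A"
      by (simp add: measure_distr A)
    then have mn: "measure M ((T ^^ n) -` A \<inter> space M) = measure M A"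
      by (simp add: measure_preserving_distr T)
    have "f y * f ((T ^^ n) y) = indicator (A \<inter> (T ^^ n) -` A) y - measure M A * indicator A y
        - measure M A * indicator ((T ^^ n) -` A \<inter> space M) y + measure M A * measure M A" if "y \<in> space M" for y
      using that by (auto simp: f_def algebra_simps split: split_indicator)
    then have "(\<integral>y. f y * f ((T ^^ n) y) \<partial>M) = (\<integral>y. indicator (A \<inter> (T ^^ n) -` A) y - measure M A * indicator A y
        - measure M A * indicator ((T ^^ n) -` A \<inter> space M) y + measure M A * measure M A \<partial>M)"
      by (intro Bochner_Integration.integral_cong) auto
    also have "\<dots> = measure M (A \<inter> (T ^^ n) -` A) - measure M A * measure M A - measure M A * measure M A + measure M A * measure M A"
    proof -
      have "A \<inter> (T ^^ n) -` A = A \<inter> ((T ^^ n) -` A \<inter> space M)" using sets.sets_into_space[OF A] by auto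
      then have [measurable]: "A \<inter> (T ^^ n) -` A \<in> sets M" using pre by simp
      note [measurable] = pre
      have "integrable M (\<lambda>y. indicator B y :: real)" if "B \<in> sets M" for B
        by (rule integrable_const_bound[where B = 1]) (use that in \<open>auto split: split_indicator\<close>)
      then show ?thesis using mn pre A \<open>A \<inter> (T ^^ n) -` A \<in> sets M\<close>
        by (simp add: Bochner_Integration.integral_diff Bochner_Integration.integral_add prob_space
            sets.sets_into_space Int_absorb2 del: vimage_Int)
    qed
    finally show ?thesis by (simp add: autocorr_def)
  qed
  have int_le: "(\<integral>y. f ((T ^^ j) y) * f ((T ^^ k) y) \<partial>M) = autocorr M T A (k - j)" if "j \<le> k" for j k
  proof -
    have "(\<integral>y. f ((T ^^ j) y) * f ((T ^^ k) y) \<partial>M) = (\<integral>y. f ((T ^^ j) y) * f ((T ^^ (k - j)) ((T ^^ j) y)) \<partial>M)"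
      using that by (metis comp_apply funpow_add le_add_diff_inverse2)
    also have "\<dots> = (\<integral>y. f y * f ((T ^^ (k - j)) y) \<partial>(distr M M (T ^^ j)))"
      by (subst integral_distr) auto
    finally show ?thesis by (simp add: measure_preserving_distr T int0)
  qed
  have corr: "(\<integral>y. f ((T ^^ j) y) * f ((T ^^ k) y) \<partial>M) = autocorr M T A (nat \<bar>int j - int k\<bar>)" for j k
  proof (cases "j \<le> k")
    case True then show ?thesis using int_le[OF True] by (simp add: nat_diff_distrib)
  next
    case False then show ?thesis using int_le[of k j] by (simp add: nat_diff_distrib mult.commute)
  qed
  have "0 \<le> (\<integral>y. (\<Sum>j<N. cos (real j * x) * f ((T ^^ j) y))\<^sup>2 + (\<Sum>j<N. sin (real j * x) * f ((T ^^ j) y))\<^sup>2 \<partial>M)"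
    by (intro integral_nonneg_AE AE_I2) simp
  also have "\<dots> = (\<integral>y. (\<Sum>j<N. \<Sum>k<N. cos ((real j - real k) * x) * (f ((T ^^ j) y) * f ((T ^^ k) y))) \<partial>M)"
    by (intro Bochner_Integration.integral_cong refl)
      (simp add: power2_eq_square sum_product sum.distrib[symmetric] left_diff_distrib cos_diff algebra_simps)
  also have "\<dots> = (\<Sum>j<N. \<Sum>k<N. cos ((real j - real k) * x) * autocorr M T A (nat \<bar>int j - int k\<bar>))"
    by (simp add: int corr)
  finally show ?thesis by (simp add: mult.commute)
qed


lemma average_tendsto_dominated:
  fixes f g :: "nat \<Rightarrow> real"
  assumes "(\<lambda>N. (\<Sum>n<N. \<bar>f n\<bar>) / real N) \<longlonglongrightarrow> 0" "\<And>n. \<bar>g n\<bar> \<le> \<bar>f n\<bar>"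
  shows "(\<lambda>N. (\<Sum>n<N. g n) / real N) \<longlonglongrightarrow> 0"
proof (rule Lim_null_comparison[OF always_eventually assms(1)], rule allI)
  fix N
  have "\<bar>\<Sum>n<N. g n\<bar> \<le> (\<Sum>n<N. \<bar>f n\<bar>)"
    by (rule order_trans[OF sum_abs sum_mono]) (rule assms)
  then show "norm ((\<Sum>n<N. g n) / real N) \<le> (\<Sum>n<N. \<bar>f n\<bar>) / real N"
    by (simp add: abs_divide divide_right_mono)
qed

text \<open>One half of Wiener's lemma.\<close>

lemma no_atom_if_average_tendsto_0:
  assumes "real_distribution \<sigma>"
    and "(\<lambda>N. (\<Sum>n<N. \<bar>\<integral>x. cos (real n * x) \<partial>\<sigma>\<bar>) / real N) \<longlonglongrightarrow> 0"
  shows "measure \<sigma> {a} = 0"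
proof -
  interpret real_distribution \<sigma> by fact
  define A where "A \<theta> = (if sin (\<theta> / 2) = 0 then 1 else 0 :: real)" for \<theta> :: real
  have avg: "(\<lambda>N. (\<Sum>n<N. cos (real n * \<theta>)) / real N) \<longlonglongrightarrow> A \<theta>" for \<theta>
  proof (cases "sin (\<theta> / 2) = 0")
    case True
    then obtain i :: int where "\<theta> / 2 = of_int i * pi" by (auto simp: sin_zero_iff_int2)
    then have "cos (real n * \<theta>) = 1" for n
      using cos_int_2pin[of "int n * i"] by (simp add: field_simps)
    then have "\<forall>\<^sub>F N in sequentially. 1 = (\<Sum>n<N. cos (real n * \<theta>)) / real N"
      using eventually_gt_at_top[of 0] by (auto elim!: eventually_mono)
    then show ?thesis using True by (auto simp: A_def intro: Lim_transform_eventually[OF tendsto_const])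
  next
    case False
    then show ?thesis using average_cos_tendsto_0[of \<theta> 0] by (simp add: A_def)
  qed
  \<comment> \<open>The averages converge to 1/2 for each of x = a and x = -a modulo 2 pi, and to 0
    elsewhere. So the limit \<open>g\<close> dominates half the indicator of {a}.\<close>
  define h where "h N x = (\<Sum>n<N. cos (real n * x) * cos (real n * a)) / real N" for N x
  define g where "g x = (A (x - a) + A (x + a)) / 2" for x
  have h_lim: "(\<lambda>N. h N x) \<longlonglongrightarrow> g x" for x
  proof -
    have "(\<lambda>N. ((\<Sum>n<N. cos (real n * (x - a))) / real N + (\<Sum>n<N. cos (real n * (x + a))) / real N) / 2) \<longlonglongrightarrow> g x"
      unfolding g_def by (intro tendsto_intros avg) simp
    moreover have "((\<Sum>n<N. cos (real n * (x - a))) / real N + (\<Sum>n<N. cos (real n * (x + a))) / real N) / 2 = h N x" for N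
    proof -
      have "cos (real n * x) * cos (real n * a) = (cos (real n * (x - a)) + cos (real n * (x + a))) / 2" for n
        by (simp add: cos_times_cos right_diff_distrib distrib_left)
      then show ?thesis
        by (simp only: h_def sum.distrib sum_divide_distrib[symmetric] add_divide_distrib) (simp add: add_divide_distrib)
    qed
    ultimately show ?thesis by simp
  qed
  have h_bd: "\<bar>h N x\<bar> \<le> 1" for N x
  proof -
    have "\<bar>\<Sum>n<N. cos (real n * x) * cos (real n * a)\<bar> \<le> (\<Sum>n<N. 1)"
      by (rule order_trans[OF sum_abs sum_mono]) (simp add: abs_mult mult_le_one)
    then show ?thesis by (cases "N = 0") (auto simp: h_def abs_divide divide_le_eq_1)
  qed
  have [measurable]: "h N \<in> borel_measurable borel" for N unfolding h_def by measurable
  have [measurable]: "g \<in> borel_measurable borel" by (rule borel_measurable_LIMSEQ_real[OF h_lim]) measurable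
  have lim1: "(\<lambda>N. \<integral>x. h N x \<partial>\<sigma>) \<longlonglongrightarrow> (\<integral>x. g x \<partial>\<sigma>)"
    by (rule integral_dominated_convergence[where w = "\<lambda>_. 1"]) (auto simp: h_lim h_bd)
  have "(\<integral>x. h N x \<partial>\<sigma>) = (\<Sum>n<N. (\<integral>x. cos (real n * x) \<partial>\<sigma>) * cos (real n * a)) / real N" for N
  proof -
    have "integrable \<sigma> (\<lambda>x. cos (real n * x))" for n
      by (rule integrable_const_bound[where B = 1]) auto
    then show ?thesis by (simp add: h_def)
  qed
  moreover have "(\<lambda>N. (\<Sum>n<N. (\<integral>x. cos (real n * x) \<partial>\<sigma>) * cos (real n * a)) / real N) \<longlonglongrightarrow> 0"
    by (rule average_tendsto_dominated[OF assms(2)]) (simp add: abs_mult mult_left_le)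
  ultimately have lim2: "(\<lambda>N. \<integral>x. h N x \<partial>\<sigma>) \<longlonglongrightarrow> 0" by simp
  have g0: "(\<integral>x. g x \<partial>\<sigma>) = 0" using LIMSEQ_unique[OF lim1 lim2] .
  have "(\<integral>x. 1/2 * indicator {a} x \<partial>\<sigma>) \<le> (\<integral>x. g x \<partial>\<sigma>)"
  proof (rule integral_mono)
    show "integrable \<sigma> g"
      by (rule integrable_const_bound[where B = 1]) (auto simp: g_def A_def)
    show "1/2 * indicator {a} x \<le> g x" for x
      by (auto simp: g_def A_def split: split_indicator)
    show "integrable \<sigma> (\<lambda>x. 1/2 * indicator {a} x :: real)"
      by (rule integrable_const_bound[where B = 1]) (auto split: split_indicator)
  qed
  then have "measure \<sigma> {a} \<le> 0" using g0 by simp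
  then show ?thesis using measure_nonneg[of \<sigma> "{a}"] by linarith
qed

section \<open>Products of averages of characters\<close>

lemma prod_one_plus_cis:
  assumes "finite I"
  shows "(\<Prod>j\<in>I. (1 + cis (c j * x)) / 2) = (\<Sum>F\<in>Pow I. cis ((\<Sum>j\<in>F. c j) * x)) / 2 ^ card I"
proof -
  have "(\<Prod>j\<in>F. cis (c j * x)) = cis ((\<Sum>j\<in>F. c j) * x)" for F
    by (induction F rule: infinite_finite_induct) (auto simp: cis_mult algebra_simps)
  then have "(\<Prod>j\<in>I. cis (c j * x) + 1) = (\<Sum>F\<in>Pow I. cis ((\<Sum>j\<in>F. c j) * x))"
    by (subst prod_add) (use assms in auto)
  then show ?thesis by (simp add: prod_dividef add.commute)
qed

text \<open>The squared norm is (1 + cos y) / 2 <= 1 - d^2 <= exp (- d^2). In exponential form a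
  product of such factors is controlled by the sum of squared distances.\<close>

lemma norm_one_plus_cis_le: "norm ((1 + cis y) / 2) \<le> exp (- ((idist (y / (2 * pi)))\<^sup>2) / 2)"
proof -
  define d where "d = idist (y / (2 * pi))"
  have "(norm ((1 + cis y) / 2))\<^sup>2 = ((1 + cos y)\<^sup>2 + (sin y)\<^sup>2) / 4"
    by (simp add: norm_divide power_divide cmod_power2)
  also have "(1 + cos y)\<^sup>2 + (sin y)\<^sup>2 = 2 + 2 * cos y"
    using sin_cos_squared_add[of y] unfolding power2_sum power_one by linarith
  also have "(2 + 2 * cos y) / 4 = (1 + cos y) / 2" by simp
  also have "\<dots> \<le> 1 + - (d\<^sup>2)" using one_minus_cos_ge[of y] by (simp add: d_def)
  also have "\<dots> \<le> exp (- (d\<^sup>2))" by (rule exp_ge_add_one_self)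
  also have "\<dots> = (exp (- (d\<^sup>2) / 2))\<^sup>2" by (simp add: exp_double[symmetric])
  finally show ?thesis unfolding d_def by (rule power2_le_imp_le) simp
qed

lemma prod_norm_tendsto_0:
  assumes "\<not> summable (\<lambda>n. (idist (y n / (2 * pi)))\<^sup>2)"
  shows "(\<lambda>J. \<Prod>n<J. norm ((1 + cis (y n)) / 2)) \<longlonglongrightarrow> 0"
proof -
  define S where "S J = (\<Sum>n<J. (idist (y n / (2 * pi)))\<^sup>2)" for J
  have "filterlim S at_top sequentially"
    unfolding filterlim_at_top
  proof
    fix Z
    obtain J where J: "Z \<le> S J"
    proof (rule ccontr)
      assume "\<not> thesis"
      then have "S J \<le> Z" for J using that by (meson linear)
      then show False
        using assms summableI_nonneg_bounded[of "\<lambda>n. (idist (y n / (2 * pi)))\<^sup>2" Z] by (auto simp: S_def)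
    qed
    have "S J \<le> S k" if "J \<le> k" for k unfolding S_def using that by (intro sum_mono2) auto
    with J show "\<forall>\<^sub>F k in sequentially. Z \<le> S k"
      unfolding eventually_sequentially by (meson order_trans)
  qed
  then have "(\<lambda>J. exp (- (S J / 2))) \<longlonglongrightarrow> 0"
    by (intro filterlim_compose[OF exp_at_bot] filterlim_compose[OF filterlim_uminus_at_bot_at_top])
      (auto intro!: filterlim_at_top_mult_tendsto_pos[where c = "1/2" and f = "\<lambda>_. 1/2", simplified])
  then show ?thesis
  proof (rule Lim_null_comparison[OF always_eventually, rotated], intro allI)
    fix J
    have "(\<Prod>n<J. norm ((1 + cis (y n)) / 2)) \<le> (\<Prod>n<J. exp (- ((idist (y n / (2 * pi)))\<^sup>2) / 2))"
      by (intro prod_mono conjI norm_one_plus_cis_le) simp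
    also have "\<dots> = exp (- (S J / 2))" by (simp add: exp_sum[symmetric] S_def sum_negf sum_divide_distrib)
    finally show "norm (\<Prod>n<J. norm ((1 + cis (y n)) / 2)) \<le> exp (- (S J / 2))"
      by (simp add: prod_nonneg)
  qed
qed


section \<open>Invertible measure-preserving maps: images and preimages\<close>

lemma MPT_E:
  assumes "T \<in> MPT M"
  shows "bij_betw T (space M) (space M)" "T \<in> M \<rightarrow>\<^sub>M M" "the_inv_into (space M) T \<in> M \<rightarrow>\<^sub>M M"
    "\<And>A. A \<in> sets M \<Longrightarrow> emeasure M (T -` A \<inter> space M) = emeasure M A"
  using assms unfolding MPT_def by auto

text \<open>Connects the forward images in \<open>IP_rigid\<close> with the preimages in
  \<open>weakly_mixing\<close>. An image under T is a preimage under the inverse, which is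
  measurable by \<open>MPT\<close>.\<close>

lemma MPT_funpow_image:
  assumes "T \<in> MPT M" "A \<in> sets M"
  shows "(T ^^ n) ` A \<in> sets M" "(T ^^ n) -` ((T ^^ n) ` A) \<inter> space M = A"
    "emeasure M ((T ^^ n) ` A) = emeasure M A"
    "emeasure M ((T ^^ n) -` A \<inter> space M) = emeasure M A"
proof -
  note T = MPT_E[OF assms(1)]
  have bij: "bij_betw (T ^^ n) (space M) (space M)" using T(1) by (rule bij_betw_funpow)
  have As: "A \<subseteq> space M" using assms(2) by (rule sets.sets_into_space)
  have m: "T ^^ n \<in> M \<rightarrow>\<^sub>M M" using T(2) by (rule measurable_compose_n)
  show im: "(T ^^ n) ` A \<in> sets M"
  proof (induction n)
    case 0 then show ?case using assms(2) by simp
  next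
    case (Suc n)
    let ?B = "(T ^^ n) ` A"
    have B: "?B \<subseteq> space M" using Suc.IH by (rule sets.sets_into_space)
    have "T ` ?B = the_inv_into (space M) T -` ?B \<inter> space M"
    proof (intro equalityI subsetI)
      fix y assume "y \<in> T ` ?B"
      then obtain x where "x \<in> ?B" "y = T x" by auto
      then show "y \<in> the_inv_into (space M) T -` ?B \<inter> space M"
        using B T(1) by (auto simp: bij_betw_def the_inv_into_f_f)
    next
      fix y assume y: "y \<in> the_inv_into (space M) T -` ?B \<inter> space M"
      then have "y = T (the_inv_into (space M) T y)" using T(1) by (auto simp: bij_betw_def f_the_inv_into_f)
      then show "y \<in> T ` ?B" using y by auto
    qed
    also have "\<dots> \<in> sets M" using T(3) Suc.IH by (rule measurable_sets)
    finally show ?case by (simp add: image_comp)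
  qed
  show pre: "(T ^^ n) -` ((T ^^ n) ` A) \<inter> space M = A"
    using bij As by (auto simp: bij_betw_def inj_on_def)
  have pres: "emeasure M ((T ^^ n) -` B \<inter> space M) = emeasure M B" if "B \<in> sets M" for B
  proof -
    have "emeasure M ((T ^^ n) -` B \<inter> space M) = emeasure (distr M M (T ^^ n)) B"
      using m that by (simp add: emeasure_distr)
    then show ?thesis using measure_preserving_distr[OF T(2,4)] by simp
  qed
  show "emeasure M ((T ^^ n) ` A) = emeasure M A" using pres[OF im] pre by simp
  show "emeasure M ((T ^^ n) -` A \<inter> space M) = emeasure M A" using pres[OF assms(2)] .
qed

text \<open>Both differences have the same measure because T^n A has the measure of A, and pulling
  back by T^n turns A \<inter> T^n A into T^(-n) A \<inter> A. So rigidity is a statement about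
  correlations.\<close>

lemma IP_rigid_autocorr:
  assumes "prob_space M" "T \<in> MPT M" "A \<in> sets M"
  shows "measure M (sym_diff A ((T ^^ n) ` A)) = 2 * (measure M A - measure M (A \<inter> (T ^^ n) -` A))"
proof -
  interpret prob_space M by fact
  note T = MPT_E[OF assms(2)] and im = MPT_funpow_image[OF assms(2,3), of n]
  have As: "A \<subseteq> space M" using assms(3) by (rule sets.sets_into_space)
  have pres: "measure M ((T ^^ n) -` B \<inter> space M) = measure M B" if "B \<in> sets M" for B
    using MPT_funpow_image(4)[OF assms(2) that, of n] by (simp add: measure_def)
  let ?B = "(T ^^ n) ` A"
  have "(T ^^ n) -` (A \<inter> ?B) \<inter> space M = A \<inter> (T ^^ n) -` A" using im(2) As by auto
  then have AB: "measure M (A \<inter> ?B) = measure M (A \<inter> (T ^^ n) -` A)"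
    using pres[of "A \<inter> ?B"] assms(3) im(1) by simp
  have "measure M (sym_diff A ?B) = measure M (A - A \<inter> ?B) + measure M (?B - A \<inter> ?B)"
    using assms(3) im(1) by (subst finite_measure_Union[symmetric]) (auto intro!: arg_cong[of _ _ "measure M"])
  also have "\<dots> = (measure M A - measure M (A \<inter> ?B)) + (measure M ?B - measure M (A \<inter> ?B))"
    using assms(3) im(1) by (simp add: finite_measure_Diff)
  also have "measure M ?B = measure M A" using im(3) by (simp add: measure_def)
  finally show ?thesis using AB by simp
qed

theorem uncountable_G_if_IPRWM:
  assumes "prob_space M" "non_atomic M" "b \<in> IPRWM M"
  shows "uncountable (G 2 b)"
proof
  assume "countable (G 2 b)"
  interpret prob_space M by fact
  obtain T where T: "T \<in> MPT M" "weakly_mixing M T" "IP_rigid M T b"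
    using assms(3) by (auto simp: IPRWM_def)
  \<comment> \<open>Non-atomicity applied to the whole space; the variance v of the indicator of A
    is then positive.\<close>
  obtain A where A: "A \<in> sets M" "0 < measure M A" "measure M A < 1"
    using assms(2)[unfolded non_atomic_def, rule_format, OF sets.top] emeasure_space_1
    by (auto simp: emeasure_eq_measure)
  define \<rho> where "\<rho> n = autocorr M T A n / autocorr M T A 0" for n
  define v where "v = measure M A - measure M A * measure M A"
  have v: "0 < v" using A by (simp add: v_def)
  have v0: "autocorr M T A 0 = v" by (simp add: autocorr_def v_def)
  obtain \<sigma> where \<sigma>: "real_distribution \<sigma>" and int_\<sigma>: "\<And>n. (\<integral>x. cos (real n * x) \<partial>\<sigma>) = \<rho> n"
  proof (rule herglotz_cos[of \<rho>])
    show "\<rho> 0 = 1" using v v0 by (simp add: \<rho>_def)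
    show "0 \<le> (\<Sum>j<N. \<Sum>k<N. \<rho> (nat \<bar>int j - int k\<bar>) * cos ((real j - real k) * x))" for N x
    proof -
      have "(\<Sum>j<N. \<Sum>k<N. \<rho> (nat \<bar>int j - int k\<bar>) * cos ((real j - real k) * x))
        = (\<Sum>j<N. \<Sum>k<N. autocorr M T A (nat \<bar>int j - int k\<bar>) * cos ((real j - real k) * x)) / v"
        by (simp add: \<rho>_def v0 sum_divide_distrib)
      then show ?thesis
        using v autocorr_pos_def[OF assms(1) MPT_E(2,4)[OF T(1)] A(1), where N = N and x = x] by simp
    qed
  qed auto
  interpret \<sigma>: real_distribution \<sigma> by fact
  have atom: "measure \<sigma> {a} = 0" for a
  proof (rule no_atom_if_average_tendsto_0[OF \<sigma>])
    have "(\<lambda>N. (\<Sum>n<N. \<bar>autocorr M T A n\<bar>) / real N / v) \<longlonglongrightarrow> 0 / v"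
      using T(2) A(1) v unfolding weakly_mixing_def autocorr_def by (intro tendsto_intros) auto
    moreover have eq: "\<bar>autocorr M T A n\<bar> / v = \<bar>\<rho> n\<bar>" for n using v by (simp add: \<rho>_def v0 abs_divide)
    then have "(\<Sum>n<N. \<bar>autocorr M T A n\<bar>) / real N / v = (\<Sum>n<N. \<bar>\<rho> n\<bar>) / real N" for N
      by (simp only: eq[symmetric] sum_divide_distrib[symmetric]) (simp add: mult.commute)
    ultimately show "(\<lambda>N. (\<Sum>n<N. \<bar>\<integral>x. cos (real n * x) \<partial>\<sigma>\<bar>) / real N) \<longlonglongrightarrow> 0"
      by (simp add: int_\<sigma>)
  qed
  \<comment> \<open>The tolerance v in the symmetric difference is v / 2 in the correlation, which
    leaves at least v / 2, that is \<open>\<rho>\<close> >= 1/2.\<close>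
  obtain m0 where m0: "\<And>F. F \<in> fin_subsets \<Longrightarrow> m0 \<le> Min F \<Longrightarrow> measure M (sym_diff A ((T ^^ (\<Sum>j\<in>F. b j)) ` A)) < v"
    using T(3) A(1) v unfolding IP_rigid_def tendsto_Min_at_top_iff by fastforce
  \<comment> \<open>The empty set must be covered too, as it contributes the term 1 to the expanded
    product; there \<open>\<rho> 0 = 1\<close>.\<close>
  have half: "1/2 \<le> \<rho> (\<Sum>j\<in>F. b j)" if F: "finite F" "F \<subseteq> {Suc m0..}" for F
  proof (cases "F = {}")
    case True then show ?thesis using v v0 by (simp add: \<rho>_def)
  next
    case False
    then have "Min F \<in> F" using F by simp
    then have "m0 \<le> Min F" using F by auto
    moreover have "F \<in> fin_subsets" using F False by (auto simp: fin_subsets_def)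
    ultimately have "2 * (measure M A - measure M (A \<inter> (T ^^ (\<Sum>j\<in>F. b j)) -` A)) < v"
      using m0[of F] IP_rigid_autocorr[OF assms(1) T(1) A(1)] by simp
    then have "v / 2 \<le> autocorr M T A (\<Sum>j\<in>F. b j)" by (simp add: autocorr_def v_def)
    then show ?thesis using v by (simp add: \<rho>_def v0 field_simps)
  qed
  define w where "w n x = (1 + cis (real (b (Suc (m0 + n))) * x)) / 2" for n x
  define P where "P J x = Re (\<Prod>n<J. w n x)" for J x
  have P_eq: "P J x = (\<Sum>F\<in>Pow {Suc m0..<Suc (m0 + J)}. cos (real (\<Sum>j\<in>F. b j) * x)) / 2 ^ J" for J x
  proof -
    have "(\<Prod>n<J. w n x) = (\<Prod>j\<in>{Suc m0..<Suc (m0 + J)}. (1 + cis (real (b j) * x)) / 2)"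
      unfolding w_def by (rule prod.reindex_bij_witness[of _ "\<lambda>j. j - Suc m0" "\<lambda>n. Suc (m0 + n)"]) auto
    also have "\<dots> = (\<Sum>F\<in>Pow {Suc m0..<Suc (m0 + J)}. cis ((\<Sum>j\<in>F. real (b j)) * x)) / 2 ^ J"
      by (subst prod_one_plus_cis) auto
    finally show ?thesis
      unfolding P_def by (simp add: Re_divide_numeral[symmetric] Re_sum flip: of_nat_sum)
  qed
  have P_int: "1/2 \<le> (\<integral>x. P J x \<partial>\<sigma>)" for J
  proof -
    have i: "integrable \<sigma> (\<lambda>x. cos (c * x))" for c
      by (rule \<sigma>.integrable_const_bound[where B = 1]) auto
    have "(\<Sum>F\<in>Pow {Suc m0..<Suc (m0 + J)}. 1/2) \<le> (\<Sum>F\<in>Pow {Suc m0..<Suc (m0 + J)}. \<integral>x. cos (real (\<Sum>j\<in>F. b j) * x) \<partial>\<sigma>)"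
      unfolding int_\<sigma> by (intro sum_mono half) (auto intro: finite_subset)
    then have "2 ^ J * (1/2) \<le> (\<Sum>F\<in>Pow {Suc m0..<Suc (m0 + J)}. \<integral>x. cos (real (\<Sum>j\<in>F. b j) * x) \<partial>\<sigma>)"
      by (simp add: card_Pow)
    also have "\<dots> = 2 ^ J * (\<integral>x. P J x \<partial>\<sigma>)"
      unfolding P_eq using i by (simp add: del: of_nat_sum)
    finally show ?thesis by simp
  qed
  \<comment> \<open>The spectral variable is x = 2 pi t with t any real representative, so
    \<open>C\<close> consists of countably many scaled translates of \<open>G 2 b\<close>.\<close>
  define C where "C = {x. frac (x / (2 * pi)) \<in> G 2 b}"
  have "C \<subseteq> (\<Union>n::int. (\<lambda>g. 2 * pi * (of_int n + g)) ` G 2 b)"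
  proof
    fix x assume "x \<in> C"
    moreover have "x = 2 * pi * (of_int \<lfloor>x / (2 * pi)\<rfloor> + frac (x / (2 * pi)))" by (simp add: frac_def)
    ultimately show "x \<in> (\<Union>n::int. (\<lambda>g. 2 * pi * (of_int n + g)) ` G 2 b)" unfolding C_def by blast
  qed
  moreover have "countable (\<Union>n::int. (\<lambda>g. 2 * pi * (of_int n + g)) ` G 2 b)"
    using \<open>countable (G 2 b)\<close> by auto
  ultimately have C: "countable C" by (rule countable_subset)
  have "(\<Union>a\<in>C. {a}) \<in> null_sets \<sigma>"
    using C by (intro null_sets_UN') (auto simp: null_sets_def atom \<sigma>.emeasure_eq_measure)
  then have AE_C: "AE x in \<sigma>. x \<notin> C" by (intro AE_I'[of C]) auto
  have P_lim: "(\<lambda>J. P J x) \<longlonglongrightarrow> 0" if "x \<notin> C" for x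
  proof (rule Lim_null_comparison[OF always_eventually])
    show "\<forall>J. norm (P J x) \<le> (\<Prod>n<J. norm (w n x))"
      unfolding P_def by (auto intro: order_trans[OF abs_Re_le_cmod] simp: prod_norm)
    have "\<not> summable (\<lambda>n. (idist (real (b (Suc (m0 + n))) * x / (2 * pi)))\<^sup>2)"
    proof
      assume "summable (\<lambda>n. (idist (real (b (Suc (m0 + n))) * x / (2 * pi)))\<^sup>2)"
      then have "summable (\<lambda>n. (idist (real (b (Suc n)) * x / (2 * pi)))\<^sup>2)"
        using summable_iff_shift[of "\<lambda>n. (idist (real (b (Suc n)) * x / (2 * pi)))\<^sup>2" m0] by (simp add: add.commute)
      then have "summable (\<lambda>n. idist (real (b (Suc n)) * (x / (2 * pi))) powr 2)"
        by (simp add: powr_numeral infdist_nonneg)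
      then have "frac (x / (2 * pi)) \<in> G 2 b" unfolding G_def by (simp add: frac_lt_1)
      then show False using that by (simp add: C_def)
    qed
    then show "(\<lambda>J. \<Prod>n<J. norm (w n x)) \<longlonglongrightarrow> 0" unfolding w_def by (rule prod_norm_tendsto_0)
  qed
  have "(\<lambda>J. \<integral>x. P J x \<partial>\<sigma>) \<longlonglongrightarrow> (\<integral>x. 0 \<partial>\<sigma>)"
  proof (rule integral_dominated_convergence[where w = "\<lambda>_. 1"])
    show "P J \<in> borel_measurable \<sigma>" for J unfolding P_eq by measurable
    show "AE x in \<sigma>. (\<lambda>J. P J x) \<longlonglongrightarrow> 0" using AE_C by eventually_elim (rule P_lim)
    have "norm (P J x) \<le> 1" for J x
    proof -
      have "\<bar>\<Sum>F\<in>Pow {Suc m0..<Suc (m0 + J)}. cos (real (\<Sum>j\<in>F. b j) * x)\<bar> \<le> (\<Sum>F\<in>Pow {Suc m0..<Suc (m0 + J)}. 1)"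
        by (rule order_trans[OF sum_abs sum_mono]) auto
      then show ?thesis by (simp add: P_eq abs_divide card_Pow del: of_nat_sum)
    qed
    then show "AE x in \<sigma>. norm (P J x) \<le> 1" for J by simp
  qed auto
  then have "(1/2::real) \<le> 0" using P_int by (intro LIMSEQ_le_const[of "\<lambda>J. \<integral>x. P J x \<partial>\<sigma>"]) auto
  then show False by simp
qed

section \<open>Trigonometric monotone class theorem\<close>

text \<open>
  A monotone class theorem for the trigonometric polynomials on a product of real lines.
  Products of cosines being sums of cosines, one passes by Bernstein polynomials from
  \<open>cos (\<theta> x\<^sub>j + \<beta>)\<close> to the indicator of \<open>{cos (\<theta> x\<^sub>j + \<beta>) > 0}\<close>, and by letting the period tend
  to infinity to the indicator of a half line.
\<close>

locale trig_monotone_class =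
  fixes W :: "(('i \<Rightarrow> real) \<Rightarrow> real) \<Rightarrow> bool"
  assumes W_add: "\<And>f g. W f \<Longrightarrow> W g \<Longrightarrow> W (\<lambda>x. f x + g x)"
    and W_scale: "\<And>f c. W f \<Longrightarrow> W (\<lambda>x. c * f x)"
    and W_lim: "\<And>F f C. (\<And>n. W (F n)) \<Longrightarrow> (\<And>n x. \<bar>F n x\<bar> \<le> C) \<Longrightarrow> (\<And>x. (\<lambda>n. F n x) \<longlonglongrightarrow> f x) \<Longrightarrow> W f"
    and W_cos: "\<And>J c a. finite J \<Longrightarrow> W (\<lambda>x. cos ((\<Sum>j\<in>J. c j * x j) + a))"
begin

text \<open>\<open>W\<close> is not assumed closed under products. The bounded functions that
  multiply every cosine into \<open>W\<close> can be accumulated one factor after another, and the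
  bound is what \<open>W_lim\<close> asks for.\<close>

definition trig_multiplier :: "(('i \<Rightarrow> real) \<Rightarrow> real) \<Rightarrow> bool" where
  "trig_multiplier m \<longleftrightarrow> (\<exists>C. \<forall>x. \<bar>m x\<bar> \<le> C) \<and>
     (\<forall>J c a. finite J \<longrightarrow> W (\<lambda>x. m x * cos ((\<Sum>j\<in>J. c j * x j) + a)))"

lemma trig_multiplier_one: "trig_multiplier (\<lambda>_. 1)"
  unfolding trig_multiplier_def using W_cos by auto

lemma trig_multiplier_cosD:
  "trig_multiplier m \<Longrightarrow> finite J \<Longrightarrow> W (\<lambda>x. m x * cos ((\<Sum>j\<in>J. c j * x j) + a))"
  unfolding trig_multiplier_def by blast

lemma trig_multiplierD: "trig_multiplier m \<Longrightarrow> W m"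
  unfolding trig_multiplier_def by (drule conjunct2, drule spec[of _ "{}"]) (auto dest!: spec[of _ 0])

lemma trig_multiplier_bdd:
  assumes "trig_multiplier m" obtains C where "0 < C" "\<And>x. \<bar>m x\<bar> \<le> C"
proof -
  obtain C where "\<And>x. \<bar>m x\<bar> \<le> C" using assms unfolding trig_multiplier_def by auto
  then have "\<bar>m x\<bar> \<le> max C 1" for x by (simp add: le_max_iff_disj)
  then show thesis using that[of "max C 1"] by simp
qed

text \<open>The coefficients are cut off outside J, where \<open>c\<close> is arbitrary, so that the
  case of j outside J and the case of j in J are treated together.\<close>

lemma linear_form_add:
  fixes c :: "'i \<Rightarrow> real"
  assumes "finite J"
  shows "(\<Sum>i\<in>insert j J. ((if i \<in> J then c i else 0) + (if i = j then \<theta> else 0)) * x i) = (\<Sum>i\<in>J. c i * x i) + \<theta> * x j"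
proof -
  have "(\<Sum>i\<in>insert j J. ((if i \<in> J then c i else 0) + (if i = j then \<theta> else 0)) * x i)
    = (\<Sum>i\<in>insert j J. if i \<in> J then c i * x i else 0) + (\<Sum>i\<in>insert j J. if i = j then \<theta> * x i else 0)"
    unfolding sum.distrib[symmetric] by (intro sum.cong) (auto simp: distrib_right)
  also have "(\<Sum>i\<in>insert j J. if i \<in> J then c i * x i else 0) = (\<Sum>i\<in>J. c i * x i)"
    using assms by (intro sum.mono_neutral_cong_right) auto
  also have "(\<Sum>i\<in>insert j J. if i = j then \<theta> * x i else 0) = \<theta> * x j"
    using assms by simp
  finally show ?thesis .
qed

lemma trig_multiplier_mult_cos:
  assumes "trig_multiplier m"
  shows "trig_multiplier (\<lambda>x. m x * cos (\<theta> * x j + \<beta>))"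
proof -
  obtain C where C: "0 < C" "\<And>x. \<bar>m x\<bar> \<le> C" using trig_multiplier_bdd[OF assms] by blast
  have "\<bar>m x * cos (\<theta> * x j + \<beta>)\<bar> \<le> C" for x
    using mult_mono[OF C(2)[of x] abs_cos_le_one[of "\<theta> * x j + \<beta>"]] C(1) by (simp add: abs_mult)
  moreover have "W (\<lambda>x. m x * cos (\<theta> * x j + \<beta>) * cos ((\<Sum>i\<in>J. c i * x i) + a))" if "finite J" for J c a
  proof -
    have *: "W (\<lambda>x. m x * cos ((\<Sum>i\<in>J. c i * x i) + \<theta>' * x j + a'))" for \<theta>' a'
    proof -
      let ?c = "\<lambda>i. (if i \<in> J then c i else 0) + (if i = j then \<theta>' else 0)"
      have "W (\<lambda>x. m x * cos ((\<Sum>i\<in>insert j J. ?c i * x i) + a'))"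
        by (rule trig_multiplier_cosD[OF assms]) (use that in simp)
      then show ?thesis by (simp only: linear_form_add[OF that])
    qed
    have "W (\<lambda>x. (1/2) * (m x * cos ((\<Sum>i\<in>J. c i * x i) + (-\<theta>) * x j + (a - \<beta>))) + (1/2) * (m x * cos ((\<Sum>i\<in>J. c i * x i) + \<theta> * x j + (a + \<beta>))))"
      by (intro W_add W_scale *)
    also have "(\<lambda>x. (1/2) * (m x * cos ((\<Sum>i\<in>J. c i * x i) + (-\<theta>) * x j + (a - \<beta>))) + (1/2) * (m x * cos ((\<Sum>i\<in>J. c i * x i) + \<theta> * x j + (a + \<beta>))))
      = (\<lambda>x. m x * cos (\<theta> * x j + \<beta>) * cos ((\<Sum>i\<in>J. c i * x i) + a))"
    proof
      fix x
      have e: "(\<Sum>i\<in>J. c i * x i) + (-\<theta>) * x j + (a - \<beta>) = ((\<Sum>i\<in>J. c i * x i) + a) - (\<theta> * x j + \<beta>)"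
        "(\<Sum>i\<in>J. c i * x i) + \<theta> * x j + (a + \<beta>) = ((\<Sum>i\<in>J. c i * x i) + a) + (\<theta> * x j + \<beta>)"
        by (simp_all add: algebra_simps)
      show "(1/2) * (m x * cos ((\<Sum>i\<in>J. c i * x i) + (-\<theta>) * x j + (a - \<beta>))) + (1/2) * (m x * cos ((\<Sum>i\<in>J. c i * x i) + \<theta> * x j + (a + \<beta>)))
        = m x * cos (\<theta> * x j + \<beta>) * cos ((\<Sum>i\<in>J. c i * x i) + a)"
        unfolding e cos_diff cos_add by (simp add: algebra_simps)
    qed
    finally show ?thesis .
  qed
  ultimately show ?thesis unfolding trig_multiplier_def by blast
qed

lemma trig_multiplier_add:
  assumes "trig_multiplier m" "trig_multiplier m'"
  shows "trig_multiplier (\<lambda>x. m x + m' x)"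
proof -
  obtain C where C: "0 < C" "\<And>x. \<bar>m x\<bar> \<le> C" using trig_multiplier_bdd[OF assms(1)] by blast
  obtain C' where C': "0 < C'" "\<And>x. \<bar>m' x\<bar> \<le> C'" using trig_multiplier_bdd[OF assms(2)] by blast
  have "\<bar>m x + m' x\<bar> \<le> C + C'" for x using C(2)[of x] C'(2)[of x] by linarith
  then show ?thesis using assms W_add unfolding trig_multiplier_def by (auto simp: distrib_right)
qed

lemma trig_multiplier_scale:
  assumes "trig_multiplier m"
  shows "trig_multiplier (\<lambda>x. k * m x)"
proof -
  obtain C where C: "0 < C" "\<And>x. \<bar>m x\<bar> \<le> C" using trig_multiplier_bdd[OF assms] by blast
  have "\<bar>k * m x\<bar> \<le> \<bar>k\<bar> * C" for x using C(2)[of x] by (simp add: abs_mult mult_left_mono)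
  then show ?thesis using assms W_scale[where c = k] unfolding trig_multiplier_def by (auto simp: mult.assoc)
qed

lemma trig_multiplier_sum:
  assumes "trig_multiplier m" "\<And>k. k \<in> K \<Longrightarrow> trig_multiplier (f k)"
  shows "trig_multiplier (\<lambda>x. \<Sum>k\<in>K. f k x)"
  using assms(2)
proof (induction K rule: infinite_finite_induct)
  case (insert k K)
  then show ?case using trig_multiplier_add[of "f k" "\<lambda>x. \<Sum>k\<in>K. f k x"] by simp
qed (use trig_multiplier_scale[OF assms(1), of 0] in simp_all)

lemma trig_multiplier_lim:
  assumes m: "\<And>n. trig_multiplier (F n)" and bd: "\<And>n x. \<bar>F n x\<bar> \<le> C" and lim: "\<And>x. (\<lambda>n. F n x) \<longlonglongrightarrow> f x"
  shows "trig_multiplier f"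
  unfolding trig_multiplier_def
proof (intro conjI allI impI exI)
  show "\<bar>f x\<bar> \<le> C" for x
    by (rule LIMSEQ_le_const2[OF tendsto_rabs[OF lim]]) (use bd in auto)
  fix J and c :: "'i \<Rightarrow> real" and a :: real assume J: "finite (J :: 'i set)"
  show "W (\<lambda>x. f x * cos ((\<Sum>j\<in>J. c j * x j) + a))"
  proof (rule W_lim[where F = "\<lambda>n x. F n x * cos ((\<Sum>j\<in>J. c j * x j) + a)"])
    show "W (\<lambda>x. F n x * cos ((\<Sum>j\<in>J. c j * x j) + a))" for n
      using m[of n] J unfolding trig_multiplier_def by blast
    show "\<bar>F n x * cos ((\<Sum>j\<in>J. c j * x j) + a)\<bar> \<le> C" for n x
      using mult_mono[OF bd[of n x] abs_cos_le_one[of "(\<Sum>j\<in>J. c j * x j) + a"]] order_trans[OF abs_ge_zero bd[of n x]]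
      by (simp add: abs_mult)
  qed (intro tendsto_intros lim)
qed

lemma trig_multiplier_bernstein:
  assumes "trig_multiplier m"
  shows "trig_multiplier (\<lambda>x. m x * (\<Sum>k\<le>n. g (real k / real n) * Bernstein n k ((1 + cos (\<theta> * x j + \<beta>)) / 2)))"
proof -
  let ?s = "\<lambda>x. cos (\<theta> * x j + \<beta>)"
  have aff: "trig_multiplier (\<lambda>x. m' x * (1/2 + e * ?s x))" if "trig_multiplier m'" for m' e
    using trig_multiplier_add[OF trig_multiplier_scale[OF that, of "1/2"] trig_multiplier_scale[OF trig_multiplier_mult_cos[OF that], of e]]
    by (simp add: algebra_simps)
  \<comment> \<open>The values e = 1/2 and e = -1/2 give the powers of y and of 1 - y in the
    Bernstein basis, where y = (1 + cos) / 2.\<close>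
  have pw: "trig_multiplier (\<lambda>x. m' x * (1/2 + e * ?s x) ^ k)" if "trig_multiplier m'" for m' e k
  proof (induction k)
    case (Suc k)
    then show ?case using aff[OF Suc.IH, of e] by (simp add: mult_ac)
  qed (use that in simp)
  have "trig_multiplier (\<lambda>x. \<Sum>k\<le>n. (g (real k / real n) * real (n choose k)) * (m x * (1/2 + 1/2 * ?s x) ^ k * (1/2 + (-1/2) * ?s x) ^ (n - k)))"
    by (intro trig_multiplier_sum[OF assms] trig_multiplier_scale pw assms)
  also have "(\<lambda>x. \<Sum>k\<le>n. (g (real k / real n) * real (n choose k)) * (m x * (1/2 + 1/2 * ?s x) ^ k * (1/2 + (-1/2) * ?s x) ^ (n - k)))
    = (\<lambda>x. m x * (\<Sum>k\<le>n. g (real k / real n) * Bernstein n k ((1 + ?s x) / 2)))"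
  proof (rule ext, unfold sum_distrib_left, rule sum.cong[OF refl])
    fix x k
    have "1/2 + 1/2 * ?s x = (1 + ?s x) / 2" "1/2 + (-1/2) * ?s x = 1 - (1 + ?s x) / 2" by (simp_all add: field_simps)
    then show "(g (real k / real n) * real (n choose k)) * (m x * (1/2 + 1/2 * ?s x) ^ k * (1/2 + (-1/2) * ?s x) ^ (n - k))
      = m x * (g (real k / real n) * Bernstein n k ((1 + ?s x) / 2))"
      by (simp only: Bernstein_def mult_ac)
  qed
  finally show ?thesis .
qed

lemma trig_multiplier_continuous:
  assumes m: "trig_multiplier m" and g: "continuous_on {0..1} g" and gb: "\<And>y. \<bar>g y\<bar> \<le> 1"
  shows "trig_multiplier (\<lambda>x. m x * g ((1 + cos (\<theta> * x j + \<beta>)) / 2))"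
proof -
  obtain C where C: "0 < C" "\<And>x. \<bar>m x\<bar> \<le> C" using trig_multiplier_bdd[OF m] by blast
  define p where "p n y = (\<Sum>k\<le>n. g (real k / real n) * Bernstein n k y)" for n y
  have "\<exists>N. \<forall>y\<in>{0..1}. \<bar>g y - p N y\<bar> < inverse (real (Suc i))" for i
    using Bernstein_Weierstrass[OF g, of "inverse (real (Suc i))"] unfolding p_def by fastforce
  then obtain N where N: "\<And>i y. y \<in> {0..1} \<Longrightarrow> \<bar>g y - p (N i) y\<bar> < inverse (real (Suc i))" by metis
  define y where "y x = (1 + cos (\<theta> * x j + \<beta>)) / 2" for x :: "'i \<Rightarrow> real"
  have y: "y x \<in> {0..1}" for x
  proof -
    have "(1 + s) / 2 \<in> {0..1}" if "-1 \<le> s" "s \<le> 1" for s :: real using that by simp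
    then show ?thesis unfolding y_def by (metis cos_ge_minus_one cos_le_one)
  qed
  have "trig_multiplier (\<lambda>x. m x * g (y x))"
  proof (rule trig_multiplier_lim[where F = "\<lambda>i x. m x * p (N i) (y x)" and C = "C * 2"])
    show "trig_multiplier (\<lambda>x. m x * p (N i) (y x))" for i
      unfolding p_def y_def by (rule trig_multiplier_bernstein[OF m])
    show "\<bar>m x * p (N i) (y x)\<bar> \<le> C * 2" for i x
    proof -
      have "inverse (real (Suc i)) \<le> 1" by (simp add: field_simps)
      then have "\<bar>p (N i) (y x)\<bar> \<le> 2" using N[OF y, of x i] gb[of "y x"] by linarith
      then show ?thesis using C mult_mono[OF C(2)[of x], of _ 2] by (simp add: abs_mult)
    qed
    show "(\<lambda>i. m x * p (N i) (y x)) \<longlonglongrightarrow> m x * g (y x)" for x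
    proof (rule tendsto_mult_left)
      have "(\<lambda>i. p (N i) (y x) - g (y x)) \<longlonglongrightarrow> 0"
        by (rule Lim_null_comparison[OF always_eventually LIMSEQ_inverse_real_of_nat])
          (use N[OF y] in \<open>auto intro!: less_imp_le simp: abs_minus_commute\<close>)
      then show "(\<lambda>i. p (N i) (y x)) \<longlonglongrightarrow> g (y x)" by (rule LIM_zero_cancel)
    qed
  qed
  then show ?thesis by (simp add: y_def)
qed

lemma trig_multiplier_half_line:
  assumes m: "trig_multiplier m"
  shows "trig_multiplier (\<lambda>x. m x * indicator {a<..} (x j))"
proof -
  obtain C where C: "0 < C" "\<And>x. \<bar>m x\<bar> \<le> C" using trig_multiplier_bdd[OF m] by blast
  have pos: "trig_multiplier (\<lambda>x. m x * indicator {0<..} (cos (\<theta> * x j + \<beta>)))" for \<theta> \<beta>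
  proof (rule trig_multiplier_lim)
    \<comment> \<open>Ramps increasing to the indicator of y > 1/2, which for y = (1 + cos) / 2
      means a positive cosine.\<close>
    let ?g = "\<lambda>n y. max 0 (min 1 (real n * (y - 1/2)))"
    show "trig_multiplier (\<lambda>x. m x * ?g n ((1 + cos (\<theta> * x j + \<beta>)) / 2))" for n
      by (rule trig_multiplier_continuous[OF m]) (auto intro!: continuous_intros)
    show "\<bar>m x * ?g n ((1 + cos (\<theta> * x j + \<beta>)) / 2)\<bar> \<le> C * 1" for n x
      unfolding abs_mult by (intro mult_mono C(2)) (use C(1) in auto)
    show "(\<lambda>n. m x * ?g n ((1 + cos (\<theta> * x j + \<beta>)) / 2)) \<longlonglongrightarrow> m x * indicator {0<..} (cos (\<theta> * x j + \<beta>))" for x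
    proof (rule tendsto_mult_left)
      define s where "s = cos (\<theta> * x j + \<beta>)"
      have y: "(1 + s) / 2 - 1/2 = s / 2" by (simp add: field_simps)
      show "(\<lambda>n. ?g n ((1 + cos (\<theta> * x j + \<beta>)) / 2)) \<longlonglongrightarrow> indicator {0<..} (cos (\<theta> * x j + \<beta>))"
        unfolding s_def[symmetric] y
      proof (cases "0 < s")
        case True
        obtain n0 where n0: "1 < real n0 * (s / 2)" using reals_Archimedean3 True half_gt_zero by blast
        have "\<forall>\<^sub>F n in sequentially. 1 = max 0 (min 1 (real n * (s / 2)))"
          using eventually_ge_at_top[of n0]
        proof eventually_elim
          case (elim n)
          then have "real n0 * (s / 2) \<le> real n * (s / 2)" using True by (intro mult_right_mono) auto
          then show ?case using n0 by simp
        qed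
        then show "(\<lambda>n. max 0 (min 1 (real n * (s / 2)))) \<longlonglongrightarrow> indicator {0<..} s"
          using True by (auto intro: Lim_transform_eventually[OF tendsto_const])
      next
        case False
        then have "max 0 (min 1 (real n * (s / 2))) = 0" for n
          using mult_nonneg_nonpos[of "real n" "s / 2"] by auto
        then show "(\<lambda>n. max 0 (min 1 (real n * (s / 2)))) \<longlonglongrightarrow> indicator {0<..} s"
          using False by simp
      qed
    qed
  qed
  show ?thesis
  proof (rule trig_multiplier_lim)
    \<comment> \<open>This is sin ((x j - a) / (n + 1)), which has the sign of x j - a as soon as
      its argument is below pi in modulus.\<close>
    let ?s = "\<lambda>n x. cos (1 / real (Suc n) * x j + (- a / real (Suc n) - pi / 2))"
    show "trig_multiplier (\<lambda>x. m x * indicator {0<..} (?s n x))" for n by (rule pos)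
    show "\<bar>m x * indicator {0<..} (?s n x)\<bar> \<le> C * 1" for n x
      unfolding abs_mult by (intro mult_mono C(2)) (use C(1) in \<open>auto split: split_indicator\<close>)
    show "(\<lambda>n. m x * indicator {0<..} (?s n x)) \<longlonglongrightarrow> m x * indicator {a<..} (x j)" for x
    proof (rule tendsto_mult_left, rule Lim_transform_eventually[OF tendsto_const])
      have s: "?s n x = sin ((x j - a) / real (Suc n))" for n
      proof -
        have "1 / real (Suc n) * x j + (- a / real (Suc n) - pi / 2) = (x j - a) / real (Suc n) - pi / 2"
          by (simp add: diff_divide_distrib)
        then show ?thesis by (simp only: cos_diff cos_pi_half sin_pi_half mult_zero_right mult_1_right add_0_left)
      qed
      have "(\<lambda>n. (x j - a) / real (Suc n)) \<longlonglongrightarrow> 0" by (rule LIMSEQ_Suc[OF lim_const_over_n])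
      then have "\<forall>\<^sub>F n in sequentially. \<bar>(x j - a) / real (Suc n)\<bar> < pi"
        by (intro order_tendstoD(2)[OF tendsto_rabs_zero pi_gt_zero])
      then show "\<forall>\<^sub>F n in sequentially. indicator {a<..} (x j) = (indicator {0<..} (?s n x) :: real)"
      proof eventually_elim
        case (elim n)
        have "0 < sin ((x j - a) / real (Suc n)) \<longleftrightarrow> a < x j"
        proof
          assume "a < x j"
          then show "0 < sin ((x j - a) / real (Suc n))" using elim by (intro sin_gt_zero) auto
        next
          assume "0 < sin ((x j - a) / real (Suc n))"
          moreover have "sin ((x j - a) / real (Suc n)) \<le> 0" if "x j \<le> a"
            using sin_ge_zero[of "- ((x j - a) / real (Suc n))"] elim that
            by (auto simp: abs_if divide_nonpos_pos split: if_splits)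
          ultimately show "a < x j" by fastforce
        qed
        then show ?case unfolding s by (simp add: indicator_def)
      qed
    qed
  qed
qed

lemma W_finite_half_lines:
  assumes "finite S"
  shows "W (indicator {x. \<forall>(j, a)\<in>S. a < x j})"
proof -
  have "trig_multiplier (indicator {x. \<forall>(j, a)\<in>S. a < x j})"
    using assms
  proof (induction S)
    case empty then show ?case using trig_multiplier_one by (simp add: indicator_def)
  next
    case (insert p S)
    obtain j a where p: "p = (j, a)" by (cases p)
    have "trig_multiplier (\<lambda>x. indicator {x. \<forall>(j, a)\<in>S. a < x j} x * indicator {a<..} (x j))"
      by (rule trig_multiplier_half_line[OF insert.IH])
    also have "(\<lambda>x. indicator {x. \<forall>(j, a)\<in>S. a < x j} x * indicator {a<..} (x j)) = (indicator {x. \<forall>(j, a)\<in>insert p S. a < x j} :: ('i \<Rightarrow> real) \<Rightarrow> real)"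
      by (auto simp: p fun_eq_iff split: split_indicator)
    finally show ?case .
  qed
  then show ?thesis by (rule trig_multiplierD)
qed

text \<open>Dynkin's argument: complements and disjoint countable unions become linear combinations
  and bounded limits of indicators.\<close>

theorem W_indicator:
  assumes "A \<in> sets (PiM UNIV (\<lambda>_. borel))"
  shows "W (indicator A)"
proof -
  \<comment> \<open>\<open>S\<close> is a set of pairs, so a coordinate may be constrained
    repeatedly, and intersections correspond to unions of the sets \<open>S\<close>.\<close>
  define \<G> where "\<G> = {{x :: 'i \<Rightarrow> real. \<forall>(j, a)\<in>S. a < x j} | S. finite S}"
  have one: "W (\<lambda>_. 1)" using W_cos[of "{}" _ 0] by simp
  have "Int_stable \<G>"
  proof (rule Int_stableI)
    fix a b assume "a \<in> \<G>" "b \<in> \<G>"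
    then obtain S S' where "finite S" "a = {x. \<forall>(j, a)\<in>S. a < x j}" "finite S'" "b = {x. \<forall>(j, a)\<in>S'. a < x j}"
      by (auto simp: \<G>_def)
    then show "a \<inter> b \<in> \<G>" unfolding \<G>_def by (intro CollectI exI[of _ "S \<union> S'"]) auto
  qed
  have gen: "sets (PiM UNIV (\<lambda>_::'i. borel :: real measure)) \<subseteq> sets (sigma UNIV \<G>)"
    unfolding sets_PiM_single
  proof (rule sets.sigma_sets_subset', safe)
    fix i and B :: "real set" assume B: "B \<in> sets borel"
    have "(\<lambda>x. x i) \<in> borel_measurable (sigma UNIV \<G>)"
      unfolding borel_measurable_iff_greater
    proof
      fix a
      have "{x. a < x i} \<in> \<G>" unfolding \<G>_def by (intro CollectI exI[of _ "{(i, a)}"]) auto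
      then show "{w \<in> space (sigma UNIV \<G>). a < w i} \<in> sets (sigma UNIV \<G>)"
        by (simp add: sigma_sets.Basic)
    qed
    from measurable_sets[OF this B] have "{x. x i \<in> B} \<in> sets (sigma UNIV \<G>)"
      by (simp add: vimage_def)
    then show "{f \<in> \<Pi>\<^sub>E i\<in>UNIV. space borel. f i \<in> B} \<in> sets (sigma UNIV \<G>)" by (simp add: PiE_def)
  qed (auto simp: PiE_def sigma_sets_top)
  have "\<G> \<subseteq> Pow UNIV" "A \<in> sigma_sets UNIV \<G>" using assms gen by auto
  then show ?thesis
  proof (induction rule: sigma_sets_induct_disjoint[OF \<open>Int_stable \<G>\<close>, consumes 2, case_names basic empty compl union])
    case (basic A)
    then show ?case unfolding \<G>_def using W_finite_half_lines by auto
  next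
    case empty
    have "W (\<lambda>x. 0 * 1)" by (rule W_scale[OF one])
    then show ?case by (simp add: indicator_def)
  next
    case (compl A)
    have "W (\<lambda>x. 1 + (-1) * indicator A x)" by (intro W_add one W_scale compl.IH)
    also have "(\<lambda>x. 1 + (-1) * indicator A x) = (indicator (UNIV - A) :: ('i \<Rightarrow> real) \<Rightarrow> real)"
      by (auto split: split_indicator)
    finally show ?case .
  next
    case (union A)
    have part: "W (indicator (\<Union>i<n. A i))" for n
    proof (induction n)
      case 0
      have "W (\<lambda>x. 0 * 1)" by (rule W_scale[OF one])
      then show ?case by (simp add: indicator_def)
    next
      case (Suc n)
      have "W (\<lambda>x. indicator (\<Union>i<n. A i) x + indicator (A n) x)" using Suc union.IH by (intro W_add) auto
      also have "(\<lambda>x. indicator (\<Union>i<n. A i) x + indicator (A n) x) = (indicator (\<Union>i<Suc n. A i) :: ('i \<Rightarrow> real) \<Rightarrow> real)"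
      proof
        fix x
        have "A i \<inter> A n = {}" if "i < n" for i
          using that by (intro disjoint_family_onD[OF union.hyps(1)]) auto
        then have "(\<Union>i<n. A i) \<inter> A n = {}" by blast
        then show "indicator (\<Union>i<n. A i) x + indicator (A n) x = (indicator (\<Union>i<Suc n. A i) x :: real)"
          by (auto simp: lessThan_Suc split: split_indicator)
      qed
      finally show ?case .
    qed
    show ?case
    proof (rule W_lim[OF part])
      show "\<bar>indicator (\<Union>i<n. A i) x :: real\<bar> \<le> 1" for n x by (auto split: split_indicator)
      show "(\<lambda>n. indicator (\<Union>i<n. A i) x) \<longlonglongrightarrow> (indicator (\<Union>i. A i) x :: real)" for x
        by (rule LIMSEQ_indicator_UN)
    qed
  qed
qed

end

section \<open>The Gaussian process\<close>

abbreviation gauss_seq :: "(nat \<Rightarrow> real) measure" where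
  "gauss_seq \<equiv> PiM UNIV (\<lambda>_. std_normal_distribution)"

interpretation gauss_seq: product_prob_space "\<lambda>_::nat. std_normal_distribution" UNIV
  by (intro product_prob_spaceI prob_space_normal_density) simp

lemma sets_gauss_seq [measurable_cong]: "sets gauss_seq = sets (PiM UNIV (\<lambda>_. borel))"
  by (rule sets_PiM_cong) auto

lemma space_gauss_seq [simp]: "space gauss_seq = UNIV"
  by (simp add: space_PiM)

lemma distr_gauss_seq_component: "distr gauss_seq borel (\<lambda>\<omega>. \<omega> j) = std_normal_distribution"
proof -
  have "distr gauss_seq borel (\<lambda>\<omega>. \<omega> j) = distr gauss_seq std_normal_distribution (\<lambda>\<omega>. \<omega> j)"
    by (rule distr_cong) auto
  then show ?thesis using gauss_seq.PiM_component[of j] by simp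
qed

lemma indep_vars_gauss_seq: "gauss_seq.indep_vars (\<lambda>_. borel) (\<lambda>j \<omega>. \<omega> j) UNIV"
proof (subst gauss_seq.indep_vars_iff_distr_eq_PiM)
  have "distr gauss_seq (PiM UNIV (\<lambda>_. borel)) (\<lambda>\<omega>. \<lambda>i\<in>UNIV. \<omega> i) = distr gauss_seq gauss_seq (\<lambda>\<omega>. \<omega>)"
    by (rule distr_cong) (auto simp: sets_gauss_seq)
  also have "\<dots> = gauss_seq" by (rule distr_id)
  finally show "distr gauss_seq (PiM UNIV (\<lambda>_. borel)) (\<lambda>\<omega>. \<lambda>i\<in>UNIV. \<omega> i) = PiM UNIV (\<lambda>i. distr gauss_seq borel (\<lambda>\<omega>. \<omega> i))"
    by (simp add: distr_gauss_seq_component)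
qed auto

text \<open>The characteristic function of the linear form at 1 factorises by independence. It is
  real, so the phase contributes only cos a.\<close>

lemma integral_cos_gauss_seq:
  assumes "finite J"
  shows "(\<integral>\<omega>. cos ((\<Sum>j\<in>J. w j * \<omega> j) + a) \<partial>gauss_seq) = cos a * exp (- (\<Sum>j\<in>J. (w j)\<^sup>2) / 2)"
proof -
  let ?S = "\<lambda>\<omega>. \<Sum>j\<in>J. w j * \<omega> j"
  have "gauss_seq.indep_vars (\<lambda>_. borel) (\<lambda>j \<omega>. (\<lambda>y. w j * y) (\<omega> j)) UNIV"
    by (rule gauss_seq.indep_vars_compose2[OF indep_vars_gauss_seq]) simp
  then have ind: "gauss_seq.indep_vars (\<lambda>_. borel) (\<lambda>j \<omega>. w j * \<omega> j) J"
    by (rule gauss_seq.indep_vars_subset) auto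
  have comp: "char (distr gauss_seq borel (\<lambda>\<omega>. w j * \<omega> j)) 1 = exp (- (w j)\<^sup>2 / 2)" for j
  proof -
    have "char (distr gauss_seq borel (\<lambda>\<omega>. w j * \<omega> j)) 1 = (CLINT \<omega>|gauss_seq. iexp (w j * \<omega> j))"
      unfolding char_def by (subst integral_distr) auto
    also have "\<dots> = (CLINT y|distr gauss_seq borel (\<lambda>\<omega>. \<omega> j). iexp (w j * y))"
      by (subst integral_distr) auto
    also have "\<dots> = char std_normal_distribution (w j)"
      unfolding distr_gauss_seq_component char_def ..
    finally show ?thesis by (simp add: char_std_normal_distribution)
  qed
  have "(CLINT \<omega>|gauss_seq. iexp (?S \<omega>)) = char (distr gauss_seq borel ?S) 1"
    unfolding char_def by (subst integral_distr) auto
  also have "\<dots> = (\<Prod>j\<in>J. char (distr gauss_seq borel (\<lambda>\<omega>. w j * \<omega> j)) 1)"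
    using ind by (rule gauss_seq.char_distr_sum)
  also have "\<dots> = complex_of_real (exp (- (\<Sum>j\<in>J. (w j)\<^sup>2) / 2))"
    using assms by (simp add: comp exp_sum[symmetric] sum_negf sum_divide_distrib flip: of_real_prod exp_of_real)
  finally have E: "(CLINT \<omega>|gauss_seq. iexp (?S \<omega>)) = complex_of_real (exp (- (\<Sum>j\<in>J. (w j)\<^sup>2) / 2))" .
  have int: "integrable gauss_seq (\<lambda>\<omega>. iexp (?S \<omega>))"
    by (rule gauss_seq.integrable_const_bound[where B = 1]) auto
  have Re_cis: "cos (s + a) = Re (cis a * iexp s)" for s :: real
    by (simp add: cis_conv_exp[symmetric] cis_mult add.commute)
  have "(\<integral>\<omega>. cos (?S \<omega> + a) \<partial>gauss_seq) = (\<integral>\<omega>. Re (cis a * iexp (?S \<omega>)) \<partial>gauss_seq)"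
    by (intro Bochner_Integration.integral_cong refl Re_cis)
  also have "\<dots> = Re (CLINT \<omega>|gauss_seq. cis a * iexp (?S \<omega>))"
    using int by (intro integral_Re) auto
  also have "\<dots> = cos a * exp (- (\<Sum>j\<in>J. (w j)\<^sup>2) / 2)" unfolding integral_mult_right_zero E by simp
  finally show ?thesis .
qed

text \<open>D is the first absolute moment of the standard normal law; it enters the L1 bound on the
  increments of \<open>partial_process\<close>.\<close>

lemma nn_integral_abs_gauss_seq:
  obtains D where "0 \<le> D" "\<And>j. (\<integral>\<^sup>+\<omega>. ennreal \<bar>\<omega> j\<bar> \<partial>gauss_seq) = ennreal D"
proof -
  have i: "integrable lborel (\<lambda>x. std_normal_density x * \<bar>x\<bar>)"
    using integrable_std_normal_moment_abs[of 1] by simp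
  have "(\<integral>\<^sup>+\<omega>. ennreal \<bar>\<omega> j\<bar> \<partial>gauss_seq) = ennreal (\<integral>x. std_normal_density x * \<bar>x\<bar> \<partial>lborel)" for j
  proof -
    have "(\<integral>\<^sup>+\<omega>. ennreal \<bar>\<omega> j\<bar> \<partial>gauss_seq) = (\<integral>\<^sup>+y. ennreal \<bar>y\<bar> \<partial>distr gauss_seq borel (\<lambda>\<omega>. \<omega> j))"
      by (subst nn_integral_distr) auto
    also have "\<dots> = (\<integral>\<^sup>+x. ennreal (std_normal_density x * \<bar>x\<bar>) \<partial>lborel)"
      unfolding distr_gauss_seq_component by (subst nn_integral_density) (auto simp: ennreal_mult)
    also have "\<dots> = ennreal (\<integral>x. std_normal_density x * \<bar>x\<bar> \<partial>lborel)"
      using i by (intro nn_integral_eq_integral) auto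
    finally show ?thesis .
  qed
  then show thesis by (rule that[rotated]) (auto intro!: integral_nonneg_AE)
qed

text \<open>Peels off the top binary digit of the index, in step with the recursion of
  \<open>gcoef\<close>.\<close>

lemma sum_lessThan_power2_Suc:
  fixes f :: "nat \<Rightarrow> 'a::comm_monoid_add"
  shows "(\<Sum>j<2 ^ Suc K. f j) = (\<Sum>j<2 ^ K. f j) + (\<Sum>j<2 ^ K. f (j + 2 ^ K))"
proof -
  have "(\<Sum>j<2 ^ Suc K. f j) = (\<Sum>j<2 ^ K. f j) + (\<Sum>j=2 ^ K..<2 ^ K + 2 ^ K. f j)"
    using sum.atLeastLessThan_concat[of 0 "2 ^ K" "2 ^ K + 2 ^ K" f] by (simp add: atLeast0LessThan mult_2)
  also have "(\<Sum>j=2 ^ K..<2 ^ K + 2 ^ K. f j) = (\<Sum>j<2 ^ K. f (j + 2 ^ K))"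
    using sum.shift_bounds_nat_ivl[of f 0 "2 ^ K" "2 ^ K"] by (simp add: atLeast0LessThan)
  finally show ?thesis .
qed

section \<open>The covariance, and the process as a limit of finite Gaussian sums\<close>

context lacunary
begin

definition partial_cov :: "nat \<Rightarrow> int \<Rightarrow> real" where
  "partial_cov K m = (\<Prod>k<K. cos (2 * pi * of_int m * t k))"

text \<open>The Fourier coefficients of a Bernoulli convolution: the law of the sum of the +-t k
  with independent fair signs.\<close>

definition cov :: "int \<Rightarrow> real" where
  "cov m = lim (\<lambda>K. partial_cov K m)"

lemma abs_partial_cov_le: "\<bar>partial_cov K m\<bar> \<le> 1"
  unfolding partial_cov_def abs_prod by (intro prod_le_1) auto

lemma abs_cos_minus_one_le: "\<bar>cos x - 1\<bar> \<le> \<bar>x\<bar>" for x :: real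
proof -
  have "\<bar>cos x - cos 0\<bar> \<le> \<bar>x - 0\<bar>"
    using abs_sin_le_one[of "(x + 0) / 2"] abs_sin_x_le_abs_x[of "(0 - x) / 2"] mult_mono[of "\<bar>sin ((x + 0) / 2)\<bar>" 1 "\<bar>sin ((0 - x) / 2)\<bar>" "\<bar>x\<bar> / 2"]
    unfolding cos_diff_cos by (simp add: abs_mult)
  then show ?thesis by simp
qed

text \<open>The increments are at most 2 pi |m| t K, hence absolutely summable.\<close>

lemma cov_LIMSEQ: "(\<lambda>K. partial_cov K m) \<longlonglongrightarrow> cov m"
proof -
  have "summable (\<lambda>K. partial_cov (Suc K) m - partial_cov K m)"
  proof (rule summable_comparison_test'[of "\<lambda>K. 2 * pi * \<bar>of_int m\<bar> * t K" 0])
    show "summable (\<lambda>K. 2 * pi * \<bar>of_int m\<bar> * t K)" using summable_t by (rule summable_mult)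
    fix K
    have "partial_cov (Suc K) m - partial_cov K m = partial_cov K m * (cos (2 * pi * of_int m * t K) - 1)"
      by (simp add: partial_cov_def algebra_simps)
    then have "norm (partial_cov (Suc K) m - partial_cov K m) \<le> 1 * \<bar>2 * pi * of_int m * t K\<bar>"
      unfolding real_norm_def by (simp only: abs_mult) (intro mult_mono abs_partial_cov_le order_trans[OF abs_cos_minus_one_le], auto simp: abs_mult)
    then show "norm (partial_cov (Suc K) m - partial_cov K m) \<le> 2 * pi * \<bar>of_int m\<bar> * t K"
      using t_pos[of K] by (simp add: abs_mult)
  qed
  then have "convergent (\<lambda>K. \<Sum>i<K. partial_cov (Suc i) m - partial_cov i m)"
    by (simp add: summable_iff_convergent)
  then have "convergent (\<lambda>K. partial_cov K m - partial_cov 0 m)"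
    unfolding sum_lessThan_telescope[where f = "\<lambda>i. partial_cov i m"] .
  then have "convergent (\<lambda>K. partial_cov K m)" by (rule convergent_diff_const_right_iff[THEN iffD1])
  then show ?thesis unfolding cov_def by (rule convergent_LIMSEQ_iff[THEN iffD1])
qed

text \<open>
  Coordinates of the vector \<open>\<Otimes>\<^sub>k\<^sub><\<^sub>K (cos (2 \<pi> n t\<^sub>k), sin (2 \<pi> n t\<^sub>k))\<close> of \<open>(\<real>\<^sup>2)\<^sup>\<otimes>\<^sup>K\<close>; the binary digits of \<open>j\<close>
  select the factors. The inner products of these vectors are the partial products of the covariance.
\<close>

fun gcoef :: "nat \<Rightarrow> int \<Rightarrow> nat \<Rightarrow> real" where
  "gcoef 0 n j = (if j = 0 then 1 else 0)"
| "gcoef (Suc K) n j = (if j < 2 ^ K then cos (2 * pi * of_int n * t K) * gcoef K n j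
     else sin (2 * pi * of_int n * t K) * gcoef K n (j - 2 ^ K))"

lemma gcoef_inner: "(\<Sum>j<2 ^ K. gcoef K n j * gcoef K m j) = partial_cov K (n - m)"
proof (induction K)
  case (Suc K)
  let ?x = "2 * pi * of_int n * t K" and ?y = "2 * pi * of_int m * t K"
  have "(\<Sum>j<2 ^ Suc K. gcoef (Suc K) n j * gcoef (Suc K) m j)
    = (\<Sum>j<2 ^ K. cos ?x * cos ?y * (gcoef K n j * gcoef K m j)) + (\<Sum>j<2 ^ K. sin ?x * sin ?y * (gcoef K n j * gcoef K m j))"
    unfolding sum_lessThan_power2_Suc by (simp add: mult_ac)
  also have "\<dots> = (cos ?x * cos ?y + sin ?x * sin ?y) * partial_cov K (n - m)"
    unfolding sum_distrib_left[symmetric] Suc.IH by (simp add: distrib_right)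
  also have "cos ?x * cos ?y + sin ?x * sin ?y = cos (2 * pi * of_int (n - m) * t K)"
    unfolding cos_diff[symmetric] by (simp add: algebra_simps)
  finally show ?case by (simp add: partial_cov_def mult.commute)
qed (simp add: partial_cov_def)

text \<open>The l1 norm is multiplicative over the tensor factors, and |cos x| + |sin x| <= 1 + |x|
  <= exp |x|. Summability of t then bounds it uniformly in K.\<close>

lemma gcoef_l1: "(\<Sum>j<2 ^ K. \<bar>gcoef K n j\<bar>) \<le> exp (2 * pi * \<bar>of_int n\<bar> * (\<Sum>k<K. t k))"
proof (induction K)
  case (Suc K)
  let ?x = "2 * pi * of_int n * t K"
  have "(\<Sum>j<2 ^ Suc K. \<bar>gcoef (Suc K) n j\<bar>) = (\<bar>cos ?x\<bar> + \<bar>sin ?x\<bar>) * (\<Sum>j<2 ^ K. \<bar>gcoef K n j\<bar>)"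
    unfolding sum_lessThan_power2_Suc by (simp add: abs_mult distrib_right sum_distrib_left[symmetric])
  also have "\<dots> \<le> exp (2 * pi * \<bar>of_int n\<bar> * t K) * exp (2 * pi * \<bar>of_int n\<bar> * (\<Sum>k<K. t k))"
  proof (intro mult_mono Suc.IH)
    have "\<bar>cos ?x\<bar> + \<bar>sin ?x\<bar> \<le> 1 + \<bar>?x\<bar>" by (intro add_mono abs_cos_le_one abs_sin_x_le_abs_x)
    also have "\<bar>?x\<bar> = 2 * pi * \<bar>of_int n\<bar> * t K" using t_pos[of K] by (simp add: abs_mult)
    finally show "\<bar>cos ?x\<bar> + \<bar>sin ?x\<bar> \<le> exp (2 * pi * \<bar>of_int n\<bar> * t K)"
      by (rule order_trans[OF _ exp_ge_add_one_self])
  qed (auto intro: sum_nonneg)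
  also have "\<dots> = exp (2 * pi * \<bar>of_int n\<bar> * (\<Sum>k<Suc K. t k))"
    by (simp add: exp_add[symmetric] algebra_simps)
  finally show ?case .
qed simp

lemma gcoef_l1_bdd: "(\<Sum>j<2 ^ K. \<bar>gcoef K n j\<bar>) \<le> exp (2 * pi * \<bar>of_int n\<bar> * suminf t)"
proof (rule order_trans[OF gcoef_l1])
  have "(\<Sum>k<K. t k) \<le> suminf t" by (rule sum_le_suminf[OF summable_t]) (auto simp: t_pos less_imp_le)
  then show "exp (2 * pi * \<bar>of_int n\<bar> * (\<Sum>k<K. t k)) \<le> exp (2 * pi * \<bar>of_int n\<bar> * suminf t)"
    by (simp add: mult_left_mono)
qed

definition partial_process :: "nat \<Rightarrow> int \<Rightarrow> (nat \<Rightarrow> real) \<Rightarrow> real" where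
  "partial_process K n \<omega> = (\<Sum>j<2 ^ K. gcoef K n j * \<omega> j)"

text \<open>Where the partial sums diverge, \<open>lim\<close> is a default value; for each n this
  happens on a null set only, so the law is unaffected.\<close>

definition process :: "(nat \<Rightarrow> real) \<Rightarrow> int \<Rightarrow> real" where
  "process \<omega> n = lim (\<lambda>K. partial_process K n \<omega>)"

lemma measurable_partial_process [measurable]: "partial_process K n \<in> borel_measurable gauss_seq"
  unfolding partial_process_def by measurable

text \<open>Passing from K to K + 1 multiplies the old sum by cos and adds a fresh copy of it
  multiplied by sin. As |cos - 1| and |sin| are at most 2 pi |n| t K, the increments have summable
  L1 norms, so their series converges absolutely almost everywhere.\<close>

lemma AE_partial_process_convergent: "AE \<omega> in gauss_seq. (\<lambda>K. partial_process K n \<omega>) \<longlonglongrightarrow> process \<omega> n"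
proof -
  obtain D where D: "0 \<le> D" "\<And>j. (\<integral>\<^sup>+\<omega>. ennreal \<bar>\<omega> j\<bar> \<partial>gauss_seq) = ennreal D" using nn_integral_abs_gauss_seq by blast
  define C where "C = exp (2 * pi * \<bar>of_int n\<bar> * suminf t)"
  have l1: "(\<integral>\<^sup>+\<omega>. ennreal (\<Sum>j<2 ^ K. \<bar>gcoef K n j\<bar> * \<bar>\<omega> (j + i)\<bar>) \<partial>gauss_seq) \<le> ennreal (C * D)" for K i
  proof -
    have "(\<integral>\<^sup>+\<omega>. ennreal (\<Sum>j<2 ^ K. \<bar>gcoef K n j\<bar> * \<bar>\<omega> (j + i)\<bar>) \<partial>gauss_seq)
      = (\<Sum>j<2 ^ K. \<integral>\<^sup>+\<omega>. ennreal \<bar>gcoef K n j\<bar> * ennreal \<bar>\<omega> (j + i)\<bar> \<partial>gauss_seq)"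
      by (subst nn_integral_sum[symmetric]) (auto simp: sum_ennreal[symmetric] ennreal_mult)
    also have "\<dots> = (\<Sum>j<2 ^ K. ennreal (\<bar>gcoef K n j\<bar> * D))"
      by (subst nn_integral_cmult) (auto simp: D ennreal_mult)
    also have "\<dots> = ennreal ((\<Sum>j<2 ^ K. \<bar>gcoef K n j\<bar>) * D)"
      using D(1) by (simp add: sum_ennreal sum_distrib_right)
    also have "\<dots> \<le> ennreal (C * D)"
      unfolding C_def by (intro ennreal_leI mult_right_mono gcoef_l1_bdd D)
    finally show ?thesis .
  qed
  define d where "d K \<omega> = partial_process (Suc K) n \<omega> - partial_process K n \<omega>" for K \<omega>
  define B where "B = 4 * pi * \<bar>of_int n\<bar> * (C * D)"
  have [measurable]: "d K \<in> borel_measurable gauss_seq" for K unfolding d_def by measurable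
  have inc: "(\<integral>\<^sup>+\<omega>. ennreal \<bar>d K \<omega>\<bar> \<partial>gauss_seq) \<le> ennreal (B * t K)" for K
  proof -
    let ?x = "2 * pi * of_int n * t K"
    let ?S = "\<lambda>i \<omega>. \<Sum>j<2 ^ K. \<bar>gcoef K n j\<bar> * \<bar>\<omega> (j + i)\<bar>"
    have "\<bar>d K \<omega>\<bar> \<le> \<bar>?x\<bar> * (?S 0 \<omega> + ?S (2 ^ K) \<omega>)" for \<omega>
    proof -
      have le: "\<bar>c * (g * y)\<bar> \<le> \<bar>x\<bar> * (\<bar>g\<bar> * \<bar>y\<bar>)" if "\<bar>c\<bar> \<le> \<bar>x\<bar>" for c g x y :: real
        using that by (simp add: abs_mult mult_right_mono)
      have "partial_process (Suc K) n \<omega> = cos ?x * (\<Sum>j<2 ^ K. gcoef K n j * \<omega> j) + sin ?x * (\<Sum>j<2 ^ K. gcoef K n j * \<omega> (j + 2 ^ K))"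
        unfolding partial_process_def sum_lessThan_power2_Suc sum_distrib_left by (simp add: mult.assoc)
      then have dK: "d K \<omega> = (\<Sum>j<2 ^ K. (cos ?x - 1) * (gcoef K n j * \<omega> j)) + (\<Sum>j<2 ^ K. sin ?x * (gcoef K n j * \<omega> (j + 2 ^ K)))"
        unfolding d_def partial_process_def[of K] sum_distrib_left[symmetric] by (simp add: left_diff_distrib)
      have "\<bar>d K \<omega>\<bar> \<le> (\<Sum>j<2 ^ K. \<bar>?x\<bar> * (\<bar>gcoef K n j\<bar> * \<bar>\<omega> j\<bar>)) + (\<Sum>j<2 ^ K. \<bar>?x\<bar> * (\<bar>gcoef K n j\<bar> * \<bar>\<omega> (j + 2 ^ K)\<bar>))"
        unfolding dK by (intro order_trans[OF abs_triangle_ineq] add_mono order_trans[OF sum_abs] sum_mono le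
            abs_cos_minus_one_le abs_sin_x_le_abs_x)
      also have "\<dots> = \<bar>?x\<bar> * (?S 0 \<omega> + ?S (2 ^ K) \<omega>)"
        by (simp only: sum_distrib_left distrib_left add_0_right)
      finally show ?thesis .
    qed
    then have "(\<integral>\<^sup>+\<omega>. ennreal \<bar>d K \<omega>\<bar> \<partial>gauss_seq) \<le> (\<integral>\<^sup>+\<omega>. ennreal \<bar>?x\<bar> * (ennreal (?S 0 \<omega>) + ennreal (?S (2 ^ K) \<omega>)) \<partial>gauss_seq)"
    proof (intro nn_integral_mono)
      fix \<omega> :: "nat \<Rightarrow> real"
      have S: "0 \<le> ?S i \<omega>" for i by (intro sum_nonneg) simp
      have "ennreal \<bar>?x\<bar> * (ennreal (?S 0 \<omega>) + ennreal (?S (2 ^ K) \<omega>)) = ennreal (\<bar>?x\<bar> * (?S 0 \<omega> + ?S (2 ^ K) \<omega>))"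
        by (simp only: ennreal_mult[OF abs_ge_zero add_nonneg_nonneg[OF S S]] ennreal_plus[OF S S])
      then show "ennreal \<bar>d K \<omega>\<bar> \<le> ennreal \<bar>?x\<bar> * (ennreal (?S 0 \<omega>) + ennreal (?S (2 ^ K) \<omega>))"
        using \<open>\<And>\<omega>. \<bar>d K \<omega>\<bar> \<le> \<bar>?x\<bar> * (?S 0 \<omega> + ?S (2 ^ K) \<omega>)\<close> by (simp only: ennreal_leI)
    qed
    also have "\<dots> = ennreal \<bar>?x\<bar> * ((\<integral>\<^sup>+\<omega>. ennreal (?S 0 \<omega>) \<partial>gauss_seq) + (\<integral>\<^sup>+\<omega>. ennreal (?S (2 ^ K) \<omega>) \<partial>gauss_seq))"
      by (subst nn_integral_cmult, measurable) (subst nn_integral_add, auto)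
    also have "\<dots> \<le> ennreal \<bar>?x\<bar> * (ennreal (C * D) + ennreal (C * D))"
      by (intro mult_left_mono add_mono l1) auto
    also have "\<dots> = ennreal (B * t K)"
    proof -
      have CD: "0 \<le> C * D" using D(1) by (simp add: C_def)
      have "ennreal \<bar>?x\<bar> * (ennreal (C * D) + ennreal (C * D)) = ennreal (\<bar>?x\<bar> * (C * D + C * D))"
        by (simp only: ennreal_mult[OF abs_ge_zero add_nonneg_nonneg[OF CD CD]] ennreal_plus[OF CD CD])
      also have "\<bar>?x\<bar> * (C * D + C * D) = B * t K" using t_pos[of K] by (simp add: abs_mult B_def)
      finally show ?thesis .
    qed
    finally show ?thesis .
  qed
  have "0 \<le> B" using D(1) by (simp add: B_def C_def)
  have "(\<integral>\<^sup>+\<omega>. (\<Sum>K. ennreal \<bar>d K \<omega>\<bar>) \<partial>gauss_seq) = (\<Sum>K. \<integral>\<^sup>+\<omega>. ennreal \<bar>d K \<omega>\<bar> \<partial>gauss_seq)"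
    by (rule nn_integral_suminf) auto
  also have "\<dots> \<le> (\<Sum>K. ennreal (B * t K))" by (intro suminf_le inc) auto
  also have "\<dots> = ennreal (\<Sum>K. B * t K)"
    using \<open>0 \<le> B\<close> by (intro suminf_ennreal2 summable_mult summable_t) (auto simp: t_pos less_imp_le)
  finally have "(\<integral>\<^sup>+\<omega>. (\<Sum>K. ennreal \<bar>d K \<omega>\<bar>) \<partial>gauss_seq) \<noteq> \<infinity>"
    by (auto simp: top_unique)
  then have "AE \<omega> in gauss_seq. (\<Sum>K. ennreal \<bar>d K \<omega>\<bar>) \<noteq> \<infinity>"
    by (intro nn_integral_PInf_AE) auto
  then show ?thesis
  proof eventually_elim
    case (elim \<omega>)
    then have "summable (\<lambda>K. \<bar>d K \<omega>\<bar>)" by (intro summable_suminf_not_top) auto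
    then have "summable (\<lambda>K. d K \<omega>)" by (rule summable_rabs_cancel)
    then have "convergent (\<lambda>K. \<Sum>i<K. d i \<omega>)" by (simp add: summable_iff_convergent)
    then have "convergent (\<lambda>K. partial_process K n \<omega> - partial_process 0 n \<omega>)" 
      unfolding d_def sum_lessThan_telescope[where f = "\<lambda>K. partial_process K n \<omega>"] .
    then have "convergent (\<lambda>K. partial_process K n \<omega>)" by (rule convergent_diff_const_right_iff[THEN iffD1])
    then show ?case unfolding process_def by (rule convergent_LIMSEQ_iff[THEN iffD1])
  qed
qed

lemma measurable_process_component [measurable]: "(\<lambda>\<omega>. process \<omega> n) \<in> borel_measurable gauss_seq"
  unfolding process_def by measurable

lemma measurable_process [measurable]: "process \<in> gauss_seq \<rightarrow>\<^sub>M PiM UNIV (\<lambda>_. borel)"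
proof (rule measurable_PiM_single')
  show "(\<lambda>\<omega>. process \<omega> n) \<in> borel_measurable gauss_seq" for n by measurable
qed auto

definition gauss_law :: "(int \<Rightarrow> real) measure" where
  "gauss_law = distr gauss_seq (PiM UNIV (\<lambda>_. borel)) process"

lemma sets_gauss_law [simp, measurable_cong]: "sets gauss_law = sets (PiM UNIV (\<lambda>_. borel))"
  by (simp add: gauss_law_def)

lemma space_gauss_law [simp]: "space gauss_law = UNIV"
  by (simp add: gauss_law_def space_PiM)

lemma prob_space_gauss_law: "prob_space gauss_law"
  unfolding gauss_law_def by (rule gauss_seq.prob_space_distr) measurable

text \<open>The coordinates are addressed through \<iota>, which may repeat: this admits sums of two
  forms with overlapping coordinates. For finite K the variance is computed by
  \<open>gcoef_inner\<close>; then K tends to infinity on both sides.\<close>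

theorem integral_cos_gauss_law:
  assumes "finite I"
  shows "(\<integral>x. cos ((\<Sum>i\<in>I. c i * x (\<iota> i)) + a) \<partial>gauss_law)
    = cos a * exp (- (\<Sum>i\<in>I. \<Sum>k\<in>I. c i * c k * cov (\<iota> i - \<iota> k)) / 2)"
proof -
  have "(\<integral>x. cos ((\<Sum>i\<in>I. c i * x (\<iota> i)) + a) \<partial>gauss_law) = (\<integral>\<omega>. cos ((\<Sum>i\<in>I. c i * process \<omega> (\<iota> i)) + a) \<partial>gauss_seq)"
    unfolding gauss_law_def by (subst integral_distr) auto
  moreover have lim1: "(\<lambda>K. \<integral>\<omega>. cos ((\<Sum>i\<in>I. c i * partial_process K (\<iota> i) \<omega>) + a) \<partial>gauss_seq)
      \<longlonglongrightarrow> (\<integral>\<omega>. cos ((\<Sum>i\<in>I. c i * process \<omega> (\<iota> i)) + a) \<partial>gauss_seq)"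
  proof (rule integral_dominated_convergence[where w = "\<lambda>_. 1"])
    have "AE \<omega> in gauss_seq. \<forall>i\<in>I. (\<lambda>K. partial_process K (\<iota> i) \<omega>) \<longlonglongrightarrow> process \<omega> (\<iota> i)"
      using assms AE_partial_process_convergent by (simp add: AE_finite_all)
    then show "AE \<omega> in gauss_seq. (\<lambda>K. cos ((\<Sum>i\<in>I. c i * partial_process K (\<iota> i) \<omega>) + a))
        \<longlonglongrightarrow> cos ((\<Sum>i\<in>I. c i * process \<omega> (\<iota> i)) + a)"
      by eventually_elim (auto intro!: tendsto_intros)
  qed auto
  moreover have eq: "(\<integral>\<omega>. cos ((\<Sum>i\<in>I. c i * partial_process K (\<iota> i) \<omega>) + a) \<partial>gauss_seq)
      = cos a * exp (- (\<Sum>i\<in>I. \<Sum>k\<in>I. c i * c k * partial_cov K (\<iota> i - \<iota> k)) / 2)" for K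
  proof -
    define w where "w j = (\<Sum>i\<in>I. c i * gcoef K (\<iota> i) j)" for j
    have "(\<Sum>i\<in>I. c i * partial_process K (\<iota> i) \<omega>) = (\<Sum>j<2 ^ K. w j * \<omega> j)" for \<omega>
      unfolding partial_process_def w_def sum_distrib_left sum_distrib_right by (subst sum.swap) (simp add: mult.assoc)
    moreover have "(\<Sum>j<2 ^ K. (w j)\<^sup>2) = (\<Sum>i\<in>I. \<Sum>k\<in>I. c i * c k * partial_cov K (\<iota> i - \<iota> k))"
    proof -
      have "(\<Sum>j<2 ^ K. (w j)\<^sup>2) = (\<Sum>j<2 ^ K. \<Sum>i\<in>I. \<Sum>k\<in>I. c i * c k * (gcoef K (\<iota> i) j * gcoef K (\<iota> k) j))"
        by (simp add: w_def power2_eq_square sum_product mult_ac)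
      also have "\<dots> = (\<Sum>i\<in>I. \<Sum>k\<in>I. \<Sum>j<2 ^ K. c i * c k * (gcoef K (\<iota> i) j * gcoef K (\<iota> k) j))"
        by (subst sum.swap, intro sum.cong refl, subst sum.swap) simp
      finally show ?thesis by (simp add: sum_distrib_left[symmetric] gcoef_inner)
    qed
    ultimately show ?thesis by (simp add: integral_cos_gauss_seq)
  qed
  moreover have lim2: "(\<lambda>K. cos a * exp (- (\<Sum>i\<in>I. \<Sum>k\<in>I. c i * c k * partial_cov K (\<iota> i - \<iota> k)) / 2))
      \<longlonglongrightarrow> cos a * exp (- (\<Sum>i\<in>I. \<Sum>k\<in>I. c i * c k * cov (\<iota> i - \<iota> k)) / 2)"
    by (intro tendsto_intros cov_LIMSEQ) simp
  ultimately show ?thesis using LIMSEQ_unique[OF lim1[unfolded eq] lim2] by simp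
qed

end

section \<open>Weak mixing and rigidity of the Gaussian shift\<close>

definition cesaro_null :: "(nat \<Rightarrow> real) \<Rightarrow> bool" where
  "cesaro_null a \<longleftrightarrow> (\<lambda>N. (\<Sum>n<N. \<bar>a n\<bar>) / real N) \<longlonglongrightarrow> 0"

text \<open>Common source of the closure properties: the dominating sequence may depend on the error
  \<epsilon>.\<close>

lemma cesaro_null_approx:
  assumes "\<And>\<epsilon>. 0 < \<epsilon> \<Longrightarrow> \<exists>b. (\<lambda>N. (\<Sum>n<N. b n) / real N) \<longlonglongrightarrow> 0 \<and> (\<forall>n. \<bar>a n\<bar> \<le> b n + \<epsilon>)"
  shows "cesaro_null a"
  unfolding cesaro_null_def
proof (rule LIMSEQ_I)
  fix \<epsilon> :: real assume "0 < \<epsilon>"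
  then obtain b where b: "(\<lambda>N. (\<Sum>n<N. b n) / real N) \<longlonglongrightarrow> 0" "\<And>n. \<bar>a n\<bar> \<le> b n + \<epsilon> / 2"
    using assms[of "\<epsilon> / 2"] by auto
  obtain N0 where N0: "\<And>N. N0 \<le> N \<Longrightarrow> \<bar>(\<Sum>n<N. b n) / real N\<bar> < \<epsilon> / 2"
    using LIMSEQ_D[OF b(1), of "\<epsilon> / 2"] \<open>0 < \<epsilon>\<close> by auto
  show "\<exists>N0. \<forall>N\<ge>N0. norm ((\<Sum>n<N. \<bar>a n\<bar>) / real N - 0) < \<epsilon>"
  proof (intro exI allI impI)
    fix N assume N: "max N0 1 \<le> N"
    have "(\<Sum>n<N. \<bar>a n\<bar>) \<le> (\<Sum>n<N. b n + \<epsilon> / 2)" by (intro sum_mono b)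
    also have "\<dots> = (\<Sum>n<N. b n) + real N * (\<epsilon> / 2)" by (simp add: sum.distrib)
    finally have "(\<Sum>n<N. \<bar>a n\<bar>) / real N \<le> ((\<Sum>n<N. b n) + real N * (\<epsilon> / 2)) / real N"
      by (rule divide_right_mono) simp
    also have "\<dots> = (\<Sum>n<N. b n) / real N + \<epsilon> / 2" using N by (simp add: add_divide_distrib)
    also have "\<dots> < \<epsilon>"
      using N0[of N] N abs_ge_self[of "(\<Sum>n<N. b n) / real N"] by linarith
    finally show "norm ((\<Sum>n<N. \<bar>a n\<bar>) / real N - 0) < \<epsilon>" by (simp add: sum_nonneg)
  qed
qed

lemma cesaro_null_dominated:
  assumes "cesaro_null b" "\<And>n. \<bar>a n\<bar> \<le> C * \<bar>b n\<bar>"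
  shows "cesaro_null a"
proof (rule cesaro_null_approx, intro exI conjI allI)
  have "(\<lambda>N. C * ((\<Sum>n<N. \<bar>b n\<bar>) / real N)) \<longlonglongrightarrow> C * 0"
    using assms(1) unfolding cesaro_null_def by (intro tendsto_intros)
  then show "(\<lambda>N. (\<Sum>n<N. C * \<bar>b n\<bar>) / real N) \<longlonglongrightarrow> 0" by (simp add: sum_distrib_left)
  show "\<bar>a n\<bar> \<le> C * \<bar>b n\<bar> + \<epsilon>" if "0 < \<epsilon>" for n \<epsilon> using assms(2)[of n] that by simp
qed

lemma cesaro_null_add:
  assumes "cesaro_null a" "cesaro_null b"
  shows "cesaro_null (\<lambda>n. a n + b n)"
proof (rule cesaro_null_approx, intro exI conjI allI)
  have "(\<lambda>N. (\<Sum>n<N. \<bar>a n\<bar>) / real N + (\<Sum>n<N. \<bar>b n\<bar>) / real N) \<longlonglongrightarrow> 0 + 0"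
    using assms unfolding cesaro_null_def by (intro tendsto_intros)
  then show "(\<lambda>N. (\<Sum>n<N. \<bar>a n\<bar> + \<bar>b n\<bar>) / real N) \<longlonglongrightarrow> 0" by (simp add: sum.distrib add_divide_distrib)
  show "\<bar>a n + b n\<bar> \<le> \<bar>a n\<bar> + \<bar>b n\<bar> + \<epsilon>" if "0 < \<epsilon>" for n \<epsilon> using that by simp
qed

lemma cesaro_null_mult: "cesaro_null a \<Longrightarrow> cesaro_null (\<lambda>n. c * a n)"
  by (rule cesaro_null_dominated[where b = a and C = "\<bar>c\<bar>"]) (auto simp: abs_mult)

lemma cesaro_null_zero: "cesaro_null (\<lambda>n. 0)"
  by (simp add: cesaro_null_def)

lemma cesaro_null_sum:
  assumes "\<And>i. i \<in> I \<Longrightarrow> cesaro_null (a i)"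
  shows "cesaro_null (\<lambda>n. \<Sum>i\<in>I. a i n)"
  using assms
proof (induction I rule: infinite_finite_induct)
  case (insert i I)
  then show ?case using cesaro_null_add[of "a i" "\<lambda>n. \<Sum>i\<in>I. a i n"] by simp
qed (simp_all add: cesaro_null_zero)

lemma cesaro_null_uniform_limit:
  assumes "\<And>k. cesaro_null (a k)" "\<And>k n. \<bar>c n - a k n\<bar> \<le> e k" "e \<longlonglongrightarrow> 0"
  shows "cesaro_null c"
proof (rule cesaro_null_approx)
  fix \<epsilon> :: real assume "0 < \<epsilon>"
  then have "\<forall>\<^sub>F k in sequentially. e k < \<epsilon>" using assms(3) by (intro order_tendstoD) auto
  then obtain k where k: "e k < \<epsilon>" by (auto simp: eventually_sequentially)
  have "\<bar>c n\<bar> \<le> \<bar>a k n\<bar> + \<epsilon>" for n using assms(2)[of n k] k by linarith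
  then show "\<exists>b. (\<lambda>N. (\<Sum>n<N. b n) / real N) \<longlonglongrightarrow> 0 \<and> (\<forall>n. \<bar>c n\<bar> \<le> b n + \<epsilon>)"
    using assms(1)[of k] unfolding cesaro_null_def by (intro exI[of _ "\<lambda>n. \<bar>a k n\<bar>"]) auto
qed

lemma abs_cos_add_diff_le: "\<bar>cos (x + 2 * pi * u) - cos x\<bar> \<le> 2 * pi * idist u"
proof -
  define e where "e = u - of_int (round u)"
  have e: "idist u = \<bar>e\<bar>" by (simp add: e_def idist_eq_round)
  have "cos (x + 2 * pi * u) = cos ((x + 2 * pi * e) + 2 * pi * of_int (round u))"
    by (simp add: e_def algebra_simps)
  also have "\<dots> = cos (x + 2 * pi * e)"
    using cos_int_2pin[of "round u"] sin_int_2pin[of "round u"] by (simp add: cos_add[of "x + 2 * pi * e"])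
  finally have eq: "cos (x + 2 * pi * u) = cos (x + 2 * pi * e)" .
  have "\<bar>cos (x + 2 * pi * e) - cos x\<bar> = 2 * \<bar>sin ((x + 2 * pi * e + x) / 2)\<bar> * \<bar>sin ((x - (x + 2 * pi * e)) / 2)\<bar>"
    unfolding cos_diff_cos by (simp add: abs_mult)
  also have "\<dots> \<le> 2 * 1 * \<bar>(x - (x + 2 * pi * e)) / 2\<bar>"
    by (intro mult_mono abs_sin_x_le_abs_x) auto
  also have "\<dots> = 2 * pi * \<bar>e\<bar>" by (simp add: abs_mult)
  finally show ?thesis unfolding eq e .
qed

section \<open>Continuity and decay of the covariance\<close>

context lacunary
begin

lemma cov_minus [simp]: "cov (- m) = cov m"
proof -
  have "partial_cov K (- m) = partial_cov K m" for K
    unfolding partial_cov_def by (intro prod.cong refl) (metis cos_minus mult_minus_left mult_minus_right of_int_minus)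
  then show ?thesis by (simp add: cov_def)
qed

lemma cov_zero [simp]: "cov 0 = 1"
  by (simp add: cov_def partial_cov_def)

lemma abs_cov_le: "\<bar>cov m\<bar> \<le> 1"
  by (rule LIMSEQ_le_const2[OF tendsto_rabs[OF cov_LIMSEQ]]) (auto intro: abs_partial_cov_le)

text \<open>Every further factor is a cosine. Finite products thus control the covariance in
  \<open>cesaro_null_cov\<close>.\<close>

lemma abs_cov_le_partial: "\<bar>cov m\<bar> \<le> \<bar>partial_cov K m\<bar>"
proof (rule LIMSEQ_le_const2[OF tendsto_rabs[OF cov_LIMSEQ]], intro exI allI impI)
  fix K' assume "K \<le> K'"
  then show "\<bar>partial_cov K' m\<bar> \<le> \<bar>partial_cov K m\<bar>"
  proof (induction K' rule: dec_induct)
    case (step K')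
    have "\<bar>partial_cov (Suc K') m\<bar> = \<bar>partial_cov K' m\<bar> * \<bar>cos (2 * pi * of_int m * t K')\<bar>"
      by (simp add: partial_cov_def abs_mult)
    also have "\<dots> \<le> \<bar>partial_cov K' m\<bar> * 1" by (intro mult_left_mono) auto
    finally show ?case using step.IH by simp
  qed simp
qed

text \<open>Products of numbers of modulus at most 1 differ by at most the sum of the differences of
  their factors. This is how distances to integers enter rigidity.\<close>

lemma abs_cov_diff_le:
  assumes "\<And>K. (\<Sum>k<K. idist (of_int n * t k)) \<le> S"
  shows "\<bar>cov (m + n) - cov m\<bar> \<le> 2 * pi * S"
proof (rule LIMSEQ_le_const2[OF tendsto_rabs[OF tendsto_diff[OF cov_LIMSEQ cov_LIMSEQ]]], intro exI allI impI)
  fix K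
  have "\<bar>partial_cov K (m + n) - partial_cov K m\<bar>
    \<le> (\<Sum>k<K. \<bar>cos (2 * pi * of_int (m + n) * t k) - cos (2 * pi * of_int m * t k)\<bar>)"
    unfolding partial_cov_def real_norm_def[symmetric] by (rule norm_prod_diff) auto
  also have "\<dots> \<le> (\<Sum>k<K. 2 * pi * idist (of_int n * t k))"
  proof (rule sum_mono)
    fix k
    have "2 * pi * of_int (m + n) * t k = 2 * pi * of_int m * t k + 2 * pi * (of_int n * t k)" by (simp add: algebra_simps)
    then show "\<bar>cos (2 * pi * of_int (m + n) * t k) - cos (2 * pi * of_int m * t k)\<bar> \<le> 2 * pi * idist (of_int n * t k)"
      using abs_cos_add_diff_le by simp
  qed
  also have "\<dots> \<le> 2 * pi * S" unfolding sum_distrib_left[symmetric] using assms by (intro mult_left_mono) auto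
  finally show "\<bar>partial_cov K (m + n) - partial_cov K m\<bar> \<le> 2 * pi * S" .
qed

text \<open>
  Expanding \<open>cos\<^sup>2\<close> gives frequencies \<open>\<gamma> + \<Sum>\<^sub>k 2 \<epsilon>\<^sub>k t\<^sub>k\<close> with \<open>\<epsilon>\<^sub>k \<in> {-1, 0, 1}\<close>; the two bounds on \<open>\<gamma>\<close>
  keep them away from the integers.
\<close>

lemma average_cos_prod_tendsto_0:
  assumes "j \<le> K" "2 * (\<Sum>k=j..<K. t k) < \<bar>\<gamma>\<bar>" "\<bar>\<gamma>\<bar> < 1 - 2 * (\<Sum>k=j..<K. t k)"
  shows "(\<lambda>N. (\<Sum>n<N. (\<Prod>k=j..<K. (cos (2 * pi * t k * (real n + \<phi>)))\<^sup>2) * cos (2 * pi * \<gamma> * real n + \<beta>)) / real N) \<longlonglongrightarrow> 0"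
  using assms
proof (induction j arbitrary: \<gamma> \<beta> rule: inc_induct)
  case base
  have "sin ((2 * pi * \<gamma>) / 2) \<noteq> 0"
  proof
    assume "sin ((2 * pi * \<gamma>) / 2) = 0"
    then have "\<gamma> \<in> \<int>" using sin_times_pi_eq_0[of \<gamma>] by (simp add: mult.commute)
    then obtain i where "\<gamma> = of_int i" by (auto elim: Ints_cases)
    with base show False by (auto simp flip: of_int_abs)
  qed
  from average_cos_tendsto_0[OF this, of \<beta>] show ?case by (simp add: mult.commute)
next
  case (step j)
  let ?P = "\<lambda>n. \<Prod>k=Suc j..<K. (cos (2 * pi * t k * (real n + \<phi>)))\<^sup>2"
  let ?A = "\<lambda>\<gamma> \<beta> N. (\<Sum>n<N. ?P n * cos (2 * pi * \<gamma> * real n + \<beta>)) / real N"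
  have s: "(\<Sum>k=j..<K. t k) = t j + (\<Sum>k=Suc j..<K. t k)" using step.hyps by (simp add: sum.atLeast_Suc_lessThan)
  \<comment> \<open>Dropping t j from the sum relaxes both bounds by 2 t j, exactly the amount by
    which the frequency moves.\<close>
  have lim: "?A \<gamma>' \<beta>' \<longlonglongrightarrow> 0" if "\<bar>\<gamma>' - \<gamma>\<bar> \<le> 2 * t j" for \<gamma>' \<beta>'
  proof (rule step.IH)
    have "\<bar>\<gamma>'\<bar> \<le> \<bar>\<gamma>\<bar> + 2 * t j" "\<bar>\<gamma>\<bar> - 2 * t j \<le> \<bar>\<gamma>'\<bar>" using that by linarith+
    then show "2 * (\<Sum>k=Suc j..<K. t k) < \<bar>\<gamma>'\<bar>" "\<bar>\<gamma>'\<bar> < 1 - 2 * (\<Sum>k=Suc j..<K. t k)"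
      using step.prems unfolding s distrib_left by linarith+
  qed
  have "(\<lambda>N. 1/2 * ?A \<gamma> \<beta> N + 1/4 * ?A (\<gamma> + 2 * t j) (\<beta> + 4 * pi * t j * \<phi>) N
      + 1/4 * ?A (\<gamma> - 2 * t j) (\<beta> - 4 * pi * t j * \<phi>) N) \<longlonglongrightarrow> 1/2 * 0 + 1/4 * 0 + 1/4 * 0"
    using t_pos[of j] by (intro tendsto_add tendsto_mult_left lim) auto
  moreover have "1/2 * ?A \<gamma> \<beta> N + 1/4 * ?A (\<gamma> + 2 * t j) (\<beta> + 4 * pi * t j * \<phi>) N + 1/4 * ?A (\<gamma> - 2 * t j) (\<beta> - 4 * pi * t j * \<phi>) N
     = (\<Sum>n<N. (\<Prod>k=j..<K. (cos (2 * pi * t k * (real n + \<phi>)))\<^sup>2) * cos (2 * pi * \<gamma> * real n + \<beta>)) / real N" for N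
  proof -
    have "(\<Prod>k=j..<K. (cos (2 * pi * t k * (real n + \<phi>)))\<^sup>2) * cos (2 * pi * \<gamma> * real n + \<beta>)
      = 1/2 * (?P n * cos (2 * pi * \<gamma> * real n + \<beta>))
        + 1/4 * (?P n * cos (2 * pi * (\<gamma> + 2 * t j) * real n + (\<beta> + 4 * pi * t j * \<phi>)))
        + 1/4 * (?P n * cos (2 * pi * (\<gamma> - 2 * t j) * real n + (\<beta> - 4 * pi * t j * \<phi>)))" for n
    proof -
      define x where "x = 2 * pi * t j * (real n + \<phi>)"
      define y where "y = 2 * pi * \<gamma> * real n + \<beta>"
      have e: "2 * pi * (\<gamma> + 2 * t j) * real n + (\<beta> + 4 * pi * t j * \<phi>) = y + 2 * x"
        "2 * pi * (\<gamma> - 2 * t j) * real n + (\<beta> - 4 * pi * t j * \<phi>) = y - 2 * x"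
        by (simp_all add: x_def y_def algebra_simps)
      have c: "(cos x)\<^sup>2 * cos y = 1/2 * cos y + 1/4 * cos (y + 2 * x) + 1/4 * cos (y - 2 * x)"
        unfolding cos_add cos_diff cos_double_cos by (simp add: algebra_simps)
      have p: "(\<Prod>k=j..<K. (cos (2 * pi * t k * (real n + \<phi>)))\<^sup>2) = (cos x)\<^sup>2 * ?P n"
        using step.hyps by (simp add: prod.atLeast_Suc_lessThan x_def)
      have "(\<Prod>k=j..<K. (cos (2 * pi * t k * (real n + \<phi>)))\<^sup>2) * cos y = ?P n * ((cos x)\<^sup>2 * cos y)"
        unfolding p by (simp only: mult_ac)
      also have "\<dots> = 1/2 * (?P n * cos y) + 1/4 * (?P n * cos (y + 2 * x)) + 1/4 * (?P n * cos (y - 2 * x))"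
        unfolding c by (simp add: distrib_left)
      finally show ?thesis unfolding e y_def[symmetric] .
    qed
    then show ?thesis by (simp only: sum.distrib sum_distrib_left[symmetric] add_divide_distrib times_divide_eq_right)
  qed
  ultimately show ?case by simp
qed

lemma sum_t_le: "(\<Sum>k=j..<K. t k) \<le> 8/7 * t j"
proof (rule order_trans[OF _ suminf_t_tail_le])
  have "(\<Sum>k=j..<K. t k) = (\<Sum>i<K - j. t (j + i))"
    by (rule sum.reindex_bij_witness[of _ "\<lambda>i. j + i" "\<lambda>k. k - j"]) auto
  also have "\<dots> \<le> (\<Sum>i. t (j + i))"
    by (rule sum_le_suminf[OF summable_t_tail]) (auto simp: t_pos less_imp_le)
  finally show "(\<Sum>k=j..<K. t k) \<le> (\<Sum>i. t (j + i))" .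
qed

text \<open>Each factor cos^2 x = 1/2 + 1/2 cos (2 x) contributes its mean 1/2; the oscillating part
  averages out by the preceding lemma.\<close>

lemma average_prod_tendsto:
  assumes "j \<le> K"
  shows "(\<lambda>N. (\<Sum>n<N. \<Prod>k=j..<K. (cos (2 * pi * t k * (real n + \<phi>)))\<^sup>2) / real N) \<longlonglongrightarrow> (1/2) ^ (K - j)"
  using assms
proof (induction j rule: inc_induct)
  case base
  have "\<forall>\<^sub>F N in sequentially. 1 = (\<Sum>n<N. 1::real) / real N"
    using eventually_gt_at_top[of 0] by eventually_elim simp
  then show ?case by (auto intro: Lim_transform_eventually[OF tendsto_const])
next
  case (step j)
  let ?P = "\<lambda>n. \<Prod>k=Suc j..<K. (cos (2 * pi * t k * (real n + \<phi>)))\<^sup>2"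
  let ?c = "\<lambda>n. cos (2 * pi * (2 * t j) * real n + 4 * pi * t j * \<phi>)"
  \<comment> \<open>The preceding lemma is applied with frequency 2 t j, for which 2 t j / 7 < 2 t j
    < 1 - 2 t j / 7.\<close>
  have tj: "0 < t j" "t j \<le> 1/16" "(\<Sum>k=Suc j..<K. t k) \<le> t j / 7"
  proof -
    show "t j \<le> 1/16" using t_add_le[of 0 j] t_0_le power_le_one[of "1/8::real" j] mult_mono[of "t 0" "1/16" "(1/8)^j" 1] by simp
    show "(\<Sum>k=Suc j..<K. t k) \<le> t j / 7" using sum_t_le[where j = "Suc j" and K = K] t_Suc_le[of j] by simp
  qed (rule t_pos)
  have lim: "(\<lambda>N. 1/2 * ((\<Sum>n<N. ?P n) / real N) + 1/2 * ((\<Sum>n<N. ?P n * ?c n) / real N)) \<longlonglongrightarrow> 1/2 * (1/2) ^ (K - Suc j) + 1/2 * 0"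
    using tj step.hyps by (intro tendsto_add tendsto_mult_left step.IH average_cos_prod_tendsto_0) auto
  have eq: "1/2 * ((\<Sum>n<N. ?P n) / real N) + 1/2 * ((\<Sum>n<N. ?P n * ?c n) / real N)
     = (\<Sum>n<N. \<Prod>k=j..<K. (cos (2 * pi * t k * (real n + \<phi>)))\<^sup>2) / real N" for N
  proof -
    have "(\<Prod>k=j..<K. (cos (2 * pi * t k * (real n + \<phi>)))\<^sup>2) = 1/2 * ?P n + 1/2 * (?P n * ?c n)" for n
    proof -
      define x where "x = 2 * pi * t j * (real n + \<phi>)"
      have e: "2 * pi * (2 * t j) * real n + 4 * pi * t j * \<phi> = 2 * x" by (simp add: x_def algebra_simps)
      have "(\<Prod>k=j..<K. (cos (2 * pi * t k * (real n + \<phi>)))\<^sup>2) = (cos x)\<^sup>2 * ?P n"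
        using step.hyps by (simp add: prod.atLeast_Suc_lessThan x_def)
      then show ?thesis unfolding e cos_double_cos by (simp add: algebra_simps)
    qed
    then show ?thesis by (simp only: sum.distrib sum_distrib_left[symmetric] add_divide_distrib times_divide_eq_right)
  qed
  have pow: "(1/2::real) ^ (K - j) = 1/2 * (1/2) ^ (K - Suc j)" using step.hyps by (simp add: Suc_diff_Suc flip: power_Suc)
  show ?case using lim unfolding eq pow by simp
qed

text \<open>The square of the covariance is at most a product of K squared cosines with mean 2^(-K),
  and K is arbitrary.\<close>

lemma cesaro_null_cov: "cesaro_null (\<lambda>n. cov (m + int n))"
  unfolding cesaro_null_def
proof (rule LIMSEQ_I)
  fix \<epsilon> :: real assume "0 < \<epsilon>"
  obtain K where K: "(1/2::real) ^ K < \<epsilon>\<^sup>2" using \<open>0 < \<epsilon>\<close> real_arch_pow_inv[of "\<epsilon>\<^sup>2" "1/2"] by auto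
  define Q where "Q n = (\<Prod>k=0..<K. (cos (2 * pi * t k * (real n + of_int m)))\<^sup>2)" for n
  have "\<forall>\<^sub>F N in sequentially. (\<Sum>n<N. Q n) / real N < \<epsilon>\<^sup>2"
    using average_prod_tendsto[of 0 K "of_int m"] K unfolding Q_def by (intro order_tendstoD) auto
  then obtain N0 where N0: "\<And>N. N0 \<le> N \<Longrightarrow> (\<Sum>n<N. Q n) / real N < \<epsilon>\<^sup>2" by (auto simp: eventually_sequentially)
  \<comment> \<open>Weighted arithmetic-geometric mean inequality, in the role of Cauchy-Schwarz;
    the weight matches the choice 2^(-K) < \<open>\<epsilon>^2\<close>.\<close>
  have le: "\<bar>cov (m + int n)\<bar> \<le> \<epsilon> / 2 + Q n / (2 * \<epsilon>)" for n
  proof -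
    have "(cov (m + int n))\<^sup>2 \<le> (partial_cov K (m + int n))\<^sup>2"
      using abs_cov_le_partial[of "m + int n" K] by (rule abs_le_square_iff[THEN iffD1])
    also have "\<dots> = Q n"
      unfolding Q_def partial_cov_def prod_power_distrib by (intro prod.cong) (auto simp: algebra_simps)
    finally have c: "\<bar>cov (m + int n)\<bar>\<^sup>2 \<le> Q n" by simp
    have "0 \<le> (\<bar>cov (m + int n)\<bar> - \<epsilon>)\<^sup>2" by simp
    then have "2 * \<epsilon> * \<bar>cov (m + int n)\<bar> \<le> \<epsilon>\<^sup>2 + Q n" using c by (simp add: power2_diff algebra_simps)
    then show ?thesis using \<open>0 < \<epsilon>\<close> by (simp add: field_simps power2_eq_square)
  qed
  show "\<exists>N0. \<forall>N\<ge>N0. norm ((\<Sum>n<N. \<bar>cov (m + int n)\<bar>) / real N - 0) < \<epsilon>"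
  proof (intro exI allI impI)
    fix N assume N: "max N0 1 \<le> N"
    have "(\<Sum>n<N. \<bar>cov (m + int n)\<bar>) \<le> (\<Sum>n<N. \<epsilon> / 2 + Q n / (2 * \<epsilon>))" by (intro sum_mono le)
    also have "\<dots> = real N * (\<epsilon> / 2) + (\<Sum>n<N. Q n) / (2 * \<epsilon>)" by (simp add: sum.distrib sum_divide_distrib)
    finally have "(\<Sum>n<N. \<bar>cov (m + int n)\<bar>) / real N \<le> (real N * (\<epsilon> / 2) + (\<Sum>n<N. Q n) / (2 * \<epsilon>)) / real N"
      by (rule divide_right_mono) simp
    also have "\<dots> = \<epsilon> / 2 + (\<Sum>n<N. Q n) / real N / (2 * \<epsilon>)" using N by (simp add: add_divide_distrib mult.commute)
    also have "\<dots> < \<epsilon> / 2 + \<epsilon>\<^sup>2 / (2 * \<epsilon>)" using N0[of N] N \<open>0 < \<epsilon>\<close> by (intro add_strict_left_mono divide_strict_right_mono) auto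
    also have "\<dots> = \<epsilon>" using \<open>0 < \<epsilon>\<close> by (simp add: power2_eq_square)
    finally show "norm ((\<Sum>n<N. \<bar>cov (m + int n)\<bar>) / real N - 0) < \<epsilon>" by (simp add: sum_nonneg)
  qed
qed


section \<open>Bounded functions on the path space, and stationarity\<close>

definition bounded_measurable :: "((int \<Rightarrow> real) \<Rightarrow> real) \<Rightarrow> bool" where
  "bounded_measurable f \<longleftrightarrow> f \<in> borel_measurable gauss_law \<and> (\<exists>C. \<forall>x. \<bar>f x\<bar> \<le> C)"

lemma bounded_measurable_cos: "finite J \<Longrightarrow> bounded_measurable (\<lambda>x. cos ((\<Sum>j\<in>J. c j * x j) + a))"
  unfolding bounded_measurable_def by (intro conjI exI[of _ 1]) auto

lemma bounded_measurable_indicator: "A \<in> sets gauss_law \<Longrightarrow> bounded_measurable (indicator A)"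
  unfolding bounded_measurable_def by (intro conjI exI[of _ 1]) (auto split: split_indicator)

lemma bounded_measurable_add:
  assumes "bounded_measurable f" "bounded_measurable g"
  shows "bounded_measurable (\<lambda>x. f x + g x)"
proof -
  obtain C D where "\<And>x. \<bar>f x\<bar> \<le> C" "\<And>x. \<bar>g x\<bar> \<le> D" using assms unfolding bounded_measurable_def by blast
  then have "\<bar>f x + g x\<bar> \<le> C + D" for x using abs_triangle_ineq[of "f x" "g x"] by (meson add_mono order_trans)
  then show ?thesis using assms unfolding bounded_measurable_def by auto
qed

lemma bounded_measurable_mult:
  assumes "bounded_measurable f" "bounded_measurable g"
  shows "bounded_measurable (\<lambda>x. f x * g x)"
proof -
  obtain C D where CD: "\<And>x. \<bar>f x\<bar> \<le> C" "\<And>x. \<bar>g x\<bar> \<le> D" using assms unfolding bounded_measurable_def by blast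
  have "\<bar>f x * g x\<bar> \<le> C * D" for x
    unfolding abs_mult by (intro mult_mono CD) (use order_trans[OF abs_ge_zero CD(1)] in auto)
  then show ?thesis using assms unfolding bounded_measurable_def by auto
qed

lemma bounded_measurable_scale: "bounded_measurable f \<Longrightarrow> bounded_measurable (\<lambda>x. c * f x)"
  by (rule bounded_measurable_mult) (auto simp: bounded_measurable_def)

lemma bounded_measurable_lim:
  assumes "\<And>n. bounded_measurable (F n)" "\<And>n x. \<bar>F n x\<bar> \<le> C" "\<And>x. (\<lambda>n. F n x) \<longlonglongrightarrow> f x"
  shows "bounded_measurable f"
  unfolding bounded_measurable_def
proof (intro conjI exI allI)
  show "f \<in> borel_measurable gauss_law"
    by (rule borel_measurable_LIMSEQ_real[OF assms(3)]) (use assms(1) in \<open>auto simp: bounded_measurable_def\<close>)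
  show "\<bar>f x\<bar> \<le> C" for x
    by (rule LIMSEQ_le_const2[OF tendsto_rabs[OF assms(3)]]) (use assms(2) in auto)
qed

lemma integrable_bounded_measurable: "bounded_measurable f \<Longrightarrow> integrable gauss_law f"
  unfolding bounded_measurable_def
  using finite_measure.integrable_const_bound[OF prob_space.finite_measure[OF prob_space_gauss_law], of f] by auto

lemma integral_abs_diff_tendsto_0:
  assumes "\<And>n. bounded_measurable (F n)" "\<And>n x. \<bar>F n x\<bar> \<le> C" "\<And>x. (\<lambda>n. F n x) \<longlonglongrightarrow> f x"
  shows "(\<lambda>n. \<integral>x. \<bar>f x - F n x\<bar> \<partial>gauss_law) \<longlonglongrightarrow> 0"
proof -
  interpret prob_space gauss_law by (rule prob_space_gauss_law)
  have f: "bounded_measurable f" using assms by (rule bounded_measurable_lim)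
  have fb: "\<bar>f x\<bar> \<le> C" for x
    by (rule LIMSEQ_le_const2[OF tendsto_rabs[OF assms(3)]]) (use assms(2) in auto)
  have [measurable]: "f \<in> borel_measurable gauss_law" "F n \<in> borel_measurable gauss_law" for n
    using f assms(1) by (auto simp: bounded_measurable_def)
  have "(\<lambda>n. \<integral>x. \<bar>f x - F n x\<bar> \<partial>gauss_law) \<longlonglongrightarrow> (\<integral>x. 0 \<partial>gauss_law)"
  proof (rule integral_dominated_convergence[where w = "\<lambda>_. 2 * C"])
    show "AE x in gauss_law. (\<lambda>n. \<bar>f x - F n x\<bar>) \<longlonglongrightarrow> 0"
    proof (rule AE_I2)
      fix x
      have "(\<lambda>n. \<bar>f x - F n x\<bar>) \<longlonglongrightarrow> \<bar>f x - f x\<bar>" by (intro tendsto_intros assms(3))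
      then show "(\<lambda>n. \<bar>f x - F n x\<bar>) \<longlonglongrightarrow> 0" by simp
    qed
    show "AE x in gauss_law. norm \<bar>f x - F n x\<bar> \<le> 2 * C" for n
    proof (rule AE_I2)
      fix x
      show "norm \<bar>f x - F n x\<bar> \<le> 2 * C"
        using add_mono[OF fb[of x] assms(2)[of n x]] abs_triangle_ineq4[of "f x" "F n x"] by simp
    qed
  qed auto
  then show ?thesis by simp
qed

definition coord_shift :: "(int \<Rightarrow> real) \<Rightarrow> int \<Rightarrow> real" where
  "coord_shift x = (\<lambda>i. x (i + 1))"

lemma shift_funpow: "(coord_shift ^^ n) x = (\<lambda>i. x (i + int n))"
  by (induction n arbitrary: x) (auto simp: coord_shift_def funpow_Suc_right algebra_simps simp del: funpow.simps)

lemma measurable_shift_by [measurable]: "(\<lambda>x i. x (i + k)) \<in> gauss_law \<rightarrow>\<^sub>M gauss_law" for k :: int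
proof -
  have "(\<lambda>x i. x (i + k)) \<in> gauss_law \<rightarrow>\<^sub>M PiM UNIV (\<lambda>_. borel)"
  proof (rule measurable_PiM_single')
    show "(\<lambda>x. x (i + k)) \<in> borel_measurable gauss_law" for i by measurable
  qed auto
  then show ?thesis by measurable
qed

lemma measurable_shift_funpow [measurable]: "(coord_shift ^^ n) \<in> gauss_law \<rightarrow>\<^sub>M gauss_law"
  unfolding shift_funpow[abs_def] by measurable

lemma bounded_measurable_shift: "bounded_measurable f \<Longrightarrow> bounded_measurable (\<lambda>x. f ((coord_shift ^^ n) x))"
  unfolding bounded_measurable_def by auto

text \<open>The monotone class theorem for the conjunction of \<open>R\<close> with bounded
  measurability, so that the integrals in the closure steps exist.\<close>

lemma trig_monotone_classI:
  assumes "\<And>f g. bounded_measurable f \<Longrightarrow> bounded_measurable g \<Longrightarrow> R f \<Longrightarrow> R g \<Longrightarrow> R (\<lambda>x. f x + g x)"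
    and "\<And>f c. bounded_measurable f \<Longrightarrow> R f \<Longrightarrow> R (\<lambda>x. c * f x)"
    and "\<And>F f C. (\<And>n. bounded_measurable (F n)) \<Longrightarrow> bounded_measurable f \<Longrightarrow> (\<And>n. R (F n)) \<Longrightarrow>
      (\<And>n x. \<bar>F n x\<bar> \<le> C) \<Longrightarrow> (\<And>x. (\<lambda>n. F n x) \<longlonglongrightarrow> f x) \<Longrightarrow> R f"
    and "\<And>J c a. finite J \<Longrightarrow> R (\<lambda>x. cos ((\<Sum>j\<in>J. c j * x j) + a))"
    and "A \<in> sets gauss_law"
  shows "R (indicator A)"
proof -
  interpret trig_monotone_class "\<lambda>f. bounded_measurable f \<and> R f"
  proof
    fix F f and C :: real
    assume F: "\<And>n. bounded_measurable (F n) \<and> R (F n)" "\<And>n x. \<bar>F n x\<bar> \<le> C" "\<And>x. (\<lambda>n. F n x) \<longlonglongrightarrow> f x"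
    then show "bounded_measurable f \<and> R f"
      using bounded_measurable_lim[of F C f] assms(3)[of F f C] by blast
  qed (auto intro: bounded_measurable_add bounded_measurable_scale bounded_measurable_cos assms(1,2,4))
  show ?thesis using W_indicator[of A] assms(5) by simp
qed

text \<open>Stationarity: a common translation of the indices leaves their differences, and hence
  the integrals of cosines, unchanged.\<close>

lemma emeasure_shift_by:
  assumes "A \<in> sets gauss_law"
  shows "emeasure gauss_law ((\<lambda>x i. x (i + k)) -` A) = emeasure gauss_law A"
proof -
  interpret prob_space gauss_law by (rule prob_space_gauss_law)
  let ?s = "\<lambda>x i. x (i + k) :: real"
  have bs: "bounded_measurable (\<lambda>x. f (?s x))" if "bounded_measurable f" for f
    using that unfolding bounded_measurable_def by auto
  have lim: "(\<lambda>n. \<integral>x. F n x \<partial>gauss_law) \<longlonglongrightarrow> (\<integral>x. f x \<partial>gauss_law)"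
    if "\<And>n. bounded_measurable (F n)" "bounded_measurable f" "\<And>n x. \<bar>F n x\<bar> \<le> C" "\<And>x. (\<lambda>n. F n x) \<longlonglongrightarrow> f x" for F f and C :: real
    by (rule integral_dominated_convergence[where w = "\<lambda>_. C"]) (use that in \<open>auto simp: bounded_measurable_def\<close>)
  have "(\<lambda>f. (\<integral>x. f (?s x) \<partial>gauss_law) = (\<integral>x. f x \<partial>gauss_law)) (indicator A :: (int \<Rightarrow> real) \<Rightarrow> real)"
  proof (rule trig_monotone_classI[of "\<lambda>f. (\<integral>x. f (?s x) \<partial>gauss_law) = (\<integral>x. f x \<partial>gauss_law)", OF _ _ _ _ assms])
    fix F f and C :: real assume F: "\<And>n. bounded_measurable (F n)" and f: "bounded_measurable f"
      and eq: "\<And>n. (\<integral>x. F n (?s x) \<partial>gauss_law) = (\<integral>x. F n x \<partial>gauss_law)"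
      and C: "\<And>n x. \<bar>F n x\<bar> \<le> C" "\<And>x. (\<lambda>n. F n x) \<longlonglongrightarrow> f x"
    have "(\<lambda>n. \<integral>x. F n (?s x) \<partial>gauss_law) \<longlonglongrightarrow> (\<integral>x. f (?s x) \<partial>gauss_law)"
      by (rule lim[OF bs[OF F] bs[OF f]]) (rule C)+
    moreover have "(\<lambda>n. \<integral>x. F n x \<partial>gauss_law) \<longlonglongrightarrow> (\<integral>x. f x \<partial>gauss_law)"
      by (rule lim[OF F f]) (rule C)+
    ultimately show "(\<integral>x. f (?s x) \<partial>gauss_law) = (\<integral>x. f x \<partial>gauss_law)"
      unfolding eq by (rule LIMSEQ_unique)
  next
    fix J c a assume "finite (J :: int set)"
    then show "(\<integral>x. cos ((\<Sum>j\<in>J. c j * ?s x j) + a) \<partial>gauss_law) = (\<integral>x. cos ((\<Sum>j\<in>J. c j * x j) + a) \<partial>gauss_law)"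
      using integral_cos_gauss_law[of J c "\<lambda>j. j + k" a] integral_cos_gauss_law[of J c "\<lambda>j. j" a] by simp
  next
    fix f g assume "bounded_measurable f" "bounded_measurable g" "(\<integral>x. f (?s x) \<partial>gauss_law) = (\<integral>x. f x \<partial>gauss_law)"
      "(\<integral>x. g (?s x) \<partial>gauss_law) = (\<integral>x. g x \<partial>gauss_law)"
    then show "(\<integral>x. f (?s x) + g (?s x) \<partial>gauss_law) = (\<integral>x. f x + g x \<partial>gauss_law)"
      using bs by (simp add: integrable_bounded_measurable)
  qed simp
  moreover have "indicator A (?s x) = (indicator (?s -` A) x :: real)" for x by (auto split: split_indicator)
  moreover have "?s -` A \<in> sets gauss_law"
    using measurable_sets[OF measurable_shift_by[of k] assms] by simp
  ultimately show ?thesis using assms by (simp add: emeasure_eq_measure)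
qed

lemma distr_shift_by: "distr gauss_law gauss_law (\<lambda>x i. x (i + k)) = gauss_law"
  by (rule measure_eqI) (auto simp: emeasure_distr emeasure_shift_by)

lemma integral_shift:
  "bounded_measurable f \<Longrightarrow> (\<integral>x. f ((coord_shift ^^ n) x) \<partial>gauss_law) = (\<integral>x. f x \<partial>gauss_law)" for f :: "(int \<Rightarrow> real) \<Rightarrow> real"
  using integral_distr[OF measurable_shift_by[of "int n"], of f] distr_shift_by[of "int n"]
  by (simp add: bounded_measurable_def shift_funpow)

text \<open>The variance of the linear form with coefficients c under
  \<open>gauss_law\<close>.\<close>

definition quad_form :: "int set \<Rightarrow> (int \<Rightarrow> real) \<Rightarrow> real" where
  "quad_form J c = (\<Sum>j\<in>J. \<Sum>k\<in>J. c j * c k * cov (j - k))"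

text \<open>The covariance of one linear form with another one shifted by n.\<close>

definition cross_form :: "int set \<Rightarrow> (int \<Rightarrow> real) \<Rightarrow> int set \<Rightarrow> (int \<Rightarrow> real) \<Rightarrow> int \<Rightarrow> real" where
  "cross_form J c J' c' n = (\<Sum>j\<in>J. \<Sum>k\<in>J'. c j * c' k * cov (j - (k + n)))"

text \<open>The variance of X + s Y. The disjoint sum of index sets allows J to meet the translate
  of J'; s = 1 and s = -1 occur in the product-to-sum formula.\<close>

lemma integral_cos_shift:
  assumes "finite J" "finite J'"
  shows "(\<integral>x. cos ((\<Sum>j\<in>J. c j * x j) + s * (\<Sum>j\<in>J'. c' j * x (j + n)) + a) \<partial>gauss_law)
    = cos a * exp (- (quad_form J c + s\<^sup>2 * quad_form J' c' + 2 * s * cross_form J c J' c' n) / 2)"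
proof -
  let ?c = "case_sum c (\<lambda>j. s * c' j)" and ?\<iota> = "case_sum (\<lambda>j. j) (\<lambda>j. j + n)"
  have fin: "finite (J <+> J')" using assms by simp
  have lin: "(\<Sum>j\<in>J. c j * x j) + s * (\<Sum>j\<in>J'. c' j * x (j + n)) = (\<Sum>i\<in>J <+> J'. ?c i * x (?\<iota> i))" for x :: "int \<Rightarrow> real"
    using assms by (simp add: sum.Plus sum_distrib_left mult.assoc)
  have c1: "cov (k + n - j) = cov (j - (k + n))" for j k using cov_minus[of "j - (k + n)"] by (simp add: algebra_simps)
  have cross: "(\<Sum>k\<in>J'. \<Sum>j\<in>J. s * c' k * c j * cov (k + n - j)) = s * cross_form J c J' c' n"
    unfolding cross_form_def sum_distrib_left c1 by (subst sum.swap) (simp add: mult_ac)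
  have "(\<Sum>i\<in>J <+> J'. \<Sum>k\<in>J <+> J'. ?c i * ?c k * cov (?\<iota> i - ?\<iota> k))
    = quad_form J c + s\<^sup>2 * quad_form J' c' + 2 * s * cross_form J c J' c' n"
    using assms cross
    by (simp add: sum.Plus sum.distrib quad_form_def sum_distrib_left power2_eq_square mult_ac)
      (simp add: cross_form_def sum_distrib_left mult_ac)
  then show ?thesis unfolding lin using integral_cos_gauss_law[OF fin, of ?c ?\<iota> a] by simp
qed

text \<open>The shift n enters through \<open>cross_form\<close> alone. Mixing follows from its
  vanishing in Cesaro mean, rigidity from its convergence to the value at 0.\<close>

lemma integral_cos_mult_cos_shift:
  assumes "finite J" "finite J'"
  shows "(\<integral>x. cos ((\<Sum>j\<in>J. c j * x j) + a) * cos ((\<Sum>j\<in>J'. c' j * (coord_shift ^^ n) x j) + a') \<partial>gauss_law)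
    = exp (- (quad_form J c + quad_form J' c') / 2) *
      (cos (a + a') * exp (- cross_form J c J' c' (int n)) + cos (a - a') * exp (cross_form J c J' c' (int n))) / 2"
proof -
  interpret prob_space gauss_law by (rule prob_space_gauss_law)
  let ?f = "\<lambda>s b x. cos ((\<Sum>j\<in>J. c j * x j) + s * (\<Sum>j\<in>J'. c' j * x (j + int n)) + b)"
  have int: "integrable gauss_law (?f s b)" for s b
    by (rule integrable_const_bound[where B = 1]) auto
  have "(\<integral>x. cos ((\<Sum>j\<in>J. c j * x j) + a) * cos ((\<Sum>j\<in>J'. c' j * (coord_shift ^^ n) x j) + a') \<partial>gauss_law)
    = (\<integral>x. (?f 1 (a + a') x + ?f (-1) (a - a') x) / 2 \<partial>gauss_law)"
    by (intro Bochner_Integration.integral_cong refl) (simp add: shift_funpow cos_times_cos algebra_simps)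
  also have "\<dots> = ((\<integral>x. ?f 1 (a + a') x \<partial>gauss_law) + (\<integral>x. ?f (-1) (a - a') x \<partial>gauss_law)) / 2"
    using int[of 1 "a + a'"] int[of "-1" "a - a'"] by simp
  also have "\<dots> = (cos (a + a') * exp (- (quad_form J c + quad_form J' c') / 2 - cross_form J c J' c' (int n))
      + cos (a - a') * exp (- (quad_form J c + quad_form J' c') / 2 + cross_form J c J' c' (int n))) / 2"
    unfolding integral_cos_shift[OF assms] by (simp add: field_simps)
  finally show ?thesis unfolding exp_add exp_diff exp_minus by (simp add: field_simps)
qed

lemma integral_cos_lin:
  assumes "finite J"
  shows "(\<integral>x. cos ((\<Sum>j\<in>J. c j * x j) + a) \<partial>gauss_law) = cos a * exp (- quad_form J c / 2)"
  using integral_cos_gauss_law[OF assms, of c "\<lambda>j. j" a] by (simp add: quad_form_def)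

lemma cesaro_null_cross_form: "cesaro_null (\<lambda>n. cross_form J c J' c' (int n))"
proof -
  have "cov (j - (k + int n)) = cov ((k - j) + int n)" for j k n using cov_minus[of "j - (k + int n)"] by (simp add: algebra_simps)
  then show ?thesis
    unfolding cross_form_def by (simp only:) (intro cesaro_null_sum cesaro_null_mult cesaro_null_cov)
qed

lemma abs_cross_form_le: "\<bar>cross_form J c J' c' n\<bar> \<le> (\<Sum>j\<in>J. \<Sum>k\<in>J'. \<bar>c j * c' k\<bar>)"
  unfolding cross_form_def
proof (intro order_trans[OF sum_abs] sum_mono)
  fix j k
  show "\<bar>c j * c' k * cov (j - (k + n))\<bar> \<le> \<bar>c j * c' k\<bar>"
    using mult_left_mono[OF abs_cov_le[of "j - (k + n)"] abs_ge_zero[of "c j * c' k"]] by (simp add: abs_mult)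
qed

lemma abs_exp_minus_one_le: "\<bar>u\<bar> \<le> B \<Longrightarrow> \<bar>exp u - 1\<bar> \<le> exp B * \<bar>u\<bar>" for u B :: real
proof -
  assume B: "\<bar>u\<bar> \<le> B"
  show ?thesis
  proof (cases "0 \<le> u")
    case True
    have "(1 - u) * exp u \<le> exp (- u) * exp u" using exp_ge_add_one_self[of "- u"] by (intro mult_right_mono) auto
    then have "exp u - 1 \<le> u * exp u" by (simp add: algebra_simps exp_minus)
    also have "\<dots> \<le> u * exp B" using True B by (intro mult_left_mono) auto
    finally show ?thesis using True by (simp add: mult.commute)
  next
    case False
    have "\<bar>exp u - 1\<bar> = 1 - exp u" using False by simp
    also have "\<dots> \<le> 1 * \<bar>u\<bar>" unfolding mult_1 using exp_ge_add_one_self[of u] by linarith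
    also have "\<dots> \<le> exp B * \<bar>u\<bar>" using B by (intro mult_right_mono) auto
    finally show ?thesis .
  qed
qed

section \<open>From cosines to measurable sets\<close>

definition pairing :: "((int \<Rightarrow> real) \<Rightarrow> real) \<Rightarrow> ((int \<Rightarrow> real) \<Rightarrow> real) \<Rightarrow> nat \<Rightarrow> real" where
  "pairing f g n = (\<integral>x. f x * g ((coord_shift ^^ n) x) \<partial>gauss_law)"

lemma abs_integral_mult_le:
  assumes f: "bounded_measurable f" and g: "bounded_measurable g" and D: "\<And>x. \<bar>g x\<bar> \<le> D"
  shows "\<bar>\<integral>x. f x * g x \<partial>gauss_law\<bar> \<le> D * (\<integral>x. \<bar>f x\<bar> \<partial>gauss_law)"
proof -
  have "\<bar>\<integral>x. f x * g x \<partial>gauss_law\<bar> \<le> (\<integral>x. \<bar>f x * g x\<bar> \<partial>gauss_law)" by (rule integral_abs_bound)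
  also have "\<dots> \<le> (\<integral>x. D * \<bar>f x\<bar> \<partial>gauss_law)"
  proof (rule integral_mono)
    show "integrable gauss_law (\<lambda>x. \<bar>f x * g x\<bar>)"
      by (intro integrable_abs integrable_bounded_measurable bounded_measurable_mult f g)
    show "\<bar>f x * g x\<bar> \<le> D * \<bar>f x\<bar>" for x
      using mult_right_mono[OF D abs_ge_zero] by (simp add: abs_mult mult.commute[of "\<bar>f x\<bar>"])
  qed (use integrable_bounded_measurable[OF f] in auto)
  finally show ?thesis by simp
qed

lemma abs_pairing_le_left:
  "bounded_measurable f \<Longrightarrow> bounded_measurable g \<Longrightarrow> (\<And>x. \<bar>g x\<bar> \<le> D) \<Longrightarrow>
    \<bar>pairing f g n\<bar> \<le> D * (\<integral>x. \<bar>f x\<bar> \<partial>gauss_law)"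
  unfolding pairing_def by (rule abs_integral_mult_le[OF _ bounded_measurable_shift])

text \<open>Invariance of the law removes the shift from the L1 norm, so the bound is uniform in
  n.\<close>

lemma abs_pairing_le_right:
  assumes "bounded_measurable f" "bounded_measurable g" "\<And>x. \<bar>f x\<bar> \<le> D"
  shows "\<bar>pairing f g n\<bar> \<le> D * (\<integral>x. \<bar>g x\<bar> \<partial>gauss_law)"
proof -
  have g': "bounded_measurable (\<lambda>x. \<bar>g x\<bar>)" using assms(2) by (auto simp: bounded_measurable_def)
  show ?thesis
    using abs_integral_mult_le[OF bounded_measurable_shift[OF assms(2)] assms(1,3), of n] integral_shift[OF g', of n]
    by (simp add: pairing_def mult.commute)
qed

lemma integrable_pairing:
  "bounded_measurable f \<Longrightarrow> bounded_measurable g \<Longrightarrow> integrable gauss_law (\<lambda>x. f x * g ((coord_shift ^^ n) x))"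
  by (intro integrable_bounded_measurable bounded_measurable_mult bounded_measurable_shift)

lemma pairing_add_left:
  assumes "bounded_measurable f" "bounded_measurable f'" "bounded_measurable g"
  shows "pairing (\<lambda>x. f x + f' x) g n = pairing f g n + pairing f' g n"
  using integrable_pairing[OF assms(1,3), of n] integrable_pairing[OF assms(2,3), of n]
  by (simp add: pairing_def distrib_right)

lemma pairing_add_right:
  assumes "bounded_measurable f" "bounded_measurable g" "bounded_measurable g'"
  shows "pairing f (\<lambda>x. g x + g' x) n = pairing f g n + pairing f g' n"
  using integrable_pairing[OF assms(1,2), of n] integrable_pairing[OF assms(1,3), of n]
  by (simp add: pairing_def distrib_left)

lemma pairing_scale: "pairing (\<lambda>x. k * f x) g n = k * pairing f g n" "pairing f (\<lambda>x. k * g x) n = k * pairing f g n"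
  by (simp_all add: pairing_def mult.assoc mult.left_commute)

lemma pairing_indicator:
  assumes "A \<in> sets gauss_law" "B \<in> sets gauss_law"
  shows "pairing (indicator A) (indicator B) n = measure gauss_law (A \<inter> (coord_shift ^^ n) -` B)"
proof -
  have "indicator A x * indicator B ((coord_shift ^^ n) x) = (indicator (A \<inter> (coord_shift ^^ n) -` B) x :: real)" for x
    by (auto split: split_indicator)
  then show ?thesis by (simp add: pairing_def)
qed

text \<open>
  Weak mixing and rigidity both say that \<open>pairing f g n - L f g\<close> tends to zero in a suitable sense, where
  \<open>L f g\<close> is \<open>(\<integral>f) (\<integral>g)\<close> or \<open>\<integral>f g\<close>.
\<close>

lemma pairing_null_indicator:
  fixes null :: "(nat \<Rightarrow> real) \<Rightarrow> bool" and L :: "((int \<Rightarrow> real) \<Rightarrow> real) \<Rightarrow> ((int \<Rightarrow> real) \<Rightarrow> real) \<Rightarrow> real"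
  assumes null_add: "\<And>a c. null a \<Longrightarrow> null c \<Longrightarrow> null (\<lambda>n. a n + c n)"
    and null_mult: "\<And>a k. null a \<Longrightarrow> null (\<lambda>n. k * a n)"
    and null_lim: "\<And>a c e. (\<And>k. null (a k)) \<Longrightarrow> (\<And>k n. \<bar>c n - a k n\<bar> \<le> e k) \<Longrightarrow> e \<longlonglongrightarrow> 0 \<Longrightarrow> null c"
    and L_commute: "\<And>f g. L f g = L g f"
    and L_add: "\<And>f f' g. bounded_measurable f \<Longrightarrow> bounded_measurable f' \<Longrightarrow> bounded_measurable g \<Longrightarrow>
      L (\<lambda>x. f x + f' x) g = L f g + L f' g"
    and L_scale: "\<And>f g k. L (\<lambda>x. k * f x) g = k * L f g"
    and L_bound: "\<And>f g D. bounded_measurable f \<Longrightarrow> bounded_measurable g \<Longrightarrow> (\<And>x. \<bar>g x\<bar> \<le> D) \<Longrightarrow>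
      \<bar>L f g\<bar> \<le> D * (\<integral>x. \<bar>f x\<bar> \<partial>gauss_law)"
    and cos: "\<And>J J' c c' a a'. finite J \<Longrightarrow> finite J' \<Longrightarrow>
      null (\<lambda>n. pairing (\<lambda>x. cos ((\<Sum>j\<in>J. c j * x j) + a)) (\<lambda>x. cos ((\<Sum>j\<in>J'. c' j * x j) + a')) n
        - L (\<lambda>x. cos ((\<Sum>j\<in>J. c j * x j) + a)) (\<lambda>x. cos ((\<Sum>j\<in>J'. c' j * x j) + a')))"
    and A: "A \<in> sets gauss_law" and B: "B \<in> sets gauss_law"
  shows "null (\<lambda>n. pairing (indicator A) (indicator B) n - L (indicator A) (indicator B))"
proof -
  \<comment> \<open>One argument is varied at a time: \<open>Q\<close> is the difference with the
    other one frozen. Its L1 bound, uniform in n, lets it pass to bounded limits.\<close>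
  have extend: "null (Q (indicator X))"
    if X: "X \<in> sets gauss_law"
      and chars: "\<And>J c a. finite J \<Longrightarrow> null (Q (\<lambda>x. cos ((\<Sum>j\<in>J. c j * x j) + a)))"
      and Q_add: "\<And>f f' n. bounded_measurable f \<Longrightarrow> bounded_measurable f' \<Longrightarrow> Q (\<lambda>x. f x + f' x) n = Q f n + Q f' n"
      and Q_scale: "\<And>f k n. Q (\<lambda>x. k * f x) n = k * Q f n"
      and Q_bound: "\<And>f n. bounded_measurable f \<Longrightarrow> \<bar>Q f n\<bar> \<le> D * (\<integral>x. \<bar>f x\<bar> \<partial>gauss_law)"
    for Q :: "((int \<Rightarrow> real) \<Rightarrow> real) \<Rightarrow> nat \<Rightarrow> real" and X D
  proof (rule trig_monotone_classI[of "\<lambda>f. null (Q f)", OF _ _ _ chars X])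
    fix f f' assume "bounded_measurable f" "bounded_measurable f'" and null: "null (Q f)" "null (Q f')"
    then have "Q (\<lambda>x. f x + f' x) = (\<lambda>n. Q f n + Q f' n)" by (intro ext Q_add)
    then show "null (Q (\<lambda>x. f x + f' x))" using null_add[OF null] by simp
  next
    fix f k assume "null (Q f)"
    moreover have "Q (\<lambda>x. k * f x) = (\<lambda>n. k * Q f n)" by (intro ext Q_scale)
    ultimately show "null (Q (\<lambda>x. k * f x))" using null_mult by simp
  next
    fix F f and C :: real
    assume F: "\<And>n. bounded_measurable (F n)" and f: "bounded_measurable f" and null: "\<And>n. null (Q (F n))"
      and C: "\<And>n x. \<bar>F n x\<bar> \<le> C" "\<And>x. (\<lambda>n. F n x) \<longlonglongrightarrow> f x"
    show "null (Q f)"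
    proof (rule null_lim[OF null])
      fix k n
      have d: "bounded_measurable (\<lambda>x. f x + (-1) * F k x)"
        using f F by (intro bounded_measurable_add bounded_measurable_scale)
      have "Q f n - Q (F k) n = Q (\<lambda>x. f x + (-1) * F k x) n"
        unfolding Q_add[OF f bounded_measurable_scale[OF F]] Q_scale by simp
      then show "\<bar>Q f n - Q (F k) n\<bar> \<le> D * (\<integral>x. \<bar>f x - F k x\<bar> \<partial>gauss_law)"
        using Q_bound[OF d, of n] by simp
      show "(\<lambda>k. D * (\<integral>x. \<bar>f x - F k x\<bar> \<partial>gauss_law)) \<longlonglongrightarrow> 0"
        using tendsto_mult_left[OF integral_abs_diff_tendsto_0[OF F C], of D] by simp
    qed
  qed
  have bound: "\<bar>p - l\<bar> \<le> 2 * D * i" if "\<bar>p\<bar> \<le> D * i" "\<bar>l\<bar> \<le> D * i" for p l D i :: real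
    using that abs_triangle_ineq4[of p l] by simp
  note ind = bounded_measurable_indicator[OF A]
  \<comment> \<open>First slot, with g frozen. Below, g is a cosine, which supplies the case of
    cosines for the second slot.\<close>
  have left: "null (\<lambda>n. pairing (indicator A) g n - L (indicator A) g)"
    if g: "bounded_measurable g" and D: "\<And>x. \<bar>g x\<bar> \<le> D"
      and chars: "\<And>J c a. finite J \<Longrightarrow> null (\<lambda>n. pairing (\<lambda>x. cos ((\<Sum>j\<in>J. c j * x j) + a)) g n - L (\<lambda>x. cos ((\<Sum>j\<in>J. c j * x j) + a)) g)"
    for g D
  proof (rule extend[of A "\<lambda>f n. pairing f g n - L f g" "2 * D", OF A chars])
    show "pairing (\<lambda>x. k * f x) g n - L (\<lambda>x. k * f x) g = k * (pairing f g n - L f g)" for f k n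
      by (simp add: pairing_scale L_scale right_diff_distrib)
    show "pairing (\<lambda>x. f x + f' x) g n - L (\<lambda>x. f x + f' x) g = (pairing f g n - L f g) + (pairing f' g n - L f' g)"
      if "bounded_measurable f" "bounded_measurable f'" for f f' n
      by (simp add: pairing_add_left L_add g that)
    show "\<bar>pairing f g n - L f g\<bar> \<le> 2 * D * (\<integral>x. \<bar>f x\<bar> \<partial>gauss_law)" if "bounded_measurable f" for f n
      by (intro bound abs_pairing_le_left L_bound D g that)
  qed
  show ?thesis
  proof (rule extend[of B "\<lambda>g n. pairing (indicator A) g n - L (indicator A) g" "2 * 1"])
    show "null (\<lambda>n. pairing (indicator A) (\<lambda>x. cos ((\<Sum>j\<in>J. c j * x j) + a)) n - L (indicator A) (\<lambda>x. cos ((\<Sum>j\<in>J. c j * x j) + a)))"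
      if "finite J" for J c a
      by (rule left[where D = 1]) (auto intro: bounded_measurable_cos cos that)
    show "pairing (indicator A) (\<lambda>x. k * f x) n - L (indicator A) (\<lambda>x. k * f x)
      = k * (pairing (indicator A) f n - L (indicator A) f)" for f k n
      unfolding L_commute[of "indicator A"] by (simp add: pairing_scale L_scale right_diff_distrib)
    show "pairing (indicator A) (\<lambda>x. f x + f' x) n - L (indicator A) (\<lambda>x. f x + f' x)
      = (pairing (indicator A) f n - L (indicator A) f) + (pairing (indicator A) f' n - L (indicator A) f')"
      if "bounded_measurable f" "bounded_measurable f'" for f f' n
      unfolding L_commute[of "indicator A"] by (simp add: pairing_add_right L_add ind that)
    show "\<bar>pairing (indicator A) f n - L (indicator A) f\<bar> \<le> 2 * 1 * (\<integral>x. \<bar>f x\<bar> \<partial>gauss_law)"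
      if "bounded_measurable f" for f n
      unfolding L_commute[of "indicator A"]
      by (intro bound abs_pairing_le_right L_bound ind that) (auto split: split_indicator)
  qed (rule B)
qed

text \<open>The product of the two integrals is what the formula for the pairing gives at cross form
  0. The formula is Lipschitz in the cross form X as long as |X| <= B.\<close>

lemma cesaro_null_pairing_cos:
  assumes "finite J" "finite J'"
  shows "cesaro_null (\<lambda>n. pairing (\<lambda>x. cos ((\<Sum>j\<in>J. c j * x j) + a)) (\<lambda>x. cos ((\<Sum>j\<in>J'. c' j * x j) + a')) n
    - (\<integral>x. cos ((\<Sum>j\<in>J. c j * x j) + a) \<partial>gauss_law) * (\<integral>x. cos ((\<Sum>j\<in>J'. c' j * x j) + a') \<partial>gauss_law))"
  (is "cesaro_null ?p")
proof (rule cesaro_null_dominated[OF cesaro_null_cross_form])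
  fix n
  define B where "B = (\<Sum>j\<in>J. \<Sum>k\<in>J'. \<bar>c j * c' k\<bar>)"
  define V where "V = exp (- (quad_form J c + quad_form J' c') / 2)"
  define X where "X = cross_form J c J' c' (int n)"
  have X: "\<bar>X\<bar> \<le> B" unfolding X_def B_def by (rule abs_cross_form_le)
  have "?p n = V * (cos (a + a') * exp (- X) + cos (a - a') * exp X) / 2 - cos a * cos a' * V"
    unfolding pairing_def integral_cos_mult_cos_shift[OF assms] integral_cos_lin[OF assms(1)] integral_cos_lin[OF assms(2)]
    by (simp add: V_def X_def exp_add[symmetric] add_divide_distrib[symmetric] mult_ac)
  also have "\<dots> = V * (cos (a + a') * (exp (- X) - 1) + cos (a - a') * (exp X - 1)) / 2"
  proof -
    have "cos a * cos a' = (cos (a + a') + cos (a - a')) / 2" by (simp add: cos_add cos_diff)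
    then show ?thesis by (simp add: algebra_simps add_divide_distrib diff_divide_distrib)
  qed
  finally have eq: "?p n = V * (cos (a + a') * (exp (- X) - 1) + cos (a - a') * (exp X - 1)) / 2" .
  have "0 \<le> V" by (simp add: V_def)
  then have "\<bar>?p n\<bar> = V * \<bar>cos (a + a') * (exp (- X) - 1) + cos (a - a') * (exp X - 1)\<bar> / 2"
    unfolding eq by (simp add: abs_mult)
  also have "\<dots> \<le> V * (1 * (exp B * \<bar>X\<bar>) + 1 * (exp B * \<bar>X\<bar>)) / 2"
  proof (intro divide_right_mono mult_left_mono order_trans[OF abs_triangle_ineq] add_mono)
    show "\<bar>cos (a + a') * (exp (- X) - 1)\<bar> \<le> 1 * (exp B * \<bar>X\<bar>)"
      unfolding abs_mult using abs_exp_minus_one_le[of "- X" B] X by (intro mult_mono) auto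
    show "\<bar>cos (a - a') * (exp X - 1)\<bar> \<le> 1 * (exp B * \<bar>X\<bar>)"
      unfolding abs_mult using abs_exp_minus_one_le[of X B] X by (intro mult_mono) auto
  qed (auto simp: V_def)
  finally show "\<bar>?p n\<bar> \<le> exp (- (quad_form J c + quad_form J' c') / 2) * exp (\<Sum>j\<in>J. \<Sum>k\<in>J'. \<bar>c j * c' k\<bar>) * \<bar>cross_form J c J' c' (int n)\<bar>"
    by (simp add: V_def X_def B_def mult_ac)
qed

theorem gauss_law_weakly_mixing:
  assumes A: "A \<in> sets gauss_law" and B: "B \<in> sets gauss_law"
  shows "(\<lambda>N. (\<Sum>n<N. \<bar>measure gauss_law (A \<inter> (coord_shift ^^ n) -` B) - measure gauss_law A * measure gauss_law B\<bar>) / real N) \<longlonglongrightarrow> 0"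
proof -
  interpret prob_space gauss_law by (rule prob_space_gauss_law)
  let ?L = "\<lambda>f g. (\<integral>x. f x \<partial>gauss_law) * (\<integral>x. g x \<partial>gauss_law)"
  have "cesaro_null (\<lambda>n. pairing (indicator A) (indicator B) n - ?L (indicator A) (indicator B))"
  proof (rule pairing_null_indicator[of cesaro_null ?L, OF cesaro_null_add cesaro_null_mult cesaro_null_uniform_limit _ _ _ _ cesaro_null_pairing_cos A B])
    fix f g D assume f: "bounded_measurable f" and g: "bounded_measurable g" and D: "\<And>x. \<bar>g x\<bar> \<le> D"
    have "\<bar>\<integral>x. 1 * g x \<partial>gauss_law\<bar> \<le> D * (\<integral>x. \<bar>1\<bar> \<partial>gauss_law)"
      by (rule abs_integral_mult_le[OF _ g D]) (auto simp: bounded_measurable_def)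
    then have gD: "\<bar>\<integral>x. g x \<partial>gauss_law\<bar> \<le> D" using prob_space by simp
    show "\<bar>?L f g\<bar> \<le> D * (\<integral>x. \<bar>f x\<bar> \<partial>gauss_law)"
      unfolding abs_mult mult.commute[of "\<bar>\<integral>x. f x \<partial>gauss_law\<bar>"]
      by (intro mult_mono integral_abs_bound gD order_trans[OF abs_ge_zero gD]) auto
  qed (simp_all add: integrable_bounded_measurable distrib_right)
  then show ?thesis using A B by (simp add: cesaro_null_def pairing_indicator)
qed

text \<open>A single coordinate is standard normal; its cosine transform exp (- n^2 / 2) is
  summable, so \<open>no_atom_if_average_tendsto_0\<close> applies.\<close>

lemma gauss_law_no_atom: "emeasure gauss_law {x} = 0"
proof -
  interpret prob_space gauss_law by (rule prob_space_gauss_law)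
  let ?\<sigma> = "distr gauss_law borel (\<lambda>x. x 0)"
  interpret \<sigma>: real_distribution ?\<sigma> by (rule real_distribution_distr) measurable
  have "(\<integral>y. cos (real n * y) \<partial>?\<sigma>) = exp (- (real n)\<^sup>2 / 2)" for n
    using integral_cos_gauss_law[of "{()}" "\<lambda>_. real n" "\<lambda>_. 0" 0]
    by (subst integral_distr) (simp_all add: power2_eq_square)
  moreover have "cesaro_null (\<lambda>n. exp (- (real n)\<^sup>2 / 2))"
    unfolding cesaro_null_def
  proof (rule Lim_null_comparison[OF always_eventually], intro allI)
    fix N
    have "(\<Sum>n<N. \<bar>exp (- (real n)\<^sup>2 / 2)\<bar>) \<le> (\<Sum>n<N. exp (- 1 / 2) ^ n)"
    proof (rule sum_mono)
      fix n :: nat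
      have "n \<le> n\<^sup>2" by (metis le_square power2_eq_square)
      then have "real n \<le> (real n)\<^sup>2" by (metis of_nat_le_iff of_nat_power)
      then show "\<bar>exp (- (real n)\<^sup>2 / 2)\<bar> \<le> exp (- 1 / 2) ^ n"
        by (simp add: exp_of_nat_mult[symmetric])
    qed
    also have "\<dots> \<le> (\<Sum>n. exp (- 1 / 2 :: real) ^ n)" by (intro sum_le_suminf summable_geometric) auto
    finally show "norm ((\<Sum>n<N. \<bar>exp (- (real n)\<^sup>2 / 2)\<bar>) / real N) \<le> (\<Sum>n. exp (- 1 / 2 :: real) ^ n) / real N"
      by (simp add: divide_right_mono sum_nonneg)
  qed (rule lim_const_over_n)
  ultimately have "measure ?\<sigma> {x 0} = 0"
    by (intro no_atom_if_average_tendsto_0 \<sigma>.real_distribution_axioms) (simp add: cesaro_null_def)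
  then have "measure gauss_law ((\<lambda>y. y 0) -` {x 0}) = 0" by (simp add: measure_distr)
  then have 0: "emeasure gauss_law ((\<lambda>y. y 0) -` {x 0}) = 0" by (simp add: emeasure_eq_measure)
  have "(\<lambda>y. y 0) -` {x 0} \<inter> space gauss_law \<in> sets gauss_law" by (rule measurable_sets[of _ _ borel]) auto
  then have "emeasure gauss_law {x} \<le> emeasure gauss_law ((\<lambda>y. y 0) -` {x 0})" by (intro emeasure_mono) auto
  then show ?thesis using 0 by simp
qed

end

section \<open>IP-rigidity of the Gaussian shift\<close>

context lacunary_arithmetic
begin

lemma summable_total: "summable (\<lambda>i. \<Sum>k. idist (real (b (Suc i)) * t k))"
  and sum_idist_total_le: "(\<Sum>k<K. idist (real (b (Suc i)) * t k)) \<le> (\<Sum>k. idist (real (b (Suc i)) * t k))"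
proof -
  have s: "summable (\<lambda>k. idist (real (b (Suc i)) * t k))" for i
  proof (rule summable_comparison_test'[of "\<lambda>k. (1/2) ^ k" 0])
    show "norm (idist (real (b (Suc i)) * t k)) \<le> (1/2) ^ k" for k
      using sum_idist_le[of k "Suc i"] sum_nonneg[of "{..<i}" "\<lambda>i. idist (real (b (Suc i)) * t k)"] by (simp add: infdist_nonneg)
  qed (auto intro: summable_geometric)
  show "(\<Sum>k<K. idist (real (b (Suc i)) * t k)) \<le> (\<Sum>k. idist (real (b (Suc i)) * t k))"
    by (rule sum_le_suminf[OF s]) (auto simp: infdist_nonneg)
  have "(\<Sum>i<N. \<Sum>k. idist (real (b (Suc i)) * t k)) \<le> 2" for N
  proof (rule LIMSEQ_le_const2)
    show "(\<lambda>K. \<Sum>i<N. \<Sum>k<K. idist (real (b (Suc i)) * t k)) \<longlonglongrightarrow> (\<Sum>i<N. \<Sum>k. idist (real (b (Suc i)) * t k))"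
      by (intro tendsto_sum summable_LIMSEQ s)
  qed (auto intro: sum_sum_idist_le)
  then show "summable (\<lambda>i. \<Sum>k. idist (real (b (Suc i)) * t k))"
    by (intro summableI_nonneg_bounded[where x = 2]) (auto intro!: suminf_nonneg s infdist_nonneg)
qed

text \<open>The change of the covariance is at most a sum over F of terms of one convergent series,
  hence small with its tail, whatever the size of F.\<close>

lemma tendsto_cov_IP: "((\<lambda>F. cov (m + int (\<Sum>j\<in>F. b j))) \<longlongrightarrow> cov m) Min_at_top"
  unfolding tendsto_Min_at_top_iff
proof (intro allI impI)
  fix \<epsilon> :: real assume "0 < \<epsilon>"
  \<comment> \<open>The index is off by one: \<open>b j\<close> belongs to \<open>e (j - 1)\<close>,
    so a tail from M on requires \<open>Suc M <= Min F\<close>.\<close>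
  define e where "e i = (\<Sum>k. idist (real (b (Suc i)) * t k))" for i
  have e_nonneg: "0 \<le> e i" for i using sum_idist_total_le[where K = 0 and i = i] by (simp add: e_def)
  have "summable e" using summable_total unfolding e_def[symmetric] .
  moreover have "0 < \<epsilon> / (2 * pi)" using \<open>0 < \<epsilon>\<close> by simp
  ultimately obtain M where M: "\<And>m n. M \<le> m \<Longrightarrow> norm (sum e {m..<n}) < \<epsilon> / (2 * pi)"
    unfolding summable_Cauchy by blast
  show "\<exists>N. \<forall>F\<in>fin_subsets. N \<le> Min F \<longrightarrow> \<bar>cov (m + int (\<Sum>j\<in>F. b j)) - cov m\<bar> < \<epsilon>"
  proof (intro exI ballI impI)
    fix F assume F: "F \<in> fin_subsets" "Suc M \<le> Min F"
    have fin: "finite F" "F \<noteq> {}" using F by (auto simp: fin_subsets_def)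
    have ge: "Suc M \<le> j" if "j \<in> F" for j using F(2) fin that by (meson Min_le order_trans)
    have "\<bar>cov (m + int (\<Sum>j\<in>F. b j)) - cov m\<bar> \<le> 2 * pi * (\<Sum>j\<in>F. e (j - 1))"
    proof (rule abs_cov_diff_le)
      fix K
      have "(\<Sum>k<K. idist (of_int (int (\<Sum>j\<in>F. b j)) * t k)) \<le> (\<Sum>k<K. \<Sum>j\<in>F. idist (real (b j) * t k))"
        by (intro sum_mono) (simp add: sum_distrib_right idist_sum_le)
      also have "\<dots> = (\<Sum>j\<in>F. \<Sum>k<K. idist (real (b j) * t k))" by (rule sum.swap)
      also have "\<dots> \<le> (\<Sum>j\<in>F. e (j - 1))"
      proof (rule sum_mono)
        fix j assume "j \<in> F"
        then have "j = Suc (j - 1)" using ge[of j] by simp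
        then show "(\<Sum>k<K. idist (real (b j) * t k)) \<le> e (j - 1)"
          using sum_idist_total_le[where K = K and i = "j - 1"] by (simp add: e_def)
      qed
      finally show "(\<Sum>k<K. idist (of_int (int (\<Sum>j\<in>F. b j)) * t k)) \<le> (\<Sum>j\<in>F. e (j - 1))" .
    qed
    also have "(\<Sum>j\<in>F. e (j - 1)) = sum e ((\<lambda>j. j - 1) ` F)"
    proof (rule sum.reindex[symmetric, unfolded comp_def])
      show "inj_on (\<lambda>j. j - 1) F" using ge by (intro inj_onI) (metis Suc_le_D diff_Suc_1)
    qed
    also have "\<dots> \<le> sum e {M..<Max F}"
    proof (rule sum_mono2)
      show "(\<lambda>j. j - 1) ` F \<subseteq> {M..<Max F}"
      proof
        fix i assume "i \<in> (\<lambda>j. j - 1) ` F"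
        then obtain j where j: "j \<in> F" "i = j - 1" by auto
        then show "i \<in> {M..<Max F}" using ge[OF j(1)] Max_ge[OF fin(1) j(1)] by auto
      qed
    qed (auto simp: e_nonneg)
    also have "\<dots> < \<epsilon> / (2 * pi)" using M[of M "Max F"] by auto
    finally show "\<bar>cov (m + int (\<Sum>j\<in>F. b j)) - cov m\<bar> < \<epsilon>" by (simp add: field_simps)
  qed
qed

lemma tendsto_cross_form_IP:
  "((\<lambda>F. cross_form J c J' c' (int (\<Sum>j\<in>F. b j))) \<longlongrightarrow> cross_form J c J' c' 0) Min_at_top"
proof -
  have eq: "cov (j - (k + i)) = cov ((k - j) + i)" for j k i using cov_minus[of "j - (k + i)"] by (simp add: algebra_simps)
  have "((\<lambda>F. cov ((k - j) + int (\<Sum>j\<in>F. b j))) \<longlongrightarrow> cov ((k - j) + 0)) Min_at_top" for j k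
    using tendsto_cov_IP[of "k - j"] by simp
  then show ?thesis
    unfolding cross_form_def eq by (intro tendsto_sum tendsto_mult_left)
qed

theorem gauss_law_IP_rigid:
  assumes A: "A \<in> sets gauss_law"
  shows "((\<lambda>F. measure gauss_law (A \<inter> (coord_shift ^^ (\<Sum>j\<in>F. b j)) -` A)) \<longlongrightarrow> measure gauss_law A) Min_at_top"
proof -
  let ?L = "\<lambda>f g. \<integral>x. f x * g x \<partial>gauss_law"
  let ?null = "\<lambda>a :: nat \<Rightarrow> real. ((\<lambda>F. a (\<Sum>j\<in>F. b j)) \<longlongrightarrow> 0) Min_at_top"
  have "?null (\<lambda>n. pairing (indicator A) (indicator A) n - ?L (indicator A) (indicator A))"
  proof (rule pairing_null_indicator[of ?null ?L, OF tendsto_add_zero tendsto_mult_right_zero _ _ _ _ abs_integral_mult_le _ A A])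
    fix a :: "nat \<Rightarrow> nat \<Rightarrow> real" and c :: "nat \<Rightarrow> real" and e :: "nat \<Rightarrow> real"
    assume a: "\<And>k. ?null (a k)" and ae: "\<And>k n. \<bar>c n - a k n\<bar> \<le> e k" and e: "e \<longlonglongrightarrow> 0"
    show "?null c"
    proof (rule tendstoI)
      fix \<epsilon> :: real assume \<epsilon>: "0 < \<epsilon>"
      then have "\<forall>\<^sub>F k in sequentially. e k < \<epsilon> / 2" using e by (intro order_tendstoD) auto
      then obtain k where k: "e k < \<epsilon> / 2" by (auto simp: eventually_sequentially)
      have "\<forall>\<^sub>F F in Min_at_top. dist (a k (\<Sum>j\<in>F. b j)) 0 < \<epsilon> / 2" using a[of k] \<epsilon> by (intro tendstoD) auto
      then show "\<forall>\<^sub>F F in Min_at_top. dist (c (\<Sum>j\<in>F. b j)) 0 < \<epsilon>"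
      proof eventually_elim
        case (elim F)
        then show ?case using ae[of "\<Sum>j\<in>F. b j" k] k by (simp add: dist_real_def)
      qed
    qed
  next
    fix J J' :: "int set" and c c' :: "int \<Rightarrow> real" and a a' :: real
    assume J: "finite J" "finite J'"
    let ?f = "\<lambda>x :: int \<Rightarrow> real. cos ((\<Sum>j\<in>J. c j * x j) + a)" and ?g = "\<lambda>x :: int \<Rightarrow> real. cos ((\<Sum>j\<in>J'. c' j * x j) + a')"
    \<comment> \<open>The expected limit is the pairing at shift 0, so convergence of the cross form
      to its value at 0 suffices.\<close>
    have L: "?L ?f ?g = pairing ?f ?g 0" by (simp add: pairing_def)
    have "((\<lambda>F. pairing ?f ?g (\<Sum>j\<in>F. b j)) \<longlongrightarrow> pairing ?f ?g 0) Min_at_top"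
      unfolding pairing_def integral_cos_mult_cos_shift[OF J]
      by (intro tendsto_intros tendsto_cross_form_IP[of J c J' c', folded of_nat_0[where 'a = int]]) auto
    then show "?null (\<lambda>n. pairing ?f ?g n - ?L ?f ?g)" unfolding L by (rule LIM_zero)
  next
    fix f f' g assume fg: "bounded_measurable f" "bounded_measurable f'" "bounded_measurable g"
    show "?L (\<lambda>x. f x + f' x) g = ?L f g + ?L f' g"
      using fg[THEN integrable_bounded_measurable] integrable_pairing[OF fg(1,3), of 0] integrable_pairing[OF fg(2,3), of 0]
      by (simp add: distrib_right)
  qed (simp_all add: mult.commute mult.left_commute)
  moreover have "?L (indicator A) (indicator A) = measure gauss_law A"
    using A by (simp flip: indicator_inter_arith)
  ultimately have "((\<lambda>F. measure gauss_law (A \<inter> (coord_shift ^^ (\<Sum>j\<in>F. b j)) -` A) - measure gauss_law A) \<longlongrightarrow> 0) Min_at_top"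
    by (simp only: pairing_indicator[OF A A])
  then show ?thesis by (rule LIM_zero_cancel)
qed

end

section \<open>Isomorphism of atomless standard Borel probability spaces\<close>

text \<open>Cantor's digits 0 and 2: in contrast to binary expansions, the digits can be recovered
  without ambiguity.\<close>

definition ternary_code :: "(nat \<Rightarrow> bool) \<Rightarrow> real" where
  "ternary_code \<beta> = (\<Sum>n. (if \<beta> n then 2 else 0) / 3 ^ Suc n)"

text \<open>Removes the first n digits. A code is at most 1/3 or at least 2/3 according to its
  leading digit, so 1/2 separates the cases; the map is Borel on the whole line.\<close>

fun ternary_rest :: "nat \<Rightarrow> real \<Rightarrow> real" where
  "ternary_rest 0 y = y"
| "ternary_rest (Suc n) y = 3 * ternary_rest n y - (if 1/2 \<le> ternary_rest n y then 2 else 0)"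

lemma summable_ternary: "summable (\<lambda>n. (if \<beta> n then 2 else 0) / 3 ^ Suc n :: real)"
proof (rule summable_comparison_test'[of "\<lambda>n. (1/3) ^ n" 0])
  show "norm ((if \<beta> n then 2 else 0) / 3 ^ Suc n :: real) \<le> (1/3) ^ n" for n
    by (simp add: power_divide field_simps)
qed (auto intro: summable_geometric)

lemma ternary_code_Suc: "ternary_code \<beta> = (if \<beta> 0 then 2 else 0) / 3 + ternary_code (\<lambda>n. \<beta> (Suc n)) / 3"
proof -
  have "ternary_code \<beta> = (\<Sum>n. (if \<beta> (Suc n) then 2 else 0) / 3 ^ Suc (Suc n)) + (if \<beta> 0 then 2 else 0) / 3"
    unfolding ternary_code_def using suminf_split_head[OF summable_ternary[of \<beta>]] by simp
  also have "(\<Sum>n. (if \<beta> (Suc n) then 2 else 0) / 3 ^ Suc (Suc n)) = (\<Sum>n. (if \<beta> (Suc n) then 2 else 0) / 3 ^ Suc n / (3::real))"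
    by (simp add: field_simps)
  also have "\<dots> = ternary_code (\<lambda>n. \<beta> (Suc n)) / 3"
    unfolding ternary_code_def by (rule suminf_divide[OF summable_ternary])
  finally show ?thesis by simp
qed

lemma ternary_code_bounds: "0 \<le> ternary_code \<beta>" "ternary_code \<beta> \<le> 1"
proof -
  show "0 \<le> ternary_code \<beta>" unfolding ternary_code_def by (intro suminf_nonneg summable_ternary) auto
  have g: "summable (\<lambda>n. (2/3) * (1/3::real) ^ n)" by (intro summable_mult summable_geometric) simp
  have "ternary_code \<beta> \<le> (\<Sum>n. (2/3) * (1/3) ^ n)"
    unfolding ternary_code_def
    by (intro suminf_le summable_ternary g) (auto simp: power_divide field_simps)
  also have "\<dots> = 1" by (subst suminf_mult) (auto simp: suminf_geometric intro: summable_geometric)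
  finally show "ternary_code \<beta> \<le> 1" .
qed

lemma ternary_rest_code: "ternary_rest n (ternary_code \<beta>) = ternary_code (\<lambda>k. \<beta> (n + k))"
proof (induction n)
  case (Suc n)
  let ?\<gamma> = "\<lambda>k. \<beta> (n + k)"
  have "1/2 \<le> ternary_code ?\<gamma> \<longleftrightarrow> \<beta> n"
    using ternary_code_Suc[of ?\<gamma>] ternary_code_bounds[of "\<lambda>k. ?\<gamma> (Suc k)"] by auto
  then show ?case using Suc.IH ternary_code_Suc[of ?\<gamma>] by auto
qed simp

lemma ternary_digit: "1/2 \<le> ternary_rest n (ternary_code \<beta>) \<longleftrightarrow> \<beta> n"
  using ternary_rest_code[of n \<beta>] ternary_code_Suc[of "\<lambda>k. \<beta> (n + k)"] ternary_code_bounds[of "\<lambda>k. \<beta> (n + Suc k)"] by auto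

lemma measurable_ternary_rest [measurable]: "ternary_rest n \<in> borel_measurable borel"
proof (induction n)
  case (Suc n)
  note [measurable] = Suc.IH
  have "(\<lambda>y. 3 * ternary_rest n y - (if 1/2 \<le> ternary_rest n y then 2 else 0)) \<in> borel_measurable borel" by measurable
  then show ?case by simp
qed simp

section \<open>Standard Borel spaces as measurable retracts of the line\<close>

lemma metric_dense_sequence:
  assumes "Metric_space X d" "second_countable (Metric_space.mtopology X d)" "X \<noteq> {}"
  obtains c :: "nat \<Rightarrow> 'a" where "\<And>i. c i \<in> X" "\<And>x e. x \<in> X \<Longrightarrow> 0 < e \<Longrightarrow> \<exists>i. d x (c i) < e"
proof -
  interpret Metric_space X d by fact
  obtain \<B> where \<B>: "countable \<B>" "\<And>V. V \<in> \<B> \<Longrightarrow> openin mtopology V"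
    "\<And>U x. openin mtopology U \<Longrightarrow> x \<in> U \<Longrightarrow> \<exists>V\<in>\<B>. x \<in> V \<and> V \<subseteq> U"
    using assms(2) unfolding second_countable_def by metis
  define C where "C = (\<lambda>V. SOME x. x \<in> V) ` {V \<in> \<B>. V \<noteq> {}}"
  have C: "countable C" using \<B>(1) by (auto simp: C_def)
  have sub: "C \<subseteq> X"
  proof
    fix x assume "x \<in> C"
    then obtain V where V: "V \<in> \<B>" "V \<noteq> {}" "x = (SOME x. x \<in> V)" by (auto simp: C_def)
    then have "x \<in> V" by (simp add: some_in_eq)
    then show "x \<in> X" using openin_subset[OF \<B>(2)[OF V(1)]] by auto
  qed
  have dense: "\<exists>y\<in>C. d x y < e" if "x \<in> X" "0 < e" for x e
  proof -
    have "x \<in> mball x e" using that by simp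
    then obtain V where V: "V \<in> \<B>" "x \<in> V" "V \<subseteq> mball x e" using \<B>(3)[OF openin_mball] by blast
    then have "(SOME x. x \<in> V) \<in> V" by (auto simp: some_in_eq)
    then have "(SOME x. x \<in> V) \<in> C" "(SOME x. x \<in> V) \<in> mball x e" using V by (auto simp: C_def)
    then show ?thesis by (auto simp: mball_def)
  qed
  have "C \<noteq> {}" using dense[of _ 1] assms(3) by fastforce
  then have r: "range (from_nat_into C) = C" using C by (rule range_from_nat_into)
  show thesis
  proof (rule that[of "from_nat_into C"])
    show "from_nat_into C i \<in> X" for i using r sub by blast
    show "\<exists>i. d x (from_nat_into C i) < e" if "x \<in> X" "0 < e" for x e using dense[OF that] r by (metis rangeE)
  qed
qed

text \<open>
  A point is coded by the set of balls \<open>B(c\<^sub>i, 2\<^sup>-\<^sup>k)\<close> containing it; for the decoding one takes for each \<open>k\<close>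
  the first of the balls of radius \<open>2\<^sup>-\<^sup>k\<close>, and the limit of their centres. The measurable left inverse
  replaces the Lusin-Souslin theorem.
\<close>

lemma standard_borel_retract:
  assumes "standard_borel M" "space M \<noteq> {}"
  obtains u :: "'a \<Rightarrow> real" and w where "u \<in> borel_measurable M" "w \<in> borel \<rightarrow>\<^sub>M M" "\<And>x. x \<in> space M \<Longrightarrow> w (u x) = x"
proof -
  obtain S where S: "topspace S = space M" "completely_metrizable_space S" "second_countable S"
    "sets M = sigma_sets (space M) {U. openin S U}"
    using assms(1) unfolding standard_borel_def by blast
  obtain X d where X: "Metric_space X d" "Metric_space.mcomplete X d" "S = Metric_space.mtopology X d"
    using S(2) unfolding completely_metrizable_space_def by blast
  interpret Metric_space X d by fact
  have XM: "X = space M" using S(1) X(3) by simp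
  have open_sets: "U \<in> sets M" if "openin mtopology U" for U
    using that S(4) X(3) by (auto intro: sigma_sets.Basic)
  obtain c :: "nat \<Rightarrow> 'a" where c: "\<And>i. c i \<in> X" "\<And>x e. x \<in> X \<Longrightarrow> 0 < e \<Longrightarrow> \<exists>i. d x (c i) < e"
    using metric_dense_sequence[OF X(1)] S(3) X(3) assms(2) XM by metis
  define u where "u x = ternary_code (\<lambda>n. case prod_decode n of (i, k) \<Rightarrow> x \<in> mball (c i) ((1/2) ^ k))" for x
  define hit where "hit i k y \<longleftrightarrow> 1/2 \<le> ternary_rest (prod_encode (i, k)) y" for i k y
  \<comment> \<open>If y codes no point there may be no hit; \<open>LEAST\<close> then yields some
    fixed index.\<close>
  define f where "f k y = (LEAST i. hit i k y)" for k y
  define s where "s k y = c (f k y)" for k y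
  \<comment> \<open>A countable, hence measurable, condition that forces a Cauchy sequence. It holds
    on the codes, where \<open>s k\<close> lies within 2^(-k) of the point; elsewhere
    \<open>w\<close> is set to \<open>c 0\<close> to be total.\<close>
  define D where "D y \<longleftrightarrow> (\<forall>k l. k \<le> l \<longrightarrow> d (s k y) (s l y) < 2 * (1/2) ^ k)" for y
  define w where "w y = (if D y then (SOME x. limitin mtopology (\<lambda>k. s k y) x sequentially) else c 0)" for y
  have sX: "s k y \<in> X" for k y by (simp add: s_def c)
  have hit_u: "hit i k (u x) \<longleftrightarrow> x \<in> mball (c i) ((1/2) ^ k)" for i k x
    unfolding hit_def u_def ternary_digit by simp
  have pow: "\<exists>k. (1/2::real) ^ k < e" if "0 < e" for e using real_arch_pow_inv[OF that, of "1/2"] by simp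
  have lim_w: "limitin mtopology (\<lambda>k. s k y) (w y) sequentially" if "D y" for y
  proof -
    have "MCauchy (\<lambda>k. s k y)"
      unfolding MCauchy_def
    proof (intro conjI allI impI)
      fix e :: real assume "0 < e"
      then obtain N where N: "(1/2::real) ^ N < e / 2" using pow[of "e / 2"] by auto
      have mono: "(1/2::real) ^ m \<le> (1/2) ^ N" if "N \<le> m" for m using that by (intro power_decreasing) auto
      show "\<exists>N. \<forall>n n'. N \<le> n \<longrightarrow> N \<le> n' \<longrightarrow> d (s n y) (s n' y) < e"
      proof (intro exI allI impI)
        fix m n assume mn: "N \<le> m" "N \<le> n"
        have "d (s m y) (s n y) < 2 * (1/2) ^ min m n"
        proof (cases "m \<le> n")
          case True
          then show ?thesis using that by (simp add: D_def min_def)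
        next
          case False
          then have "d (s n y) (s m y) < 2 * (1/2) ^ n" using that by (simp add: D_def)
          then show ?thesis using False by (simp add: commute[of "s m y"] min_def)
        qed
        moreover have "N \<le> min m n" using mn by simp
        then have "(1/2::real) ^ min m n \<le> (1/2) ^ N" by (rule mono)
        ultimately show "d (s m y) (s n y) < e" using N by linarith
      qed
    qed (use sX in auto)
    then have "\<exists>x. limitin mtopology (\<lambda>k. s k y) x sequentially" using X(2) unfolding mcomplete_def by blast
    then have "limitin mtopology (\<lambda>k. s k y) (SOME x. limitin mtopology (\<lambda>k. s k y) x sequentially) sequentially"
      by (rule someI_ex)
    moreover have "w y = (SOME x. limitin mtopology (\<lambda>k. s k y) x sequentially)" using that by (simp add: w_def)
    ultimately show ?thesis by simp
  qed
  have wX: "w y \<in> X" for y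
  proof (cases "D y")
    case True
    then show ?thesis using lim_w[OF True] by (simp add: limit_metric_sequentially)
  qed (simp add: w_def c)
  have w_u: "w (u x) = x" if x: "x \<in> X" for x
  proof -
    have near: "d (s k (u x)) x < (1/2) ^ k" for k
    proof -
      obtain i where "d x (c i) < (1/2) ^ k" using c(2)[OF x, of "(1/2) ^ k"] by auto
      then have "hit i k (u x)" using x c(1) by (simp add: hit_u commute[of "c i" x])
      then have "hit (f k (u x)) k (u x)" unfolding f_def by (rule LeastI)
      then show ?thesis by (simp add: hit_u s_def)
    qed
    have "D (u x)"
      unfolding D_def
    proof (intro allI impI)
      fix k l :: nat assume "k \<le> l"
      then have "(1/2::real) ^ l \<le> (1/2) ^ k" by (intro power_decreasing) auto
      moreover have "d (s k (u x)) (s l (u x)) \<le> d (s k (u x)) x + d x (s l (u x))" using x sX by (intro triangle)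
      ultimately show "d (s k (u x)) (s l (u x)) < 2 * (1/2) ^ k"
        using near[of k] near[of l] commute[of x "s l (u x)"] by linarith
    qed
    then have 1: "limitin mtopology (\<lambda>k. s k (u x)) (w (u x)) sequentially" by (rule lim_w)
    have "limitin mtopology (\<lambda>k. s k (u x)) x sequentially"
      unfolding limit_metric_sequentially
    proof (intro conjI allI impI x)
      fix e :: real assume "0 < e"
      then obtain N where N: "(1/2::real) ^ N < e" using pow by auto
      show "\<exists>N. \<forall>n\<ge>N. s n (u x) \<in> X \<and> d (s n (u x)) x < e"
      proof (intro exI allI impI conjI sX)
        fix n assume "N \<le> n"
        then have "(1/2::real) ^ n \<le> (1/2) ^ N" by (intro power_decreasing) auto
        then show "d (s n (u x)) x < e" using near[of n] N by linarith
      qed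
    qed
    then show ?thesis using limitin_metric_unique[OF 1] by simp
  qed
  have u_meas: "u \<in> borel_measurable M"
  proof -
    have [measurable]: "mball (c i) r \<in> sets M" for i r by (intro open_sets) simp
    have "(\<lambda>x. (if case prod_decode n of (i, k) \<Rightarrow> x \<in> mball (c i) ((1/2) ^ k) then 2 else 0) / 3 ^ Suc n :: real) \<in> borel_measurable M" for n
      by (cases "prod_decode n") (simp only: prod.case, measurable)
    then show ?thesis unfolding u_def[abs_def] ternary_code_def by (rule borel_measurable_suminf)
  qed
  have f_meas [measurable]: "f k \<in> borel \<rightarrow>\<^sub>M count_space UNIV" for k
    unfolding f_def[abs_def] hit_def by measurable
  have dist_meas: "(\<lambda>y. d a (s k y)) \<in> borel_measurable borel" for a k
    unfolding s_def by (rule measurable_compose_countable[OF _ f_meas]) simp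
  have dist2_meas [measurable]: "(\<lambda>y. d (s k y) (s l y)) \<in> borel_measurable borel" for k l
    unfolding s_def
    by (rule measurable_compose_countable[OF _ f_meas[of k], where f = "\<lambda>i y. d (c i) (c (f l y))"])
      (rule dist_meas[unfolded s_def])
  have D_meas [measurable]: "Measurable.pred borel D"
    unfolding D_def[abs_def] by measurable
  \<comment> \<open>Distances are real-valued, so measurability can pass to the limit defining
    \<open>w\<close>; the countably many distances to the centres then give that of
    \<open>w\<close>.\<close>
  have dw_meas: "(\<lambda>y. d a (w y)) \<in> borel_measurable borel" if a: "a \<in> X" for a
  proof (rule borel_measurable_LIMSEQ_real[where u = "\<lambda>k y. if D y then d a (s k y) else d a (c 0)"])
    show "(\<lambda>k. if D y then d a (s k y) else d a (c 0)) \<longlonglongrightarrow> d a (w y)" for y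
    proof (cases "D y")
      case True
      have "(\<lambda>k. d a (s k y) - d a (w y)) \<longlonglongrightarrow> 0"
      proof (rule LIMSEQ_I)
        fix e :: real assume "0 < e"
        then obtain N where N: "\<And>n. N \<le> n \<Longrightarrow> d (s n y) (w y) < e"
          using lim_w[OF True] unfolding limit_metric_sequentially by blast
        have "\<bar>d a (s n y) - d a (w y)\<bar> < e" if "N \<le> n" for n
          using N[OF that] triangle[OF a sX[of n y] wX[of y]] triangle[OF a wX[of y] sX[of n y]] commute[of "w y" "s n y"] by linarith
        then show "\<exists>N. \<forall>n\<ge>N. norm (d a (s n y) - d a (w y) - 0) < e" by auto
      qed
      then show ?thesis using True by (simp add: LIM_zero_iff)
    next
      case False
      then show ?thesis by (simp add: w_def)
    qed
    show "(\<lambda>y. if D y then d a (s k y) else d a (c 0)) \<in> borel_measurable borel" for k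
      using dist_meas[of a k] by measurable
  qed
  have w_meas: "w \<in> borel \<rightarrow>\<^sub>M M"
  proof (rule measurable_sigma_sets[OF S(4)])
    show "{U. openin S U} \<subseteq> Pow (space M)" using openin_subset S(1) by auto
    show "w \<in> space borel \<rightarrow> space M" using wX XM by auto
    fix U assume "U \<in> {U. openin S U}"
    then have U: "openin mtopology U" using X(3) by simp
    \<comment> \<open>An open set is the union of the coding balls it contains; radii below r / 2
      keep a ball around a nearby centre inside the ball of radius r.\<close>
    have "w -` U \<inter> space borel = (\<Union>(i, k)\<in>{(i, k). mball (c i) ((1/2) ^ k) \<subseteq> U}. {y. d (c i) (w y) < (1/2) ^ k})"
    proof (intro equalityI subsetI)
      fix y assume "y \<in> w -` U \<inter> space borel"
      then obtain r where r: "0 < r" "mball (w y) r \<subseteq> U" using U unfolding openin_mtopology by auto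
      obtain k where k: "(1/2::real) ^ k < r / 2" using pow[of "r / 2"] r(1) by auto
      obtain i where i: "d (w y) (c i) < (1/2) ^ k" using c(2)[OF wX, of "(1/2) ^ k" y] by auto
      have "mball (c i) ((1/2) ^ k) \<subseteq> U"
      proof
        fix z assume "z \<in> mball (c i) ((1/2) ^ k)"
        then have z: "z \<in> X" "d (c i) z < (1/2) ^ k" by auto
        have "d (w y) z \<le> d (w y) (c i) + d (c i) z" using wX c(1) z(1) by (rule triangle)
        then have "d (w y) z < r" using z(2) i k by simp
        then show "z \<in> U" using r(2) z(1) wX by auto
      qed
      then show "y \<in> (\<Union>(i, k)\<in>{(i, k). mball (c i) ((1/2) ^ k) \<subseteq> U}. {y. d (c i) (w y) < (1/2) ^ k})"
        using i by (auto simp: commute[of "w y"])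
    next
      fix y assume "y \<in> (\<Union>(i, k)\<in>{(i, k). mball (c i) ((1/2) ^ k) \<subseteq> U}. {y. d (c i) (w y) < (1/2) ^ k})"
      then obtain i k where "mball (c i) ((1/2) ^ k) \<subseteq> U" "d (c i) (w y) < (1/2) ^ k" by auto
      then show "y \<in> w -` U \<inter> space borel" using wX[of y] c(1)[of i] by auto
    qed
    also have "\<dots> \<in> sets borel"
    proof (rule sets.countable_UN'', simp, safe)
      fix i k
      have [measurable]: "(\<lambda>y. d (c i) (w y)) \<in> borel_measurable borel" by (rule dw_meas[OF c(1)])
      show "{y. d (c i) (w y) < (1/2) ^ k} \<in> sets borel" by measurable
    qed
    finally show "w -` U \<inter> space borel \<in> sets borel" .
  qed
  show thesis using that[OF u_meas w_meas] w_u XM by blast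
qed


section \<open>Isomorphism modulo null sets with the unit interval\<close>

definition iso_mod_null :: "'a measure \<Rightarrow> 'b measure \<Rightarrow> ('a \<Rightarrow> 'b) \<Rightarrow> ('b \<Rightarrow> 'a) \<Rightarrow> bool" where
  "iso_mod_null M N p q \<longleftrightarrow> p \<in> M \<rightarrow>\<^sub>M N \<and> q \<in> N \<rightarrow>\<^sub>M M \<and> distr M N p = N \<and> distr N M q = M \<and>
     (AE x in M. q (p x) = x) \<and> (AE y in N. p (q y) = y)"

lemma iso_mod_null_AE:
  assumes "iso_mod_null M N p q" "AE y in N. P y"
  shows "AE x in M. P (p x)"
proof -
  have p: "p \<in> M \<rightarrow>\<^sub>M N" "distr M N p = N" using assms(1) unfolding iso_mod_null_def by blast+
  show ?thesis by (rule AE_distrD[OF p(1)]) (unfold p(2), rule assms(2))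
qed

lemma iso_mod_null_sym: "iso_mod_null M N p q \<Longrightarrow> iso_mod_null N M q p"
  by (auto simp: iso_mod_null_def)

lemma iso_mod_null_trans:
  assumes 1: "iso_mod_null M N p q" and 2: "iso_mod_null N K p' q'"
  shows "iso_mod_null M K (\<lambda>x. p' (p x)) (\<lambda>z. q (q' z))"
proof -
  note m = 1[unfolded iso_mod_null_def] 2[unfolded iso_mod_null_def]
  have [measurable]: "p \<in> M \<rightarrow>\<^sub>M N" "q \<in> N \<rightarrow>\<^sub>M M" "p' \<in> N \<rightarrow>\<^sub>M K" "q' \<in> K \<rightarrow>\<^sub>M N" using m by auto
  have "distr M K (\<lambda>x. p' (p x)) = distr (distr M N p) K p'" by (simp add: distr_distr comp_def)
  moreover have "distr K M (\<lambda>z. q (q' z)) = distr (distr K N q') M q" by (simp add: distr_distr comp_def)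
  moreover have "AE x in M. q (q' (p' (p x))) = x"
    using iso_mod_null_AE[OF 1, of "\<lambda>y. q' (p' y) = y"] m by auto
  moreover have "AE z in K. p' (p (q (q' z))) = z"
    using iso_mod_null_AE[OF iso_mod_null_sym[OF 2], of "\<lambda>y. p (q y) = y"] m by auto
  ultimately show ?thesis using m unfolding iso_mod_null_def by auto
qed

text \<open>Lebesgue measure on (0,1) viewed on the whole line, so that a distribution function,
  which may take the values 0 and 1, maps into its space.\<close>

definition unit_lebesgue :: "real measure" where
  "unit_lebesgue = distr (restrict_space lborel {0<..<1}) borel (\<lambda>x. x)"

lemma measurable_unit_restrict: "(\<lambda>x. x) \<in> restrict_space lborel {0<..<1::real} \<rightarrow>\<^sub>M borel"
  by (rule measurable_restrict_space1) simp

lemma sets_unit_lebesgue [simp, measurable_cong]: "sets unit_lebesgue = sets borel"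
  by (simp add: unit_lebesgue_def)

lemma AE_unit_lebesgue: "AE x in unit_lebesgue. x \<in> {0<..<1}"
  unfolding unit_lebesgue_def using measurable_unit_restrict
  by (subst AE_distr_iff) (auto intro!: AE_I2 simp: space_restrict_space)

text \<open>The quantile transform: the generalised inverse \<open>I\<close> of the distribution
  function carries Lebesgue measure to Q. Without atoms the distribution function is continuous and
  hence a left inverse of \<open>I\<close>.\<close>

lemma atomless_real_iso:
  assumes Q: "real_distribution Q" and atomless: "\<And>y. measure Q {y} = 0"
  obtains q where "iso_mod_null Q unit_lebesgue (cdf Q) q"
proof -
  interpret cdf_distribution Q by (intro cdf_distribution.intro Q)
  \<comment> \<open>\<open>I\<close> extended by 0 to a Borel function on the line.\<close>
  define J where "J \<omega> = indicator {0<..<1} \<omega> *\<^sub>R I \<omega>" for \<omega>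
  have J_meas [measurable]: "J \<in> borel_measurable borel"
    using measurable_CI unfolding J_def[abs_def] by (subst (asm) borel_measurable_restrict_space_iff) auto
  have J_u: "J \<in> borel_measurable unit_lebesgue"
    by (subst measurable_cong_sets[OF sets_unit_lebesgue refl]) (rule J_meas)
  have J_distr: "distr unit_lebesgue borel J = Q"
  proof -
    have "distr unit_lebesgue borel J = distr (restrict_space lborel {0<..<1}) borel J"
      unfolding unit_lebesgue_def using measurable_unit_restrict J_meas by (subst distr_distr) (auto simp: comp_def)
    also have "\<dots> = distr (restrict_space lborel {0<..<1}) borel I"
      by (rule distr_cong) (auto simp: J_def space_restrict_space)
    finally show ?thesis by (simp add: distr_I_eq_M)
  qed
  have cont: "isCont (cdf Q) x" for x using isCont_cdf atomless by simp
  have C_J: "cdf Q (J \<omega>) = \<omega>" if \<omega>: "\<omega> \<in> {0<..<1}" for \<omega>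
  proof (rule antisym)
    have J: "J \<omega> = I \<omega>" using \<omega> by (simp add: J_def)
    show "\<omega> \<le> cdf Q (J \<omega>)" using pseudoinverse[of \<omega> "I \<omega>"] \<omega> J by simp
    \<comment> \<open>To the left of \<open>I \<omega>\<close> the distribution function is below
      \<omega>; continuity carries the bound to \<open>I \<omega>\<close> itself.\<close>
    have "(\<lambda>n. cdf Q (I \<omega> - 1 / real (Suc n))) \<longlonglongrightarrow> cdf Q (I \<omega> - 0)"
      by (intro isCont_tendsto_compose[OF cont] tendsto_intros LIMSEQ_Suc[OF lim_const_over_n])
    moreover have "cdf Q (I \<omega> - 1 / real (Suc n)) \<le> \<omega>" for n
      using pseudoinverse[of \<omega> "I \<omega> - 1 / real (Suc n)"] \<omega> by (auto simp: not_le intro: less_imp_le)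
    ultimately show "cdf Q (J \<omega>) \<le> \<omega>" unfolding J by (intro LIMSEQ_le_const2) auto
  qed
  have AE_CJ: "AE \<omega> in unit_lebesgue. cdf Q (J \<omega>) = \<omega>"
    using AE_unit_lebesgue by eventually_elim (rule C_J)
  have "AE \<omega> in unit_lebesgue. J (cdf Q (J \<omega>)) = J \<omega>" using AE_CJ by auto
  moreover have "{y \<in> space borel. J (cdf Q y) = y} \<in> sets borel" by measurable
  ultimately have "AE y in distr unit_lebesgue borel J. J (cdf Q y) = y"
    by (subst AE_distr_iff[OF J_u])
  then have AE_JC: "AE y in Q. J (cdf Q y) = y" unfolding J_distr .
  have "distr Q unit_lebesgue (cdf Q) = distr (distr unit_lebesgue borel J) borel (cdf Q)"
    unfolding J_distr by (rule distr_cong[OF refl sets_unit_lebesgue refl])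
  also have "\<dots> = distr unit_lebesgue borel (\<lambda>\<omega>. cdf Q (J \<omega>))" by (simp add: distr_distr comp_def)
  also have "\<dots> = distr unit_lebesgue unit_lebesgue (\<lambda>\<omega>. \<omega>)"
    by (rule distr_cong_AE[OF refl _ AE_CJ]) auto
  finally have "distr Q unit_lebesgue (cdf Q) = unit_lebesgue" by simp
  moreover have "distr unit_lebesgue Q J = Q"
    using J_distr by (subst distr_cong[OF refl _ refl, of Q borel]) auto
  moreover have "cdf Q \<in> Q \<rightarrow>\<^sub>M unit_lebesgue" "J \<in> unit_lebesgue \<rightarrow>\<^sub>M Q" by measurable
  ultimately have "iso_mod_null Q unit_lebesgue (cdf Q) J"
    using AE_CJ AE_JC unfolding iso_mod_null_def by auto
  then show thesis by (rule that)
qed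

text \<open>The law Q of u is atomless because the fibre over y lies in {w y}. The maps u and w are
  inverse modulo null sets, since u (w y) = y on the range of u, which carries Q.\<close>

theorem standard_borel_iso_unit:
  assumes "prob_space M" "standard_borel M" "\<And>x. x \<in> space M \<Longrightarrow> emeasure M {x} = 0"
  obtains p q where "iso_mod_null M unit_lebesgue p q"
proof -
  interpret prob_space M by fact
  obtain u :: "'a \<Rightarrow> real" and w where uw: "u \<in> borel_measurable M" "w \<in> borel \<rightarrow>\<^sub>M M" "\<And>x. x \<in> space M \<Longrightarrow> w (u x) = x"
    using standard_borel_retract[OF assms(2) not_empty] by blast
  note [measurable] = uw(1,2)
  define Q where "Q = distr M borel u"
  have Q: "real_distribution Q" unfolding Q_def by (rule real_distribution_distr) measurable
  have sQ [measurable_cong]: "sets Q = sets borel" by (simp add: Q_def)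
  have "measure Q {y} = 0" for y
  proof -
    have "u -` {y} \<inter> space M \<subseteq> {w y}" using uw(3) by auto
    then have "u -` {y} \<inter> space M = {} \<or> u -` {y} \<inter> space M = {w y}" by (rule subset_singletonD)
    then have "emeasure M (u -` {y} \<inter> space M) = 0"
    proof
      assume eq: "u -` {y} \<inter> space M = {w y}"
      then have "w y \<in> space M" by (metis Int_iff insertI1)
      then show ?thesis unfolding eq by (rule assms(3))
    qed simp
    then show ?thesis unfolding Q_def by (subst measure_distr) (auto simp: measure_def)
  qed
  then obtain I where I: "iso_mod_null Q unit_lebesgue (cdf Q) I" using atomless_real_iso[OF Q] by blast
  have "iso_mod_null M Q u w"
    unfolding iso_mod_null_def
  proof (intro conjI)
    show "distr M Q u = Q" unfolding Q_def by (rule distr_cong) auto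
    have "distr Q M w = distr M M (\<lambda>x. w (u x))" unfolding Q_def by (simp add: distr_distr comp_def)
    also have "\<dots> = distr M M (\<lambda>x. x)" by (rule distr_cong) (auto simp: uw(3))
    finally show "distr Q M w = M" by simp
    show "AE x in M. w (u x) = x" using uw(3) by (intro AE_I2)
    show "AE y in Q. u (w y) = y" unfolding Q_def by (subst AE_distr_iff) (auto simp: uw(3))
  qed measurable
  then show thesis using iso_mod_null_trans[OF _ I] that by blast
qed

lemma AE_full_set:
  assumes "AE x in M. P x"
  obtains E where "E \<in> sets M" "AE x in M. x \<in> E" "\<And>x. x \<in> E \<Longrightarrow> x \<in> space M \<and> P x"
proof -
  obtain N where N: "\<And>x. x \<in> space M - N \<Longrightarrow> P x" "N \<in> null_sets M" using AE_E3[OF assms] by blast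
  show thesis
  proof (rule that[of "space M - N"])
    show "AE x in M. x \<in> space M - N" using AE_not_in[OF N(2)] AE_space by eventually_elim auto
  qed (use N in auto)
qed

text \<open>
  The flow is transported to the invariant set of full measure on which \<open>p\<close> and \<open>q\<close> are mutually inverse
  along the whole orbit, and extended by the identity.
\<close>

theorem transport_flow:
  fixes s :: "int \<Rightarrow> 'b \<Rightarrow> 'b"
  assumes iso: "iso_mod_null M P p q" and sp: "space P = UNIV"
    and s0: "\<And>y. s 0 y = y" and sadd: "\<And>m n y. s m (s n y) = s (m + n) y"
    and s_meas: "\<And>n. s n \<in> P \<rightarrow>\<^sub>M P" and s_pres: "\<And>n. distr P P (s n) = P"
  obtains T where "T \<in> MPT M"
    "\<And>A B n. A \<in> sets M \<Longrightarrow> B \<in> sets M \<Longrightarrow>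
      measure M (A \<inter> (T ^^ n) -` B) = measure P ((q -` A) \<inter> (s (int n)) -` (q -` B))"
proof -
  note iso' = iso[unfolded iso_mod_null_def]
  have [measurable]: "p \<in> M \<rightarrow>\<^sub>M P" "q \<in> P \<rightarrow>\<^sub>M M" "s n \<in> P \<rightarrow>\<^sub>M P" for n using iso' s_meas by auto
  obtain E where E [measurable]: "E \<in> sets M" and EAE: "AE x in M. x \<in> E" and EP: "\<And>x. x \<in> E \<Longrightarrow> x \<in> space M \<and> q (p x) = x"
    using AE_full_set[where M = M and P = "\<lambda>x. q (p x) = x"] iso' by blast
  obtain E' where E' [measurable]: "E' \<in> sets P" and E'AE: "AE y in P. y \<in> E'" and E'P: "\<And>y. y \<in> E' \<Longrightarrow> y \<in> space P \<and> p (q y) = y"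
    using AE_full_set[where M = P and P = "\<lambda>y. p (q y) = y"] iso' by blast
  \<comment> \<open>All integers n are required, so the set is invariant forwards and backwards; as
    a countable intersection it still has full measure.\<close>
  define X0 where "X0 = {x \<in> space M. x \<in> E \<and> (\<forall>n. s n (p x) \<in> E' \<and> q (s n (p x)) \<in> E)}"
  have [measurable]: "X0 \<in> sets M" unfolding X0_def by measurable
  have AE_s: "AE y in P. R (s n y)" if "AE y in P. R y" for R n
    by (rule AE_distrD[OF s_meas]) (unfold s_pres, rule that)
  have "AE y in P. \<forall>n. s n y \<in> E' \<and> q (s n y) \<in> E"
    using AE_s[OF E'AE] AE_s[OF iso_mod_null_AE[OF iso_mod_null_sym[OF iso] EAE]] by (simp add: AE_all_countable)
  from iso_mod_null_AE[OF iso this] have X0_AE: "AE x in M. x \<in> X0"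
    using EAE AE_space by eventually_elim (auto simp: X0_def)
  have move: "q (s n (p x)) \<in> X0" "p (q (s n (p x))) = s n (p x)" if "x \<in> X0" for x n
  proof -
    show pq: "p (q (s n (p x))) = s n (p x)" using that E'P by (auto simp: X0_def)
    have "q (s n (p x)) \<in> E" using that by (auto simp: X0_def)
    then show "q (s n (p x)) \<in> X0" using that EP unfolding X0_def by (auto simp: pq sadd)
  qed
  have qp: "q (p x) = x" if "x \<in> X0" for x using that EP by (auto simp: X0_def)
  have X0_space: "x \<in> space M" if "x \<in> X0" for x using that by (simp add: X0_def)
  define T where "T n x = (if x \<in> X0 then q (s n (p x)) else x)" for n x
  have T_meas [measurable]: "T n \<in> M \<rightarrow>\<^sub>M M" for n unfolding T_def by measurable
  have TT: "T m (T n x) = T (m + n) x" for m n x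
    using move[of x n] by (auto simp: T_def sadd)
  have T0: "T 0 x = x" for x by (auto simp: T_def s0 qp)
  have T_space: "T n x \<in> space M" if "x \<in> space M" for n x using measurable_space[OF T_meas that] .
  have bij: "bij_betw (T 1) (space M) (space M)"
    by (rule bij_betwI[where g = "T (- 1)"]) (auto simp: TT T0 T_space)
  have inv: "the_inv_into (space M) (T 1) x = T (- 1) x" if "x \<in> space M" for x
    by (rule the_inv_into_f_eq[OF bij_betw_imp_inj_on[OF bij]]) (auto simp: TT T0 T_space that)
  have T_AE: "AE x in M. T n x = q (s n (p x))" for n using X0_AE by eventually_elim (simp add: T_def)
  have T_pres: "distr M M (T n) = M" for n
  proof -
    have "distr M M (T n) = distr M M (\<lambda>x. q (s n (p x)))" by (rule distr_cong_AE[OF refl _ T_AE]) auto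
    also have "\<dots> = distr (distr (distr M P p) P (s n)) M q" by (simp add: distr_distr comp_def)
    also have "\<dots> = M" using iso' s_pres by simp
    finally show ?thesis .
  qed
  have "T 1 \<in> MPT M"
    unfolding MPT_def
  proof (intro CollectI conjI ballI bij T_meas)
    show "the_inv_into (space M) (T 1) \<in> M \<rightarrow>\<^sub>M M"
      using T_meas[of "-1"] by (subst measurable_cong[OF inv])
    show "emeasure M (T 1 -` A \<inter> space M) = emeasure M A" if "A \<in> sets M" for A
      using emeasure_distr[OF T_meas that, of 1] T_pres[of 1] by simp
  qed
  moreover have "measure M (A \<inter> (T 1 ^^ n) -` B) = measure P ((q -` A) \<inter> (s (int n)) -` (q -` B))"
    if A [measurable]: "A \<in> sets M" and B [measurable]: "B \<in> sets M" for A B n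
  proof -
    have pow: "(T 1 ^^ n) = T (int n)"
      by (induction n) (auto simp: T0 TT fun_eq_iff)
    have [measurable]: "q -` A \<in> sets P" "q -` B \<in> sets P"
      using measurable_sets[OF _ A, of q P] measurable_sets[OF _ B, of q P] iso' sp by auto
    have [measurable]: "s (int n) -` (q -` B) \<in> sets P"
      using measurable_sets[OF s_meas, of "q -` B" "int n"] sp by simp
    have "A \<inter> T (int n) -` B = A \<inter> (T (int n) -` B \<inter> space M)" using sets.sets_into_space[OF A] by auto
    then have m: "A \<inter> T (int n) -` B \<in> sets M" using measurable_sets[OF T_meas B] by simp
    let ?D = "(q -` A) \<inter> (s (int n)) -` (q -` B)"
    have "measure M (A \<inter> T (int n) -` B) = measure M (p -` ?D \<inter> space M)"
    proof (rule measure_eq_AE)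
      show "AE x in M. x \<in> A \<inter> T (int n) -` B \<longleftrightarrow> x \<in> p -` ?D \<inter> space M"
        using X0_AE by eventually_elim (auto simp: T_def qp X0_space)
      show "p -` ?D \<inter> space M \<in> sets M" by measurable
    qed (rule m)
    also have "\<dots> = measure (distr M P p) ?D" by (rule measure_distr[symmetric]) auto
    finally show ?thesis using iso' pow by simp
  qed
  ultimately show thesis by (rule that)
qed

lemma non_atomic_singleton:
  assumes "non_atomic M" "x \<in> space M" "emeasure M {x} \<noteq> \<infinity>"
  shows "emeasure M {x} = 0"
proof (rule ccontr)
  assume nz: "emeasure M {x} \<noteq> 0"
  \<comment> \<open>A set outside the sigma-algebra has \<open>emeasure\<close> 0 by
    convention.\<close>
  then have "{x} \<in> sets M" using emeasure_notin_sets by blast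
  then obtain B where "B \<subseteq> {x}" "0 < emeasure M B" "emeasure M B < emeasure M {x}"
    using assms(1) nz unfolding non_atomic_def by (metis gr_zeroI)
  then show False by (auto simp: subset_singleton_iff)
qed

section \<open>Transport to the given space, and the equivalence\<close>

context lacunary_arithmetic
begin

lemma standard_borel_gauss_law: "standard_borel gauss_law"
  unfolding standard_borel_def
proof (intro exI conjI)
  let ?S = "euclidean :: (int \<Rightarrow> real) topology"
  show "topspace ?S = space gauss_law" by simp
  show "completely_metrizable_space ?S" by (rule completely_metrizable_space_euclidean)
  obtain \<B> :: "(int \<Rightarrow> real) set set" where \<B>: "countable \<B>" "\<And>C. C \<in> \<B> \<Longrightarrow> open C" "\<And>S. open S \<Longrightarrow> \<exists>U. U \<subseteq> \<B> \<and> S = \<Union>U"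
    using univ_second_countable by blast
  show "second_countable ?S"
    unfolding second_countable_def
  proof (intro exI conjI ballI allI impI)
    fix U x assume "openin ?S U \<and> x \<in> U"
    then obtain \<U> where "\<U> \<subseteq> \<B>" "U = \<Union>\<U>" "x \<in> U" using \<B>(3)[of U] by auto
    then show "\<exists>V\<in>\<B>. x \<in> V \<and> V \<subseteq> U" by blast
  qed (use \<B> in auto)
  show "sets gauss_law = sigma_sets (space gauss_law) {U. openin ?S U}"
    by (simp add: sets_PiM_equal_borel sets_borel)
qed

text \<open>The given space and \<open>gauss_law\<close> are both matched with
  \<open>unit_lebesgue\<close>. Carrying over the correlations is enough, as weak mixing and, by
  \<open>IP_rigid_autocorr\<close>, rigidity are expressed by them.\<close>

theorem IPRWM_if_lacunary:
  assumes "prob_space M" "standard_borel M" "non_atomic M" "incr_seq b"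
  shows "b \<in> IPRWM M"
proof -
  interpret M: prob_space M by fact
  interpret P: prob_space gauss_law by (rule prob_space_gauss_law)
  obtain p1 q1 where 1: "iso_mod_null M unit_lebesgue p1 q1"
  proof (rule standard_borel_iso_unit[OF assms(1,2)])
    show "emeasure M {x} = 0" if "x \<in> space M" for x
      using non_atomic_singleton[OF assms(3) that] by (simp add: M.emeasure_eq_measure)
  qed (rule that)
  obtain p2 q2 where 2: "iso_mod_null gauss_law unit_lebesgue p2 q2"
    by (rule standard_borel_iso_unit[OF prob_space_gauss_law standard_borel_gauss_law gauss_law_no_atom])
  define p where "p x = q2 (p1 x)" for x
  define q where "q y = q1 (p2 y)" for y
  have iso: "iso_mod_null M gauss_law p q"
    using iso_mod_null_trans[OF 1 iso_mod_null_sym[OF 2]] by (simp add: p_def[abs_def] q_def[abs_def])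
  note iso' = iso[unfolded iso_mod_null_def]
  obtain T where T: "T \<in> MPT M" "\<And>A B n. A \<in> sets M \<Longrightarrow> B \<in> sets M \<Longrightarrow>
      measure M (A \<inter> (T ^^ n) -` B) = measure gauss_law ((q -` A) \<inter> (\<lambda>x i. x (i + int n)) -` (q -` B))"
  proof (rule transport_flow[OF iso, of "\<lambda>n x i. x (i + n)"])
    show "(\<lambda>x i. x (i + n)) \<in> gauss_law \<rightarrow>\<^sub>M gauss_law" for n by (rule measurable_shift_by)
    show "distr gauss_law gauss_law (\<lambda>x i. x (i + n)) = gauss_law" for n by (rule distr_shift_by)
  qed (auto simp: add.assoc)
  have corr: "measure M (A \<inter> (T ^^ n) -` B) = measure gauss_law ((q -` A) \<inter> (coord_shift ^^ n) -` (q -` B))"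
    if "A \<in> sets M" "B \<in> sets M" for A B n
    using T(2)[OF that, of n] by (simp add: shift_funpow[abs_def])
  have qA: "q -` A \<in> sets gauss_law" "measure gauss_law (q -` A) = measure M A" if "A \<in> sets M" for A
  proof -
    show "q -` A \<in> sets gauss_law" using measurable_sets[of q gauss_law M A] iso' that by simp
    have "measure (distr gauss_law M q) A = measure gauss_law (q -` A)" using iso' that by (subst measure_distr) auto
    then show "measure gauss_law (q -` A) = measure M A" using iso' by simp
  qed
  have "weakly_mixing M T"
    unfolding weakly_mixing_def
  proof (intro ballI)
    fix A B assume A: "A \<in> sets M" and B: "B \<in> sets M"
    show "(\<lambda>n. (\<Sum>k<n. \<bar>measure M (A \<inter> (T ^^ k) -` B) - measure M A * measure M B\<bar>) / real n) \<longlonglongrightarrow> 0"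
      using gauss_law_weakly_mixing[OF qA(1)[OF A] qA(1)[OF B]]
      unfolding qA(2)[OF A] qA(2)[OF B] corr[OF A B] .
  qed
  moreover have "IP_rigid M T b"
    unfolding IP_rigid_def
  proof
    fix A assume A: "A \<in> sets M"
    have "((\<lambda>F. 2 * (measure M A - measure gauss_law ((q -` A) \<inter> (coord_shift ^^ (\<Sum>j\<in>F. b j)) -` (q -` A)))) \<longlongrightarrow> 2 * (measure M A - measure M A)) Min_at_top"
      using gauss_law_IP_rigid[OF qA(1)[OF A]] unfolding qA(2)[OF A] by (intro tendsto_intros)
    then show "((\<lambda>F. measure M (sym_diff A ((T ^^ (\<Sum>j\<in>F. b j)) ` A))) \<longlongrightarrow> 0) Min_at_top"
      unfolding IP_rigid_autocorr[OF assms(1) T(1) A] corr[OF A A] by simp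
  qed
  ultimately show ?thesis using T(1) assms(4) unfolding IPRWM_def by blast
qed

end

text \<open>The same lacunary sequence takes (a) to both (b) and (c); (c) implies (d), and
  countability under bounded ratios leads from (b) and from (d) back to (a).\<close>

theorem proposition3:
  fixes M :: "'a measure" and b :: "nat \<Rightarrow> nat"
  assumes "prob_space M" and "standard_borel M" and "non_atomic M"
    and "arithmetic_seq b"
  shows "(limsup (\<lambda>n. ereal (real (b (Suc n)) / real (b n))) = \<infinity> \<longleftrightarrow> uncountable (G 1 b))
       \<and> (uncountable (G 1 b) \<longleftrightarrow> b \<in> IPRWM M)
       \<and> (b \<in> IPRWM M \<longleftrightarrow> uncountable (G 2 b))"
proof -
  let ?a = "limsup (\<lambda>n. ereal (real (b (Suc n)) / real (b n))) = \<infinity>"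
  have "uncountable (G 1 b) \<and> b \<in> IPRWM M" if a: ?a
  proof -
    obtain t where "lacunary_arithmetic t b" using obtain_lacunary_arithmetic[OF assms(4) a] by blast
    then interpret lacunary_arithmetic t b .
    show ?thesis using uncountable_G IPRWM_if_lacunary[OF assms(1-3)] assms(4) by (simp add: arithmetic_seq_def)
  qed
  moreover have ?a if "uncountable (G 1 b)" using that countable_G_if_bounded_ratio[OF assms(4), of 1] by auto
  moreover have ?a if "uncountable (G 2 b)" using that countable_G_if_bounded_ratio[OF assms(4), of 2] by auto
  moreover have "uncountable (G 2 b)" if "b \<in> IPRWM M" using uncountable_G_if_IPRWM[OF assms(1,3) that] .
  ultimately show ?thesis by blast
qed

end
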